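(* Let $w,w'$ be row strict tableaux of type $(i_1,\dots,i_m)$. Then $\widetilde Y_w\cap\widetilde Y_{w'}=\emptyset$ if and only if the circle diagram $CC(w,w')$ contains at least one red circle.
   Context: Setting: $n\ge2k\ge0$; $V$ has basis $e_1,\dots,e_{n-k},f_1,\dots,f_k$; $Ne_i=e_{i-1}$, $Nf_i=f_{i-1}$, $e_0=f_0=0$. For $0<i_1<\dots<i_m=n$, $\widetilde Y=\mathrm{Sp}(i_1,\dots,i_m)$ is the variety of partial flags $F_{i_1}\subset\dots\subset F_{i_m}$ ($\dim F_{i_l}=i_l$) with $NF_{i_l}\subset F_{i_{l-1}}$ ($F_{i_0}=\{0\}$). A row strict tableau of type $(i_1,\dots,i_m)$: two rows (top $n-k$ boxes, bottom $k$), $i_l$ occurring $i_l-i_{l-1}$ times, strictly decreasing rows; double entries: $i_l$ with $i_l-i_{l-1}=2$; $w_\wedge,w_\vee,w_\times$: top-row entries, bottom-row entries, double entries. $\mathcal F_{i_l}(w)=\langle e_j,f_r:j\le t_{i_l},r\le b_{i_l}\rangle$, $t_s$ ($b_s$) the number of entries $\le s$ in the top (bottom) row. With $P=\langle e_1,\dots,e_{n-k}\rangle$, $Q=\langle f_1,\dots,f_k\rangle$, $\rho:V\to Q$ the projection along $P$ and $F'_{i_l}=(F_{i_l}\cap P)+\rho(F_{i_l})$, $\widetilde Y_w$ is the Zariski closure of $\{F\in\widetilde Y: F'=\mathcal F(w)\}$. Extended cup diagram $eC(w)$: weight sequence $a_1\dots a_n$ ($a_{i-1}=a_i=\times$ for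 $i\in w_\times$, else $\wedge$ for $i\in w_\wedge$, $\vee$ for $i\in w_\vee$), with $n-k$ points $\vee$ prepended at positions $-(n-k)+1,\dots,0$ and $k$ points $\wedge$ appended at positions $n+1,\dots,n+k$; repeatedly join by cups the $\vee\wedge$ pairs adjacent after ignoring $\times$'s and joined points, until all non-$\times$ points of $1,\dots,n$ are joined; delete the unused added points. Cups with an endpoint at an added point are green, others black. Points of position $<1$ are left outer points, of position $>n$ right outer points. Circle diagram $CC(w,w')$: draw $eC(w)$ with its cups below a horizontal line and the mirror image of $eC(w')$ (cups above the line) on the same points. If one of the two diagrams has outer points not present in the other (such extra points occur equally often on the left and on the right), these extra points are joined, on the side lacking them, by green arcs in the unique crossingless way. The result is a disjoint union of closed curves (circles). A circle is coloured red if it contains more than one left outer point or more than one right outer point; otherwise it is green if it contains at least one green arc, and black otherwise. *)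

theory Defs
  imports "Jordan_Normal_Form.Determinant" "HOL-Library.Multiset"
begin

text \<open>V = C^n with coordinates 0..n-1.  The basis vector e_j (1 <= j <= n-k) is the
  coordinate vector with index j-1, and f_r (1 <= r <= k) is the coordinate vector with
  index n-k+r-1.\<close>

definition Nmap :: "nat \<Rightarrow> nat \<Rightarrow> complex vec \<Rightarrow> complex vec" where
  "Nmap n k v = vec n (\<lambda>c. if c + 1 < n \<and> c + 1 \<noteq> n - k then v $ (c + 1) else 0)"

definition Pspace :: "nat \<Rightarrow> nat \<Rightarrow> complex vec set" where
  "Pspace n k = {v \<in> carrier_vec n. \<forall>i. n - k \<le> i \<longrightarrow> i < n \<longrightarrow> v $ i = 0}"

definition rho :: "nat \<Rightarrow> nat \<Rightarrow> complex vec \<Rightarrow> complex vec" where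
  "rho n k v = vec n (\<lambda>i. if i < n - k then 0 else v $ i)"

definition setsum_vec :: "complex vec set \<Rightarrow> complex vec set \<Rightarrow> complex vec set" where
  "setsum_vec A B = {a + b | a b. a \<in> A \<and> b \<in> B}"

definition valid_type :: "nat \<Rightarrow> nat list \<Rightarrow> bool" where
  "valid_type n is \<longleftrightarrow> is \<noteq> [] \<and> sorted_wrt (<) is \<and> 0 < hd is \<and> last is = n"

definition GLn :: "nat \<Rightarrow> complex mat set" where
  "GLn n = {g \<in> carrier_mat n n. det g \<noteq> 0}"

definition col_span :: "nat \<Rightarrow> complex mat \<Rightarrow> nat \<Rightarrow> complex vec set" where
  "col_span n g d = {g *\<^sub>v x | x. x \<in> carrier_vec n \<and> (\<forall>i<n. d \<le> i \<longrightarrow> x $ i = 0)}"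

definition flag_of :: "nat \<Rightarrow> nat list \<Rightarrow> complex mat \<Rightarrow> complex vec set list" where
  "flag_of n is g = map (col_span n g) is"

definition FlagVar :: "nat \<Rightarrow> nat list \<Rightarrow> complex vec set list set" where
  "FlagVar n is = flag_of n is ` GLn n"

inductive_set polyfun :: "nat \<Rightarrow> (complex mat \<Rightarrow> complex) set" for n :: nat where
  pf_const: "(\<lambda>g. c) \<in> polyfun n"
| pf_entry: "i < n \<Longrightarrow> j < n \<Longrightarrow> (\<lambda>g. g $$ (i, j)) \<in> polyfun n"
| pf_add: "p \<in> polyfun n \<Longrightarrow> q \<in> polyfun n \<Longrightarrow> (\<lambda>g. p g + q g) \<in> polyfun n"
| pf_mult: "p \<in> polyfun n \<Longrightarrow> q \<in> polyfun n \<Longrightarrow> (\<lambda>g. p g * q g) \<in> polyfun n"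

definition GL_zclosed :: "nat \<Rightarrow> complex mat set \<Rightarrow> bool" where
  "GL_zclosed n A \<longleftrightarrow> (\<exists>Ps \<subseteq> polyfun n. A = {g \<in> GLn n. \<forall>p\<in>Ps. p g = 0})"

text \<open>Zariski topology on the partial flag variety GL_n/P: the quotient topology
  of the quotient morphism g \<mapsto> flag_of g.\<close>
definition flag_zclosed :: "nat \<Rightarrow> nat list \<Rightarrow> complex vec set list set \<Rightarrow> bool" where
  "flag_zclosed n is C \<longleftrightarrow> C \<subseteq> FlagVar n is \<and>
     GL_zclosed n {g \<in> GLn n. flag_of n is g \<in> C}"

definition flag_zclosure :: "nat \<Rightarrow> nat list \<Rightarrow> complex vec set list set \<Rightarrow> complex vec set list set" where
  "flag_zclosure n is S = \<Inter> {C. flag_zclosed n is C \<and> S \<subseteq> C}"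

definition Ytilde :: "nat \<Rightarrow> nat \<Rightarrow> nat list \<Rightarrow> complex vec set list set" where
  "Ytilde n k is = {F \<in> FlagVar n is.
     \<forall>l < length is. Nmap n k ` (F ! l) \<subseteq> (if l = 0 then {0\<^sub>v n} else F ! (l - 1))}"

fun type_mset_aux :: "nat \<Rightarrow> nat list \<Rightarrow> nat multiset" where
  "type_mset_aux p [] = {#}"
| "type_mset_aux p (i # is) = replicate_mset (i - p) i + type_mset_aux i is"

definition type_mset :: "nat list \<Rightarrow> nat multiset" where
  "type_mset is = type_mset_aux 0 is"

text \<open>A tableau is a pair (top row, bottom row), each listed left to right.\<close>
type_synonym tableau = "nat list \<times> nat list"

definition row_strict_tableau :: "nat \<Rightarrow> nat \<Rightarrow> nat list \<Rightarrow> tableau \<Rightarrow> bool" where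
  "row_strict_tableau n k is w \<longleftrightarrow>
     length (fst w) = n - k \<and> length (snd w) = k \<and>
     sorted_wrt (>) (fst w) \<and> sorted_wrt (>) (snd w) \<and>
     mset (fst w @ snd w) = type_mset is"

definition double_entries :: "nat list \<Rightarrow> nat set" where
  "double_entries is = {is ! l | l. l < length is \<and> is ! l - (if l = 0 then 0 else is ! (l - 1)) = 2}"

definition tcount :: "nat list \<Rightarrow> nat \<Rightarrow> nat" where
  "tcount xs s = card {x \<in> set xs. x \<le> s}"

definition coord_space :: "nat \<Rightarrow> nat \<Rightarrow> tableau \<Rightarrow> nat \<Rightarrow> complex vec set" where
  "coord_space n k w s = {v \<in> carrier_vec n. \<forall>i<n. v $ i \<noteq> 0 \<longrightarrow>
      (i < n - k \<and> i < tcount (fst w) s) \<or> (n - k \<le> i \<and> i - (n - k) < tcount (snd w) s)}"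

definition Fprime :: "nat \<Rightarrow> nat \<Rightarrow> complex vec set \<Rightarrow> complex vec set" where
  "Fprime n k F = setsum_vec (F \<inter> Pspace n k) (rho n k ` F)"

definition Ytilde_w :: "nat \<Rightarrow> nat \<Rightarrow> nat list \<Rightarrow> tableau \<Rightarrow> complex vec set list set" where
  "Ytilde_w n k is w = Ytilde n k is \<inter>
     flag_zclosure n is {F \<in> Ytilde n k is. map (Fprime n k) F = map (coord_space n k w) is}"

datatype wt = Up | Down | Cross

text \<open>Labels of the points of the extended weight sequence (positions -(n-k)+1 .. n+k).
  Up = \<and>, Down = \<or>, Cross = \<times>.\<close>
definition ext_label :: "nat \<Rightarrow> nat \<Rightarrow> nat list \<Rightarrow> tableau \<Rightarrow> int \<Rightarrow> wt option" where
  "ext_label n k is w p =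
     (if - int (n - k) + 1 \<le> p \<and> p \<le> 0 then Some Down
      else if int n + 1 \<le> p \<and> p \<le> int n + int k then Some Up
      else if 1 \<le> p \<and> p \<le> int n then
        (if nat p \<in> double_entries is \<or> nat p + 1 \<in> double_entries is then Some Cross
         else if nat p \<in> set (fst w) then Some Up
         else if nat p \<in> set (snd w) then Some Down
         else None)
      else None)"

definition joined :: "(int \<times> int) set \<Rightarrow> int set" where
  "joined C = fst ` C \<union> snd ` C"

text \<open>States reachable by the cup-joining process (which stops as soon as all
  non-\<times> points among 1..n are joined).\<close>
inductive_set cup_reach :: "nat \<Rightarrow> (int \<Rightarrow> wt option) \<Rightarrow> (int \<times> int) set set"
  for n :: nat and lab :: "int \<Rightarrow> wt option" where
  cr_empty: "{} \<in> cup_reach n lab"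
| cr_step: "C \<in> cup_reach n lab \<Longrightarrow>
     (\<exists>i. 1 \<le> i \<and> i \<le> int n \<and> lab i \<in> {Some Up, Some Down} \<and> i \<notin> joined C) \<Longrightarrow>
     p < q \<Longrightarrow> lab p = Some Down \<Longrightarrow> lab q = Some Up \<Longrightarrow>
     p \<notin> joined C \<Longrightarrow> q \<notin> joined C \<Longrightarrow>
     (\<forall>r. p < r \<and> r < q \<longrightarrow> lab r = Some Cross \<or> r \<in> joined C) \<Longrightarrow>
     insert (p, q) C \<in> cup_reach n lab"

text \<open>The cups of the extended cup diagram eC(w) (pairs (left end, right end)).
  Unused added points are simply those not occurring in any cup.\<close>
definition ext_cups :: "nat \<Rightarrow> nat \<Rightarrow> nat list \<Rightarrow> tableau \<Rightarrow> (int \<times> int) set" where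
  "ext_cups n k is w = (THE C. C \<in> cup_reach n (ext_label n k is w) \<and>
     (\<forall>i. 1 \<le> i \<and> i \<le> int n \<and> ext_label n k is w i \<in> {Some Up, Some Down} \<longrightarrow> i \<in> joined C))"

definition left_outer :: "(int \<times> int) set \<Rightarrow> int set" where
  "left_outer C = {p \<in> joined C. p < 1}"

definition right_outer :: "nat \<Rightarrow> (int \<times> int) set \<Rightarrow> int set" where
  "right_outer n C = {p \<in> joined C. p > int n}"

text \<open>Green arcs joining extra left points EL with extra right points ER in the
  crossingless (nested) way: innermost left point with innermost right point, etc.\<close>
definition extra_arcs :: "int set \<Rightarrow> int set \<Rightarrow> (int \<times> int) set" where
  "extra_arcs EL ER = set (zip (rev (sorted_list_of_set EL)) (sorted_list_of_set ER))"

definition circle_edges :: "nat \<Rightarrow> nat \<Rightarrow> nat list \<Rightarrow> tableau \<Rightarrow> tableau \<Rightarrow> (int \<times> int) set" where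
  "circle_edges n k is w w' =
     (let C = ext_cups n k is w; C' = ext_cups n k is w' in
      C \<union> C'
      \<union> extra_arcs (left_outer C' - left_outer C) (right_outer n C' - right_outer n C)
      \<union> extra_arcs (left_outer C - left_outer C') (right_outer n C - right_outer n C'))"

definition circles :: "nat \<Rightarrow> nat \<Rightarrow> nat list \<Rightarrow> tableau \<Rightarrow> tableau \<Rightarrow> int set set" where
  "circles n k is w w' =
     (let E = circle_edges n k is w w' in
      {{u. (v, u) \<in> (E \<union> E\<inverse>)\<^sup>*} | v. v \<in> joined E})"

definition red_circle :: "nat \<Rightarrow> int set \<Rightarrow> bool" where
  "red_circle n c \<longleftrightarrow> card {p \<in> c. p < 1} > 1 \<or> card {p \<in> c. p > int n} > 1"

definition has_red_circle :: "nat \<Rightarrow> nat \<Rightarrow> nat list \<Rightarrow> tableau \<Rightarrow> tableau \<Rightarrow> bool" where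
  "has_red_circle n k is w w' \<longleftrightarrow> (\<exists>c \<in> circles n k is w w'. red_circle n c)"

end

theory Submission
  imports Defs
begin

text \<open>Call a labelling of the points by Down and Up an orientation of an extended cup diagram if the
  ends of every cup carry different labels, all left outer points are Down and all right outer
  points are Up.  The theorem follows from two statements about the existence of a common
  orientation of the two diagrams.

  Combinatorially, every arc of a circle cuts off an even number of points of that circle, so along
  the line the points of an oriented circle are labelled alternately.  Two neighbouring
  left (or right) outer points of a red circle would have to carry different labels; if there is no
  red circle, labelling every circle alternately, beginning with Down, is an orientation.

  Geometrically, on the cell of a tableau a black cup (i, j) forces N^c F_j to lie in F_(i-1) with
  2 c = j - i + 1, and the steps at green cups are coordinate spaces.  These conditions are Zariski
  closed, hence hold on the closure, and by counting dimensions the jumps of the projections of F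
  to Q orient the diagram.  Conversely an orientation determines a coordinate flag, the same one for
  both tableaux; adding, at each black cup, a small multiple of the other generator deforms it into
  either cell, so it lies in both closures.\<close>

section \<open>The cup joining process\<close>

text \<open>Equalities such as F' = coordinate flag are not Zariski closed, since dimensions of
  intersections may jump in a limit. Only inclusions are carried to the closure, and equality is
  recovered by counting: if N^c F_b lies in F_a, then F_b has at most c more e-directions and at
  most c more f-directions than F_a, so a difference of 2 c in dimension makes both bounds sharp.
  The factor 2 arises because every cup and every crossed pair contributes one entry to each row.
  For the converse, polynomials are continuous, so an invertible entrywise limit of invertible
  matrices stays inside every Zariski closed set that contains them; no algebraic curve has to be
  constructed. The parameter at a cup cannot be an arbitrary small number: depending on the
  parameters further left, one value may cancel a leading coefficient and leave the cell. Two small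
  candidates per cup suffice. The two components are never compared directly: the orientation read
  off from a flag depends only on the flag, and the undeformed flag depends only on the type and the
  orientation.\<close>

definition cup_matching :: "nat \<Rightarrow> (int \<Rightarrow> wt option) \<Rightarrow> (int \<times> int) set \<Rightarrow> bool" where
  "cup_matching n lab C \<longleftrightarrow> finite C \<and>
     (\<forall>p q. (p, q) \<in> C \<longrightarrow> p < q \<and> lab p = Some Down \<and> lab q = Some Up \<and>
        p \<le> int n \<and> 1 \<le> q \<and> (1 \<le> p \<or> q \<le> int n)) \<and>
     (\<forall>p q p' q'. (p, q) \<in> C \<longrightarrow> (p', q') \<in> C \<longrightarrow> p = p' \<or> q = q' \<longrightarrow> p = p' \<and> q = q') \<and>
     (\<forall>p q r. (p, q) \<in> C \<longrightarrow> p < r \<longrightarrow> r < q \<longrightarrow>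
        lab r = Some Cross \<or> (\<exists>s. (r, s) \<in> C \<and> s < q) \<or> (\<exists>s. (s, r) \<in> C \<and> p < s))"

lemma joined_iff: "x \<in> joined C \<longleftrightarrow> (\<exists>y. (x, y) \<in> C \<or> (y, x) \<in> C)"
  unfolding joined_def by force

lemma joined_Un: "joined (A \<union> B) = joined A \<union> joined B"
  by (auto simp: joined_def)

lemma cup_matchingD:
  assumes "cup_matching n lab C"
  shows "finite C"
    and "\<And>p q. (p, q) \<in> C \<Longrightarrow> p < q"
    and "\<And>p q. (p, q) \<in> C \<Longrightarrow> lab p = Some Down"
    and "\<And>p q. (p, q) \<in> C \<Longrightarrow> lab q = Some Up"
    and "\<And>p q. (p, q) \<in> C \<Longrightarrow> 1 \<le> p \<or> q \<le> int n"
    and "\<And>p q q'. (p, q) \<in> C \<Longrightarrow> (p, q') \<in> C \<Longrightarrow> q = q'"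
    and "\<And>p q p'. (p, q) \<in> C \<Longrightarrow> (p', q) \<in> C \<Longrightarrow> p = p'"
    and "\<And>p q r. (p, q) \<in> C \<Longrightarrow> p < r \<Longrightarrow> r < q \<Longrightarrow>
        lab r = Some Cross \<or> (\<exists>s. (r, s) \<in> C \<and> s < q) \<or> (\<exists>s. (s, r) \<in> C \<and> p < s)"
    and "\<And>p q. (p, q) \<in> C \<Longrightarrow> p \<le> int n"
    and "\<And>p q. (p, q) \<in> C \<Longrightarrow> 1 \<le> q"
  using assms unfolding cup_matching_def by blast+

lemma cup_matching_Down:
  assumes "cup_matching n lab C" "x \<in> joined C" "lab x = Some Down"
  obtains y where "(x, y) \<in> C"
  using assms cup_matchingD(4)[OF assms(1)] by (force simp: joined_iff)

lemma cup_matching_Up: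
  assumes "cup_matching n lab C" "x \<in> joined C" "lab x = Some Up"
  obtains y where "(y, x) \<in> C"
  using assms cup_matchingD(3)[OF assms(1)] by (force simp: joined_iff)

lemma cup_reach_matching:
  assumes "C \<in> cup_reach n lab"
    and "\<And>p. lab p = Some Down \<Longrightarrow> p \<le> int n" and "\<And>q. lab q = Some Up \<Longrightarrow> 1 \<le> q"
  shows "cup_matching n lab C"
  using assms(1)
proof induction
  case cr_empty
  then show ?case by (simp add: cup_matching_def)
next
  case (cr_step C p q)
  note M = cup_matchingD[OF cr_step.IH]
  \<comment> \<open>A cup joining a left to a right added point would pass over the inner point
    \<open>i\<close> that is still free, and the joining rule forbids free points under a new
    cup.\<close>
  have inner: "1 \<le> p \<or> q \<le> int n"
  proof (rule ccontr)
    assume n: "\<not> ?thesis"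
    obtain i where i: "1 \<le> i" "i \<le> int n" "lab i \<in> {Some Up, Some Down}" "i \<notin> joined C"
      using cr_step.hyps by blast
    with n have "p < i" "i < q" by auto
    with cr_step.hyps have "lab i = Some Cross \<or> i \<in> joined C" by blast
    with i show False by auto
  qed
  have unq: "p' \<noteq> p" "q' \<noteq> q" "p' \<noteq> q" "q' \<noteq> p" if "(p', q') \<in> C" for p' q'
    using that cr_step.hyps by (force simp: joined_iff)+
  \<comment> \<open>The partner of \<open>r\<close> cannot lie beyond \<open>p\<close> or
    \<open>q\<close>: the older cup would then pass over a free end of the new one, whereas
    everything under a cup of \<open>C\<close> is joined or crossed.\<close>
  have nest: "lab r = Some Cross \<or> (\<exists>s. (r, s) \<in> C \<and> s < q) \<or> (\<exists>s. (s, r) \<in> C \<and> p < s)"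
    if r: "p < r" "r < q" for r
  proof (cases "lab r = Some Cross")
    case False
    then have "r \<in> joined C" using r cr_step.hyps by auto
    then consider s where "(r, s) \<in> C" | s where "(s, r) \<in> C" by (auto simp: joined_iff)
    then show ?thesis
    proof cases
      case 1
      have "s < q"
      proof (rule ccontr)
        assume "\<not> s < q"
        with unq[OF 1] have "q < s" by auto
        from M(8)[OF 1 r(2) this] cr_step.hyps show False
          by (auto simp: joined_iff)
      qed
      with 1 show ?thesis by blast
    next
      case 2
      have "p < s"
      proof (rule ccontr)
        assume "\<not> p < s"
        with unq[OF 2] have "s < p" by auto
        from M(8)[OF 2 this r(1)] cr_step.hyps show False
          by (auto simp: joined_iff)
      qed
      with 2 show ?thesis by blast
    qed
  qed simp
  show ?case
    unfolding cup_matching_def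
  proof (intro conjI allI impI)
    show "finite (insert (p, q) C)" using M(1) by simp
  next
    fix a b assume "(a, b) \<in> insert (p, q) C"
    then show "a < b" "lab a = Some Down" "lab b = Some Up" "a \<le> int n" "1 \<le> b" "1 \<le> a \<or> b \<le> int n"
      using M(2,3,4,5,9,10)[of a b] cr_step.hyps(2-) inner assms(2,3) by blast+
  next
    fix a b a' b' assume "(a, b) \<in> insert (p, q) C" "(a', b') \<in> insert (p, q) C" "a = a' \<or> b = b'"
    then show "a = a'" "b = b'"
      using M(6,7) unq by (metis insertE prod.inject)+
  next
    fix a b r assume "(a, b) \<in> insert (p, q) C" "a < r" "r < b"
    then show "lab r = Some Cross \<or> (\<exists>s. (r, s) \<in> insert (p, q) C \<and> s < b)
        \<or> (\<exists>s. (s, r) \<in> insert (p, q) C \<and> a < s)"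
      using nest[of r] M(8)[of a b r] by blast
  qed
qed

definition cups_complete :: "nat \<Rightarrow> (int \<Rightarrow> wt option) \<Rightarrow> (int \<times> int) set \<Rightarrow> bool" where
  "cups_complete n lab C \<longleftrightarrow>
     (\<forall>i. 1 \<le> i \<and> i \<le> int n \<and> lab i \<in> {Some Up, Some Down} \<longrightarrow> i \<in> joined C)"

text \<open>Induction on the length of the cup. Shorter cups under (p, q) already lie in
  \<open>D\<close>, so if \<open>D\<close> joined \<open>p\<close> or \<open>q\<close> elsewhere,
  some point under (p, q) would have two partners in \<open>D\<close>. This makes the result of the
  joining process independent of the order of choices.\<close>

lemma cup_matching_subset:
  assumes C: "cup_matching n lab C" and D: "cup_matching n lab D" and c: "cups_complete n lab D"
    and pq: "(p, q) \<in> C"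
  shows "(p, q) \<in> D"
  using pq
proof (induction "nat (q - p)" arbitrary: p q rule: less_induct)
  case less
  note MC = cup_matchingD[OF C] and MD = cup_matchingD[OF D]
  note pq = less.prems
  have IH: "(a, b) \<in> D" if "(a, b) \<in> C" "p \<le> a" "b \<le> q" "p < a \<or> b < q" for a b
    using less.hyps[of b a] that MC(2)[OF that(1)] by auto
  have lab: "lab p = Some Down" "lab q = Some Up" "p < q" using MC pq by auto
  \<comment> \<open>Completeness of \<open>D\<close> speaks only of inner points. A cup has at least
    one inner end, and the argument starts from that end.\<close>
  show ?case
  proof (cases "1 \<le> p")
    case True
    then have "p \<in> joined D" using c MC(9)[OF pq] lab by (auto simp: cups_complete_def)
    then obtain q' where q': "(p, q') \<in> D" using cup_matching_Down[OF D _ lab(1)] by blast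
    have "q' = q"
    proof (rule ccontr)
      assume "q' \<noteq> q"
      then consider "q' < q" | "q < q'" by linarith
      then show False
      proof cases
        case 1
        from MC(8)[OF pq MD(2)[OF q'] 1] MD(4)[OF q'] obtain s where "(s, q') \<in> C" "p < s"
          using MC(3) by fastforce
        with IH[of s q'] 1 MD(7) q' show False by force
      next
        case 2
        from MD(8)[OF q' lab(3) 2] lab obtain s where s: "(s, q) \<in> D" "p < s"
          using MD(3) by fastforce
        from MC(8)[OF pq s(2) MD(2)[OF s(1)]] MD(3)[OF s(1)] obtain r where "(s, r) \<in> C" "r < q"
          using MC(4) by fastforce
        with IH[of s r] s MD(6) show False by force
      qed
    qed
    with q' show ?thesis by simp
  next
    case False
    with MC(5)[OF pq] have "q \<le> int n" by auto
    then have "q \<in> joined D" using c MC(10)[OF pq] lab by (auto simp: cups_complete_def)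
    then obtain p' where p': "(p', q) \<in> D" using cup_matching_Up[OF D _ lab(2)] by blast
    have "p' = p"
    proof (rule ccontr)
      assume "p' \<noteq> p"
      then consider "p < p'" | "p' < p" by linarith
      then show False
      proof cases
        case 1
        from MC(8)[OF pq 1 MD(2)[OF p']] MD(3)[OF p'] obtain s where "(p', s) \<in> C" "s < q"
          using MC(4) by fastforce
        with IH[of p' s] 1 MD(6) p' show False by force
      next
        case 2
        from MD(8)[OF p' 2 lab(3)] lab obtain s where s: "(p, s) \<in> D" "s < q"
          using MD(4) by fastforce
        from MC(8)[OF pq MD(2)[OF s(1)] s(2)] MD(4)[OF s(1)] obtain r where "(r, s) \<in> C" "p < r"
          using MC(3) by fastforce
        with IH[of r s] s MD(7) show False by force
      qed
    qed
    with p' show ?thesis by simp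
  qed
qed

text \<open>If an inner point is unjoined, the counting hypotheses provide an unjoined Down to the left
  of an unjoined Up; a pair of this kind at minimal distance can be joined next.\<close>

lemma cup_reach_extend:
  assumes C: "C \<in> cup_reach n lab"
    and bd: "\<And>p. lab p = Some Down \<Longrightarrow> p \<le> int n" "\<And>q. lab q = Some Up \<Longrightarrow> 1 \<le> q"
    and fin: "finite {p. lab p \<noteq> None}"
    and gap: "\<And>p q r. lab p = Some Down \<Longrightarrow> lab q = Some Up \<Longrightarrow> p < r \<Longrightarrow> r < q \<Longrightarrow> lab r \<noteq> None"
    and up: "\<And>i. 1 \<le> i \<Longrightarrow> i \<le> int n \<Longrightarrow> lab i = Some Up \<Longrightarrow>
      card {q. lab q = Some Up \<and> q < i} < card {p. lab p = Some Down \<and> p < i}"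
    and down: "\<And>i. 1 \<le> i \<Longrightarrow> i \<le> int n \<Longrightarrow> lab i = Some Down \<Longrightarrow>
      card {p. lab p = Some Down \<and> i < p} < card {q. lab q = Some Up \<and> i < q}"
    and nc: "\<not> cups_complete n lab C"
  obtains p q where "insert (p, q) C \<in> cup_reach n lab" "p \<notin> joined C"
proof -
  have M: "cup_matching n lab C" by (rule cup_reach_matching[OF C bd])
  note MD = cup_matchingD[OF M]
  have finl: "finite {p. lab p = x \<and> P p}" if "x \<noteq> None" for x P
    by (rule finite_subset[OF _ fin]) (use that in auto)
  obtain i where i: "1 \<le> i" "i \<le> int n" "lab i \<in> {Some Up, Some Down}" "i \<notin> joined C"
    using nc by (auto simp: cups_complete_def)
  have nocross: "\<not> (p < i \<and> i < q)" if "(p, q) \<in> C" for p q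
    using MD(8)[OF that] i by (force simp: joined_iff)
  have ne: "p \<noteq> i" "q \<noteq> i" if "(p, q) \<in> C" for p q
    using that i by (auto simp: joined_iff)
  have "\<exists>p q. lab p = Some Down \<and> lab q = Some Up \<and> p \<notin> joined C \<and> q \<notin> joined C \<and> p < q"
  proof (cases "lab i = Some Up")
    case True
    have "\<exists>p. lab p = Some Down \<and> p < i \<and> p \<notin> joined C"
    proof (rule ccontr)
      assume n: "\<not> ?thesis"
      \<comment> \<open>If every Down left of \<open>i\<close> were joined, its partner would also
        lie left of \<open>i\<close>, since no cup passes over the free point \<open>i\<close>.
        Passing to partners would inject these Downs into the Ups left of \<open>i\<close>, against
        \<open>up\<close>.\<close>
      define f where "f p = (THE q. (p, q) \<in> C)" for p
      have f: "(p, f p) \<in> C" if "lab p = Some Down" "p < i" for p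
      proof -
        from n that have "p \<in> joined C" by blast
        then obtain q where q: "(p, q) \<in> C" using cup_matching_Down[OF M _ \<open>lab p = Some Down\<close>] by blast
        show ?thesis unfolding f_def by (rule theI[of "\<lambda>q. (p, q) \<in> C"]) (use q MD(6) in auto)
      qed
      have "card {p. lab p = Some Down \<and> p < i} \<le> card {q. lab q = Some Up \<and> q < i}"
      proof (rule card_inj_on_le[of f])
        show "inj_on f {p. lab p = Some Down \<and> p < i}"
          by (rule inj_onI) (metis (mono_tags, lifting) MD(7) f mem_Collect_eq)
        have "f p < i" if "lab p = Some Down" "p < i" for p
          using f[OF that] nocross ne that by (metis linorder_less_linear)
        then show "f ` {p. lab p = Some Down \<and> p < i} \<subseteq> {q. lab q = Some Up \<and> q < i}"
          using f MD(4) by blast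
        show "finite {q. lab q = Some Up \<and> q < i}" by (rule finl) simp
      qed
      with up[OF i(1,2) True] show False by simp
    qed
    with True i show ?thesis by blast
  next
    case False
    then have D: "lab i = Some Down" using i by auto
    have "\<exists>q. lab q = Some Up \<and> i < q \<and> q \<notin> joined C"
    proof (rule ccontr)
      assume n: "\<not> ?thesis"
      define f where "f q = (THE p. (p, q) \<in> C)" for q
      have f: "(f q, q) \<in> C" if "lab q = Some Up" "i < q" for q
      proof -
        from n that have "q \<in> joined C" by blast
        then obtain p where p: "(p, q) \<in> C" using cup_matching_Up[OF M _ \<open>lab q = Some Up\<close>] by blast
        show ?thesis unfolding f_def by (rule theI[of "\<lambda>p. (p, q) \<in> C"]) (use p MD(7) in auto)
      qed
      have "card {q. lab q = Some Up \<and> i < q} \<le> card {p. lab p = Some Down \<and> i < p}"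
      proof (rule card_inj_on_le[of f])
        show "inj_on f {q. lab q = Some Up \<and> i < q}"
          by (rule inj_onI) (metis (mono_tags, lifting) MD(6) f mem_Collect_eq)
        have "i < f q" if "lab q = Some Up" "i < q" for q
          using f[OF that] nocross ne that by (metis linorder_less_linear)
        then show "f ` {q. lab q = Some Up \<and> i < q} \<subseteq> {p. lab p = Some Down \<and> i < p}"
          using f MD(3) by blast
        show "finite {p. lab p = Some Down \<and> i < p}" by (rule finl) simp
      qed
      with down[OF i(1,2) D] show False by simp
    qed
    with D i show ?thesis by blast
  qed
  then obtain p0 q0 where pq0: "lab p0 = Some Down" "lab q0 = Some Up" "p0 \<notin> joined C"
      "q0 \<notin> joined C" "p0 < q0" by blast
  define Q where "Q z \<longleftrightarrow> lab (fst z) = Some Down \<and> lab (snd z) = Some Up \<and> fst z \<notin> joined C \<and>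
      snd z \<notin> joined C \<and> fst z < snd z" for z
  have "Q (p0, q0)" using pq0 by (simp add: Q_def)
  from ex_has_least_nat[of Q, OF this, of "\<lambda>z. nat (snd z - fst z)"]
  obtain z where z: "Q z" and zl: "\<And>y. Q y \<Longrightarrow> nat (snd z - fst z) \<le> nat (snd y - fst y)" by blast
  define p where "p = fst z"
  define q where "q = snd z"
  have pq: "lab p = Some Down" "lab q = Some Up" "p \<notin> joined C" "q \<notin> joined C" "p < q"
    using z by (auto simp: Q_def p_def q_def)
  have least: "nat (q - p) \<le> nat (q' - p')" if "lab p' = Some Down" "lab q' = Some Up" "p' \<notin> joined C"
        "q' \<notin> joined C" "p' < q'" for p' q'
    using zl[of "(p', q')"] that by (auto simp: Q_def p_def q_def)
  \<comment> \<open>A free labelled point in between would form a nearer pair with \<open>p\<close>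
    or with \<open>q\<close>.\<close>
  have "\<forall>r. p < r \<and> r < q \<longrightarrow> lab r = Some Cross \<or> r \<in> joined C"
  proof (intro allI impI, rule ccontr)
    fix r assume r: "p < r \<and> r < q" and n: "\<not> (lab r = Some Cross \<or> r \<in> joined C)"
    from gap[OF pq(1,2), of r] r n have "lab r = Some Up \<or> lab r = Some Down"
      by (metis not_Some_eq wt.exhaust)
    then show False using least[of p r] least[of r q] r n pq by auto
  qed
  with cr_step[OF C, of p q] i pq have "insert (p, q) C \<in> cup_reach n lab" by blast
  with pq that show ?thesis by blast
qed

text \<open>There are finitely many states, and an inclusion-maximal one is complete because an
  incomplete one can be extended. Two complete states contain each other. This gives the definite
  description in \<open>ext_cups\<close> its value.\<close>

lemma cup_reach_complete_ex1:
  assumes bd: "\<And>p. lab p = Some Down \<Longrightarrow> p \<le> int n" "\<And>q. lab q = Some Up \<Longrightarrow> 1 \<le> q"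
    and fin: "finite {p. lab p \<noteq> None}"
    and gap: "\<And>p q r. lab p = Some Down \<Longrightarrow> lab q = Some Up \<Longrightarrow> p < r \<Longrightarrow> r < q \<Longrightarrow> lab r \<noteq> None"
    and up: "\<And>i. 1 \<le> i \<Longrightarrow> i \<le> int n \<Longrightarrow> lab i = Some Up \<Longrightarrow>
      card {q. lab q = Some Up \<and> q < i} < card {p. lab p = Some Down \<and> p < i}"
    and down: "\<And>i. 1 \<le> i \<Longrightarrow> i \<le> int n \<Longrightarrow> lab i = Some Down \<Longrightarrow>
      card {p. lab p = Some Down \<and> i < p} < card {q. lab q = Some Up \<and> i < q}"
  shows "\<exists>!C. C \<in> cup_reach n lab \<and> cups_complete n lab C"
proof -
  let ?X = "{p. lab p \<noteq> None}"
  have sub: "C \<subseteq> ?X \<times> ?X" if "C \<in> cup_reach n lab" for C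
  proof (rule subsetI)
    fix z assume "z \<in> C"
    then show "z \<in> ?X \<times> ?X"
      using cup_matchingD(3,4)[OF cup_reach_matching[OF that bd], of "fst z" "snd z"]
      by (cases z) simp
  qed
  have "cup_reach n lab \<subseteq> Pow (?X \<times> ?X)" using sub by blast
  then have "finite (cup_reach n lab)" 
    by (rule finite_subset) (intro finite_Pow_iff[THEN iffD2] finite_cartesian_product fin)
  from finite_has_maximal[OF this] cr_empty
  obtain C where C: "C \<in> cup_reach n lab" and mx: "\<And>D. D \<in> cup_reach n lab \<Longrightarrow> C \<subseteq> D \<Longrightarrow> C = D"
    by blast
  have comp: "cups_complete n lab C"
  proof (rule ccontr)
    assume nc: "\<not> ?thesis"
    show False
    proof (rule cup_reach_extend[OF C _ _ fin _ _ _ nc])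
      fix p q assume pq: "insert (p, q) C \<in> cup_reach n lab" "p \<notin> joined C"
      with mx[of "insert (p, q) C"] have "(p, q) \<in> C" by auto
      with pq show False by (auto simp: joined_iff)
    qed (fact bd gap up down)+
  qed
  show ?thesis
  proof (rule ex1I)
    show "C \<in> cup_reach n lab \<and> cups_complete n lab C" using C comp by simp
    have MC: "cup_matching n lab C" by (rule cup_reach_matching[OF C]) (fact bd)+
    fix D assume "D \<in> cup_reach n lab \<and> cups_complete n lab D"
    then have D1: "D \<in> cup_reach n lab" and D2: "cups_complete n lab D" by simp_all
    have MD: "cup_matching n lab D" by (rule cup_reach_matching[OF D1]) (fact bd)+
    show "D = C"
    proof (rule Set.set_eqI)
      fix z show "z \<in> D \<longleftrightarrow> z \<in> C"
        using cup_matching_subset[OF MC MD D2, of "fst z" "snd z"]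
          cup_matching_subset[OF MD MC comp, of "fst z" "snd z"] by (cases z) auto
    qed
  qed
qed

section \<open>Flag types and row strict tableaux\<close>

lemma count_type_mset_aux_notin:
  "x \<notin> set is \<Longrightarrow> count (type_mset_aux p is) x = 0"
  by (induction "is" arbitrary: p) auto

lemma count_type_mset_aux_nth:
  assumes "sorted_wrt (<) is" "\<forall>x\<in>set is. p < x" "l < length is"
  shows "count (type_mset_aux p is) (is ! l) = is ! l - (if l = 0 then p else is ! (l - 1))"
  using assms
proof (induction "is" arbitrary: p l)
  case (Cons a as)
  have as: "sorted_wrt (<) as" "\<forall>x\<in>set as. a < x" using Cons.prems by auto
  show ?case
  proof (cases l)
    case 0
    with as have "a \<notin> set as" by auto
    with 0 show ?thesis by (simp add: count_type_mset_aux_notin)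
  next
    case (Suc m)
    then have m: "m < length as" using Cons.prems by simp
    then have "as ! m \<noteq> a" using as nth_mem by blast
    then have "count (type_mset_aux p (a # as)) ((a # as) ! l) = count (type_mset_aux a as) (as ! m)"
      using Suc by simp
    also have "\<dots> = as ! m - (if m = 0 then a else as ! (m - 1))"
      by (rule Cons.IH[OF as m])
    finally show ?thesis using Suc by (cases m) simp_all
  qed
qed simp

lemma tcount_0: "0 \<notin> set xs \<Longrightarrow> tcount xs 0 = 0"
  by (auto simp: tcount_def)

lemma tcount_Suc: "tcount xs (Suc p) = tcount xs p + (if Suc p \<in> set xs then 1 else 0)"
proof -
  have "{x \<in> set xs. x \<le> Suc p} = {x \<in> set xs. x \<le> p} \<union> (if Suc p \<in> set xs then {Suc p} else {})"
    by (auto simp: le_Suc_eq)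
  then show ?thesis unfolding tcount_def by (subst (asm) card_Un_disjoint[symmetric] | simp)+
qed

lemma tcount_mono: "p \<le> q \<Longrightarrow> tcount xs p \<le> tcount xs q"
  unfolding tcount_def by (intro card_mono) auto

locale two_row_tableau =
  fixes n k :: nat and "is" :: "nat list" and w :: tableau
  assumes kn: "2 * k \<le> n" and vt: "valid_type n is" and rs: "row_strict_tableau n k is w"
begin

abbreviation "dbl \<equiv> double_entries is"
abbreviation "lab \<equiv> ext_label n k is w"
definition pos :: "nat set" where "pos = insert 0 (set is)"
definition crs :: "nat \<Rightarrow> bool" where "crs p \<longleftrightarrow> p \<in> dbl \<or> Suc p \<in> dbl"
definition prv :: "nat \<Rightarrow> nat" where "prv p = (if p \<in> dbl then p - 2 else p - 1)"
definition T :: "nat \<Rightarrow> nat" where "T p = tcount (fst w) p"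
definition B :: "nat \<Rightarrow> nat" where "B p = tcount (snd w) p"
definition C :: "(int \<times> int) set" where "C = ext_cups n k is w"

lemma is_sorted: "sorted_wrt (<) is" and is_ne: "is \<noteq> []" and last_is: "last is = n"
  and is_pos: "x \<in> set is \<Longrightarrow> 0 < x"
proof -
  show s: "sorted_wrt (<) is" "is \<noteq> []" "last is = n" using vt by (auto simp: valid_type_def)
  show "0 < x" if "x \<in> set is" using that vt s
    by (cases "is") (auto simp: valid_type_def)
qed

lemma nth_less: "i < j \<Longrightarrow> j < length is \<Longrightarrow> is ! i < is ! j"
  using is_sorted by (rule sorted_wrt_nth_less)

lemma is_le: "x \<in> set is \<Longrightarrow> x \<le> n"
proof -
  assume "x \<in> set is"
  then obtain l where l: "l < length is" "x = is ! l" by (metis in_set_conv_nth)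
  show "x \<le> n"
  proof (cases "l = length is - 1")
    case True then show ?thesis using l last_is is_ne by (simp add: last_conv_nth)
  next
    case False
    then have "is ! l < is ! (length is - 1)" using l by (intro nth_less) auto
    then show ?thesis using l last_is is_ne by (simp add: last_conv_nth)
  qed
qed

lemma n_in_is: "n \<in> set is"
  using last_is is_ne last_in_set by blast

lemma count_rows: "count (mset (fst w)) x + count (mset (snd w)) x = count (type_mset is) x"
  using rs unfolding row_strict_tableau_def by (metis count_union mset_append)

lemma distinct_rows: "distinct (fst w)" "distinct (snd w)"
  using rs unfolding row_strict_tableau_def
  by (auto simp: distinct_conv_nth sorted_wrt_iff_nth_less) (metis linorder_neqE_nat order_less_irrefl)+

lemma row_count: "count (mset (fst w)) x = (if x \<in> set (fst w) then 1 else 0)"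
  "count (mset (snd w)) x = (if x \<in> set (snd w) then 1 else 0)"
  using distinct_rows by (auto simp: distinct_count_atmost_1)

lemma type_count: "l < length is \<Longrightarrow> count (type_mset is) (is ! l) = is ! l - (if l = 0 then 0 else is ! (l - 1))"
  "x \<notin> set is \<Longrightarrow> count (type_mset is) x = 0"
  using count_type_mset_aux_nth[OF is_sorted, of 0] count_type_mset_aux_notin is_pos
  unfolding type_mset_def by auto

lemma rows_subset: "set (fst w) \<subseteq> set is" "set (snd w) \<subseteq> set is"
  using count_rows type_count(2) by (auto simp: row_count) (metis add_is_0 one_neq_zero)+

lemma nth_prev_less: "l < length is \<Longrightarrow> (if l = 0 then 0 else is ! (l - 1)) < is ! l"
  using is_pos by (auto intro: nth_less)

text \<open>A step length is the multiplicity of its entry, and strictly decreasing rows contain an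
  entry at most once each.\<close>

lemma nth_step: "l < length is \<Longrightarrow> is ! l - (if l = 0 then 0 else is ! (l - 1)) \<in> {1, 2}"
proof -
  assume l: "l < length is"
  have "is ! l - (if l = 0 then 0 else is ! (l - 1)) \<le> 2"
    unfolding type_count(1)[OF l, symmetric] count_rows[symmetric] row_count by simp
  with nth_prev_less[OF l] show ?thesis by auto
qed

lemma not_between:
  assumes "l < length is" "(if l = 0 then 0 else is ! (l - 1)) < x" "x < is ! l"
  shows "x \<notin> set is"
proof
  assume "x \<in> set is"
  then obtain m where m: "m < length is" "x = is ! m" by (metis in_set_conv_nth)
  have "m < l"
  proof (rule ccontr)
    assume "\<not> m < l"
    then have "is ! l \<le> is ! m" using m nth_less[of l m]
      by (cases "m = l") auto
    with m assms show False by simp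
  qed
  then have "is ! m \<le> is ! (l - 1)" using assms(1) \<open>m < l\<close> nth_less[of m "l - 1"]
    by (cases "m = l - 1") (simp, linarith)
  with m assms \<open>m < l\<close> show False by auto
qed

lemma nth_cases:
  assumes "l < length is"
  shows "prv (is ! l) = (if l = 0 then 0 else is ! (l - 1))"
    and "is ! l \<in> dbl \<longleftrightarrow> is ! l - (if l = 0 then 0 else is ! (l - 1)) = 2"
proof -
  have inj: "is ! l = is ! m \<Longrightarrow> m < length is \<Longrightarrow> l = m" for m
    using assms nth_less by (metis linorder_neqE_nat order_less_irrefl)
  show 2: "is ! l \<in> dbl \<longleftrightarrow> is ! l - (if l = 0 then 0 else is ! (l - 1)) = 2"
    (is "?L \<longleftrightarrow> ?R")
  proof
    assume ?L
    then obtain m where m: "m < length is" "is ! l = is ! m"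
      "is ! m - (if m = 0 then 0 else is ! (m - 1)) = 2" unfolding double_entries_def by blast
    from m(3) show ?R unfolding inj[OF m(2,1)] .
  next
    assume ?R
    with assms show ?L unfolding double_entries_def by blast
  qed
  show "prv (is ! l) = (if l = 0 then 0 else is ! (l - 1))"
    unfolding prv_def 2 using nth_step[OF assms] nth_prev_less[OF assms] by auto
qed

lemma dbl_nthE:
  assumes "q \<in> dbl"
  obtains l where "l < length is" "is ! l = q" "q - 2 = (if l = 0 then 0 else is ! (l - 1))" "2 \<le> q"
  using assms unfolding double_entries_def by auto

lemma pos_0 [simp]: "0 \<in> pos" and pos_n: "n \<in> pos" and pos_le: "p \<in> pos \<Longrightarrow> p \<le> n"
  using n_in_is is_le by (auto simp: pos_def)

lemma n_pos: "0 < n"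
  using n_in_is is_pos by blast

lemma dblD:
  assumes "q \<in> dbl"
  shows "q \<in> set is" "2 \<le> q" "q - 2 \<in> pos" "q - 1 \<notin> pos" "q \<le> n" "q \<in> pos"
proof -
  obtain l where l: "l < length is" "is ! l = q" "q - 2 = (if l = 0 then 0 else is ! (l - 1))" "2 \<le> q"
    using dbl_nthE[OF assms] by blast
  show "q \<in> set is" "2 \<le> q" using l by auto
  then show "q \<le> n" "q \<in> pos" using is_le by (auto simp: pos_def)
  show "q - 2 \<in> pos" unfolding pos_def using l by (auto split: if_splits)
  have "q - 1 \<notin> set is" using l(4) not_between[OF l(1), of "q - 1"] l unfolding l(3)[symmetric] by auto
  then show "q - 1 \<notin> pos" using l by (auto simp: pos_def)
qed

lemma dbl_not_Suc: "q \<in> dbl \<Longrightarrow> Suc q \<notin> dbl"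
  using dblD(4)[of "Suc q"] dblD(6) by fastforce

text \<open>The first flag dimension not below \<open>p\<close> must be \<open>p\<close> itself: a
  step of length two reaching it would make \<open>p\<close> one of the two crossed points of a
  double entry.\<close>

lemma single:
  assumes "1 \<le> p" "p \<le> n" "\<not> crs p"
  shows "p \<in> set is" "p - 1 \<in> pos" "p \<in> pos" "p \<notin> dbl" "prv p = p - 1"
proof -
  define l where "l = (LEAST l. l < length is \<and> p \<le> is ! l)"
  have "\<exists>l. l < length is \<and> p \<le> is ! l"
    using assms(2) last_is is_ne by (intro exI[of _ "length is - 1"]) (auto simp: last_conv_nth)
  then have l: "l < length is" "p \<le> is ! l" unfolding l_def by (metis (mono_tags, lifting) LeastI)+
  have "is ! (l - 1) < p" if "l \<noteq> 0"
  proof (rule ccontr)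
    assume "\<not> ?thesis"
    then have "l \<le> l - 1" unfolding l_def using l by (intro Least_le) (auto simp: l_def)
    with that show False by simp
  qed
  with assms have lt: "(if l = 0 then 0 else is ! (l - 1)) < p" by auto
  have "is ! l - (if l = 0 then 0 else is ! (l - 1)) \<noteq> 2"
  proof
    assume "is ! l - (if l = 0 then 0 else is ! (l - 1)) = 2"
    moreover from this nth_cases(2)[OF l(1)] have "is ! l \<in> dbl" by blast
    moreover have "p = is ! l \<or> Suc p = is ! l" using calculation lt l by (auto split: if_splits)
    ultimately show False using assms by (auto simp: crs_def)
  qed
  with nth_step[OF l(1)] have d: "is ! l - (if l = 0 then 0 else is ! (l - 1)) = 1" by auto
  with lt l have p: "p = is ! l" by auto
  then show "p \<in> set is" "p \<in> pos" using l by (auto simp: pos_def)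
  show "p \<notin> dbl" using assms by (auto simp: crs_def)
  then show "prv p = p - 1" by (simp add: prv_def)
  have "p - 1 = (if l = 0 then 0 else is ! (l - 1))" using d p lt by auto
  then show "p - 1 \<in> pos" using l by (auto simp: pos_def split: if_splits)
qed

lemma pos_cases:
  assumes "p \<in> pos"
  obtains "p = 0" | "p \<in> dbl" "2 \<le> p" "p - 2 \<in> pos" | "1 \<le> p" "p \<le> n" "\<not> crs p" "p - 1 \<in> pos"
proof (cases "p = 0")
  case False
  then have p: "1 \<le> p" "p \<le> n" using assms pos_le by auto
  have "Suc p \<notin> dbl" using dblD(4)[of "Suc p"] assms by auto
  then show ?thesis using that dblD[of p] single(2)[OF p] p by (cases "p \<in> dbl") (auto simp: crs_def)
qed (use that in blast)

lemma crs_not_pos: "Suc p \<in> dbl \<Longrightarrow> p \<notin> pos"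
  using dblD(4)[of "Suc p"] by simp

lemma rows_dbl:
  assumes q: "q \<in> dbl"
  shows "q \<in> set (fst w) \<and> q \<in> set (snd w)"
proof -
  obtain l where l: "l < length is" "is ! l = q" using dbl_nthE[OF q] by blast
  have "count (type_mset is) q = 2"
    using type_count(1)[OF l(1)] nth_cases(2)[OF l(1)] q unfolding l(2) by simp
  then show ?thesis unfolding count_rows[symmetric] row_count by (auto split: if_splits)
qed

lemma rows_single:
  assumes "1 \<le> p" "p \<le> n" "\<not> crs p"
  shows "p \<in> set (fst w) \<longleftrightarrow> p \<notin> set (snd w)"
proof -
  from single(1)[OF assms] obtain l where l: "l < length is" "is ! l = p" by (metis in_set_conv_nth)
  have "count (type_mset is) p = 1"
    using type_count(1)[OF l(1)] nth_cases(2)[OF l(1)] nth_step[OF l(1)] single(4)[OF assms]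
    unfolding l(2) by simp
  then show ?thesis unfolding count_rows[symmetric] row_count by (auto split: if_splits)
qed

lemma lab_inner:
  assumes "1 \<le> p" "p \<le> n"
  shows "lab (int p) = (if crs p then Some Cross else if p \<in> set (fst w) then Some Up else Some Down)"
  using rows_single[OF assms] assms unfolding ext_label_def crs_def by auto

lemma lab_left: "p \<le> 0 \<Longrightarrow> lab p = (if - int (n - k) + 1 \<le> p then Some Down else None)"
  and lab_right: "int n < p \<Longrightarrow> lab p = (if p \<le> int n + int k then Some Up else None)"
  unfolding ext_label_def by auto

lemma T_0 [simp]: "T 0 = 0" and B_0 [simp]: "B 0 = 0"
  using rows_subset is_pos by (auto simp: T_def B_def intro!: tcount_0)

lemma T_single: "\<lbrakk>1 \<le> p; p \<le> n; \<not> crs p\<rbrakk> \<Longrightarrow> T p = T (p - 1) + (if lab (int p) = Some Up then 1 else 0)"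
  and B_single: "\<lbrakk>1 \<le> p; p \<le> n; \<not> crs p\<rbrakk> \<Longrightarrow> B p = B (p - 1) + (if lab (int p) = Some Up then 0 else 1)"
  using tcount_Suc[of "fst w" "p - 1"] tcount_Suc[of "snd w" "p - 1"] rows_single[of p]
  by (auto simp: T_def B_def lab_inner)

lemma T_dbl: "q \<in> dbl \<Longrightarrow> T q = T (q - 2) + 1" and B_dbl: "q \<in> dbl \<Longrightarrow> B q = B (q - 2) + 1"
proof -
  assume q: "q \<in> dbl"
  have "q - 1 \<notin> set (fst w)" "q - 1 \<notin> set (snd w)"
    using dblD(4)[OF q] rows_subset by (auto simp: pos_def)
  moreover have "Suc (q - 2) = q - 1" "Suc (q - 1) = q" using dblD(2)[OF q] by auto
  ultimately show "T q = T (q - 2) + 1" "B q = B (q - 2) + 1"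
    using tcount_Suc[of "fst w" "q - 2"] tcount_Suc[of "snd w" "q - 2"] tcount_Suc[of "fst w" "q - 1"]
      tcount_Suc[of "snd w" "q - 1"] rows_dbl[OF q]
    by (auto simp: T_def B_def)
qed

lemma TB: "p \<in> pos \<Longrightarrow> T p + B p = p"
proof (induction p rule: less_induct)
  case (less p)
  from less.prems show ?case
  proof (cases rule: pos_cases)
    case 2 then show ?thesis using less.IH[of "p - 2"] T_dbl[of p] B_dbl[of p] by auto
  next
    case 3 then show ?thesis using less.IH[of "p - 1"] T_single[of p] B_single[of p] by auto
  qed simp
qed

lemma T_n: "T n = n - k" and B_n: "B n = k"
proof -
  have "{x \<in> set (fst w). x \<le> n} = set (fst w)" "{x \<in> set (snd w). x \<le> n} = set (snd w)"
    using rows_subset is_le by auto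
  then show "T n = n - k" "B n = k"
    using rs distinct_rows unfolding T_def B_def tcount_def row_strict_tableau_def
    by (auto simp: distinct_card)
qed

lemma T_mono: "p \<le> q \<Longrightarrow> T p \<le> T q" and B_mono: "p \<le> q \<Longrightarrow> B p \<le> B q"
  by (simp_all add: T_def B_def tcount_mono)

end

section \<open>Orientations of circles\<close>

text \<open>Models one side of the circle diagram after completion by the extra arcs. Only then do
  both sides match the same set \<open>X\<close>, which the parity arguments about circles
  need.\<close>

definition arc_matching :: "int set \<Rightarrow> (int \<times> int) set \<Rightarrow> bool" where
  "arc_matching X A \<longleftrightarrow> finite X \<and> X = joined A \<and> (\<forall>p q r. (p, q) \<in> A \<longrightarrow> (q, r) \<notin> A) \<and>
     (\<forall>p q. (p, q) \<in> A \<longrightarrow> p < q) \<and>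
     (\<forall>p q p' q'. (p, q) \<in> A \<longrightarrow> (p', q') \<in> A \<longrightarrow> p = p' \<or> q = q' \<longrightarrow> p = p' \<and> q = q') \<and>
     (\<forall>p q r. (p, q) \<in> A \<longrightarrow> p < r \<longrightarrow> r < q \<longrightarrow> r \<in> X \<longrightarrow>
        (\<exists>s. (r, s) \<in> A \<and> s < q) \<or> (\<exists>s. (s, r) \<in> A \<and> p < s))"

lemma arc_matchingD:
  assumes "arc_matching X A"
  shows "finite X" and "X = joined A"
    and "\<And>p q. (p, q) \<in> A \<Longrightarrow> p < q"
    and "\<And>p q. (p, q) \<in> A \<Longrightarrow> p \<in> X" and "\<And>p q. (p, q) \<in> A \<Longrightarrow> q \<in> X"
    and "\<And>p q q'. (p, q) \<in> A \<Longrightarrow> (p, q') \<in> A \<Longrightarrow> q = q'"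
    and "\<And>p q p'. (p, q) \<in> A \<Longrightarrow> (p', q) \<in> A \<Longrightarrow> p = p'"
    and "\<And>p q r. (p, q) \<in> A \<Longrightarrow> (q, r) \<notin> A"
    and "\<And>p q r. (p, q) \<in> A \<Longrightarrow> p < r \<Longrightarrow> r < q \<Longrightarrow> r \<in> X \<Longrightarrow>
        (\<exists>s. (r, s) \<in> A \<and> s < q) \<or> (\<exists>s. (s, r) \<in> A \<and> p < s)"
  using assms unfolding arc_matching_def by (simp_all, (blast intro: joined_iff[THEN iffD2])+)

text \<open>Each arc meeting \<open>Y\<close> has one left and one right end in it, and no point is
  both a left end and a right end.\<close>

lemma arc_matching_even:
  assumes M: "arc_matching X A" and Y: "Y \<subseteq> X"
    and cl: "\<And>p q. (p, q) \<in> A \<Longrightarrow> p \<in> Y \<longleftrightarrow> q \<in> Y"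
  shows "even (card Y)"
proof -
  note D = arc_matchingD[OF M]
  define AY where "AY = {z \<in> A. fst z \<in> Y}"
  have Yeq: "Y = fst ` AY \<union> snd ` AY"
  proof (intro equalityI subsetI)
    fix y assume y: "y \<in> Y"
    then obtain z where "(y, z) \<in> A \<or> (z, y) \<in> A" using Y D(2) joined_iff[of y A] by blast
    then show "y \<in> fst ` AY \<union> snd ` AY"
    proof
      assume "(y, z) \<in> A" then show ?thesis using y by (force simp: AY_def)
    next
      assume "(z, y) \<in> A" then show ?thesis using y cl by (force simp: AY_def)
    qed
  qed (auto simp: AY_def cl)
  have fst: "inj_on fst AY" and snd: "inj_on snd AY"
    using D(6,7) by (auto simp: inj_on_def AY_def)
  have "fst ` AY \<inter> snd ` AY = {}"
    using D(8) by (auto simp: AY_def)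
  moreover have "finite Y" using D(1) Y finite_subset by blast
  then have "finite (fst ` AY)" "finite (snd ` AY)" using Yeq by (metis finite_Un)+
  ultimately have "card Y = card AY + card AY"
    using card_Un_disjoint[of "fst ` AY" "snd ` AY"] card_image[OF fst] card_image[OF snd] Yeq by auto
  then show ?thesis by simp
qed

definition idx :: "int set \<Rightarrow> int \<Rightarrow> nat" where
  "idx E x = card {e \<in> E. e < x}"

text \<open>A discrete Jordan curve theorem: the arc cuts off a subset of E that is itself
  perfectly matched, so the ranks of its two ends within E have opposite parity.\<close>

lemma idx_arc:
  assumes M: "arc_matching X A" and E: "E \<subseteq> X"
    and cl: "\<And>p q. (p, q) \<in> A \<Longrightarrow> p \<in> E \<longleftrightarrow> q \<in> E"
    and pq: "(p, q) \<in> A" "p \<in> E"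
  shows "even (idx E q) \<longleftrightarrow> odd (idx E p)"
proof -
  note D = arc_matchingD[OF M]
  let ?Y = "{e \<in> E. p < e \<and> e < q}"
  \<comment> \<open>Noncrossing keeps the partner between \<open>p\<close> and \<open>q\<close>, and
    \<open>cl\<close> keeps it in \<open>E\<close>; so \<open>?Y\<close> consists of whole
    arcs.\<close>
  have half: "b \<in> ?Y" if "(a, b) \<in> A" "a \<in> ?Y" for a b
  proof -
    from that(2) have a: "a \<in> E" "p < a" "a < q" "a \<in> X" using E by auto
    from D(9)[OF pq(1) a(2-4)] D(8)[of _ a b] that(1) obtain s where "(a, s) \<in> A" "s < q" by blast
    with D(6)[OF that(1)] have "b < q" by blast
    with cl[OF that(1)] D(3)[OF that(1)] a show ?thesis by simp
  qed
  have half': "a \<in> ?Y" if "(a, b) \<in> A" "b \<in> ?Y" for a b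
  proof -
    from that(2) have b: "b \<in> E" "p < b" "b < q" "b \<in> X" using E by auto
    from D(9)[OF pq(1) b(2-4)] D(8)[of a b] that(1) obtain s where "(s, b) \<in> A" "p < s" by blast
    with D(7)[OF that(1)] have "p < a" by blast
    with cl[OF that(1)] D(3)[OF that(1)] b show ?thesis by simp
  qed
  have ev: "even (card ?Y)"
  proof (rule arc_matching_even[OF M])
    show "?Y \<subseteq> X" using E by blast
    show "a \<in> ?Y \<longleftrightarrow> b \<in> ?Y" if "(a, b) \<in> A" for a b
      using half[OF that] half'[OF that] by (rule iffI)
  qed
  have fin: "finite E" using D(1) E finite_subset by blast
  have "{e \<in> E. e < q} = insert p {e \<in> E. e < p} \<union> ?Y" using D(3)[OF pq(1)] pq(2) by auto
  then have "idx E q = card (insert p {e \<in> E. e < p}) + card ?Y"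
    unfolding idx_def using fin by (simp add: card_Un_disjoint disjoint_iff)
  also have "card (insert p {e \<in> E. e < p}) = Suc (idx E p)" using fin by (simp add: idx_def)
  finally show ?thesis using ev by simp
qed

lemma idx_consecutive:
  assumes "finite E" "x \<in> E" "x < y" "\<And>e. e \<in> E \<Longrightarrow> \<not> (x < e \<and> e < y)"
  shows "idx E y = Suc (idx E x)"
proof -
  have "{e \<in> E. e < y} = insert x {e \<in> E. e < x}" using assms by (auto, force)
  then show ?thesis using assms by (simp add: idx_def)
qed

lemma consecutive_exists:
  fixes S :: "int set"
  assumes "card S > 1"
  shows "\<exists>x y. x \<in> S \<and> y \<in> S \<and> x < y \<and> (\<forall>e\<in>S. \<not> (x < e \<and> e < y))"
proof -
  have fin: "finite S" using assms by (metis card.infinite not_less_zero)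
  have ne: "S \<noteq> {}" using assms by auto
  define x where "x = Min S"
  have x: "x \<in> S" "\<And>e. e \<in> S \<Longrightarrow> x \<le> e" using fin ne by (auto simp: x_def)
  have "card (S - {x}) > 0" using assms x by simp
  then have ne': "S - {x} \<noteq> {}" by force
  define y where "y = Min (S - {x})"
  have "y \<in> S - {x}" unfolding y_def by (rule Min_in) (use fin ne' in auto)
  moreover have "\<And>e. e \<in> S - {x} \<Longrightarrow> y \<le> e" unfolding y_def by (rule Min_le) (use fin in auto)
  ultimately have "y \<in> S" "x < y" "\<forall>e\<in>S. \<not> (x < e \<and> e < y)"
    using x by fastforce+
  with x show ?thesis by blast
qed

section \<open>Circles as components of the union of two matchings\<close>

definition comp_of :: "(int \<times> int) set \<Rightarrow> int \<Rightarrow> int set" where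
  "comp_of E v = {u. (v, u) \<in> (E \<union> E\<inverse>)\<^sup>*}"

lemma comp_of_eq: "u \<in> comp_of E v \<Longrightarrow> comp_of E u = comp_of E v"
proof -
  assume u: "u \<in> comp_of E v"
  have "sym ((E \<union> E\<inverse>)\<^sup>*)" by (intro sym_rtrancl sym_Un_converse)
  with u have "(u, v) \<in> (E \<union> E\<inverse>)\<^sup>*" by (auto simp: comp_of_def dest: symD)
  with u show ?thesis by (auto simp: comp_of_def intro: rtrancl_trans)
qed

lemma comp_of_refl: "v \<in> comp_of E v"
  by (simp add: comp_of_def)

lemma comp_of_edge: "(p, q) \<in> E \<Longrightarrow> p \<in> comp_of E v \<longleftrightarrow> q \<in> comp_of E v"
  unfolding comp_of_def by (auto intro: rtrancl_into_rtrancl)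

lemma comp_of_subset:
  assumes "v \<in> X" "\<And>p q. (p, q) \<in> E \<Longrightarrow> p \<in> X \<and> q \<in> X"
  shows "comp_of E v \<subseteq> X"
proof
  fix u assume "u \<in> comp_of E v"
  then have "(v, u) \<in> (E \<union> E\<inverse>)\<^sup>*" by (simp add: comp_of_def)
  then show "u \<in> X" by induction (use assms in auto)
qed

text \<open>By \<open>idx_arc\<close> the parity of the rank within a circle changes along every
  arc, as does any labelling \<open>lam\<close>; so on one circle \<open>lam\<close> equals that
  parity up to a global flip. Neighbouring points of a circle have ranks of different parity, which
  is the obstruction. Conversely the parity itself serves as labelling.\<close>

lemma red_comp_iff:
  assumes MA: "arc_matching X A" and MB: "arc_matching X A'"
  shows "(\<exists>v\<in>X. red_circle n (comp_of (A \<union> A') v)) \<longleftrightarrow>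
    \<not> (\<exists>lam :: int \<Rightarrow> bool. (\<forall>(p, q)\<in>A \<union> A'. lam p \<noteq> lam q) \<and>
        (\<forall>p\<in>X. p < 1 \<longrightarrow> lam p) \<and> (\<forall>p\<in>X. int n < p \<longrightarrow> \<not> lam p))"
proof -
  let ?E = "A \<union> A'"
  have sub: "comp_of ?E v \<subseteq> X" if "v \<in> X" for v
    by (rule comp_of_subset[OF that]) (use arc_matchingD(4,5)[OF MA] arc_matchingD(4,5)[OF MB] in blast)
  have clA: "p \<in> comp_of ?E v \<longleftrightarrow> q \<in> comp_of ?E v" if "(p, q) \<in> A" for p q v
    by (rule comp_of_edge) (use that in simp)
  have clB: "p \<in> comp_of ?E v \<longleftrightarrow> q \<in> comp_of ?E v" if "(p, q) \<in> A'" for p q v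
    by (rule comp_of_edge) (use that in simp)
  have par: "even (idx (comp_of ?E v) q) \<longleftrightarrow> odd (idx (comp_of ?E v) p)"
    if "v \<in> X" "(p, q) \<in> ?E" "p \<in> comp_of ?E v" for p q v
    using that(2)
  proof
    assume "(p, q) \<in> A"
    then show ?thesis using idx_arc[OF MA sub[OF that(1)], of p q] clA that(3) by blast
  next
    assume "(p, q) \<in> A'"
    then show ?thesis using idx_arc[OF MB sub[OF that(1)], of p q] clB that(3) by blast
  qed
  have fin: "finite (comp_of ?E v)" if "v \<in> X" for v
    using sub[OF that] arc_matchingD(1)[OF MA] finite_subset by blast
  show ?thesis
  proof (intro iffI notI)
    assume "\<exists>v\<in>X. red_circle n (comp_of ?E v)"
    then obtain v where v: "v \<in> X" "red_circle n (comp_of ?E v)" by blast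
    let ?c = "comp_of ?E v"
    assume "\<exists>lam :: int \<Rightarrow> bool. (\<forall>(p, q)\<in>?E. lam p \<noteq> lam q) \<and>
        (\<forall>p\<in>X. p < 1 \<longrightarrow> lam p) \<and> (\<forall>p\<in>X. int n < p \<longrightarrow> \<not> lam p)"
    then obtain lam :: "int \<Rightarrow> bool" where lam: "(\<forall>(p, q)\<in>?E. lam p \<noteq> lam q) \<and>
        (\<forall>p\<in>X. p < 1 \<longrightarrow> lam p) \<and> (\<forall>p\<in>X. int n < p \<longrightarrow> \<not> lam p)" by (rule exE)
    have e: "lam p \<noteq> lam q" if "(p, q) \<in> ?E" for p q
      using conjunct1[OF lam] that by auto
    have l: "lam p" if "p \<in> X" "p < 1" for p
      using conjunct1[OF conjunct2[OF lam]] that by simp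
    have r: "\<not> lam p" if "p \<in> X" "int n < p" for p
      using conjunct2[OF conjunct2[OF lam]] that by simp
    have agree: "(lam v = lam u) = (even (idx ?c v) = even (idx ?c u))" if "u \<in> ?c" for u
    proof -
      from that have "(v, u) \<in> (?E \<union> ?E\<inverse>)\<^sup>*" by (simp add: comp_of_def)
      then show ?thesis
      proof induction
        case (step y z)
        have y: "y \<in> ?c" using step.hyps by (simp add: comp_of_def)
        have z: "z \<in> ?c" using rtrancl_into_rtrancl[OF step.hyps] by (simp add: comp_of_def)
        from step.hyps(2) consider "(y, z) \<in> ?E" | "(z, y) \<in> ?E" by blast
        then show ?case
        proof cases
          case 1
          show ?thesis using step.IH e[OF 1] par[OF v(1) 1 y] by argo
        next
          case 2
          show ?thesis using step.IH e[OF 2] par[OF v(1) 2 z] by argo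
        qed
      qed simp
    qed
    \<comment> \<open>All left outer points carry True and all right outer ones False, so two points
      on the same side that are neighbours within the circle violate the alternation.\<close>
    have "\<exists>x y. x \<in> ?c \<and> y \<in> ?c \<and> x < y \<and> (\<forall>e\<in>?c. \<not> (x < e \<and> e < y)) \<and> lam x = lam y"
      using v(2) unfolding red_circle_def
    proof
      assume "card {p \<in> ?c. p < 1} > 1"
      from consecutive_exists[OF this] obtain x y where "x \<in> {p \<in> ?c. p < 1}" "y \<in> {p \<in> ?c. p < 1}"
        "x < y" "\<forall>e\<in>{p \<in> ?c. p < 1}. \<not> (x < e \<and> e < y)" by (elim exE conjE)
      then have xy: "x \<in> ?c" "y \<in> ?c" "x < y" "\<forall>e\<in>?c. \<not> (x < e \<and> e < y)" "lam x" "lam y"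
        using l sub[OF v(1)] by (auto 0 3)
      show ?thesis by (rule exI[of _ x], rule exI[of _ y]) (simp add: xy)
    next
      assume "card {p \<in> ?c. p > int n} > 1"
      from consecutive_exists[OF this] obtain x y where "x \<in> {p \<in> ?c. p > int n}" "y \<in> {p \<in> ?c. p > int n}"
        "x < y" "\<forall>e\<in>{p \<in> ?c. p > int n}. \<not> (x < e \<and> e < y)" by (elim exE conjE)
      then have xy: "x \<in> ?c" "y \<in> ?c" "x < y" "\<forall>e\<in>?c. \<not> (x < e \<and> e < y)" "\<not> lam x" "\<not> lam y"
        using r sub[OF v(1)] by (auto 0 3)
      show ?thesis by (rule exI[of _ x], rule exI[of _ y]) (simp add: xy)
    qed
    then obtain x y where xy: "x \<in> ?c" "y \<in> ?c" "x < y" "\<forall>e\<in>?c. \<not> (x < e \<and> e < y)" "lam x = lam y"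
      by (elim exE conjE)
    have "idx ?c y = Suc (idx ?c x)"
      by (rule idx_consecutive[OF fin[OF v(1)] xy(1,3)]) (use xy(4) in simp)
    with agree[OF xy(1)] agree[OF xy(2)] xy(5) show False by auto
  next
    assume no: "\<not> (\<exists>lam :: int \<Rightarrow> bool. (\<forall>(p, q)\<in>?E. lam p \<noteq> lam q) \<and>
        (\<forall>p\<in>X. p < 1 \<longrightarrow> lam p) \<and> (\<forall>p\<in>X. int n < p \<longrightarrow> \<not> lam p))"
    show "\<exists>v\<in>X. red_circle n (comp_of ?E v)"
    proof (rule ccontr)
      assume nr: "\<not> ?thesis"
      define lam where "lam x \<longleftrightarrow> even (idx (comp_of ?E x) x)" for x
      have e: "lam p \<noteq> lam q" if "(p, q) \<in> ?E" for p q
      proof -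
        have p: "p \<in> X" using that arc_matchingD(4)[OF MA] arc_matchingD(4)[OF MB] by blast
        have "q \<in> comp_of ?E p" using comp_of_edge[OF that] comp_of_refl by blast
        then have "comp_of ?E q = comp_of ?E p" by (rule comp_of_eq)
        then show ?thesis using par[OF p that comp_of_refl] by (simp add: lam_def)
      qed
      have l: "lam p" if p: "p \<in> X" "p < 1" for p
      proof -
        let ?c = "comp_of ?E p"
        \<comment> \<open>A circle that is not red has at most one left outer point, so
          \<open>p\<close> is its first point and has rank 0.\<close>
        have "{e \<in> ?c. e < p} = {}"
        proof (rule ccontr)
          assume "\<not> ?thesis"
          then obtain e where e: "e \<in> ?c" "e < p" by blast
          have "card {e, p} \<le> card {p \<in> ?c. p < 1}"
            by (rule card_mono) (use e p fin[OF p(1)] comp_of_refl in auto)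
          with e nr p show False by (auto simp: red_circle_def)
        qed
        then show ?thesis unfolding lam_def idx_def by (simp only: card.empty) simp
      qed
      have r: "\<not> lam p" if p: "p \<in> X" "int n < p" for p
      proof -
        let ?c = "comp_of ?E p"
        have "{e \<in> ?c. e > p} = {}"
        proof (rule ccontr)
          assume "\<not> ?thesis"
          then obtain e where e: "e \<in> ?c" "e > p" by blast
          have "card {e, p} \<le> card {p \<in> ?c. p > int n}"
            by (rule card_mono) (use e p fin[OF p(1)] comp_of_refl in auto)
          with e nr p show False by (auto simp: red_circle_def)
        qed
        \<comment> \<open>Here \<open>p\<close> is the last point of its circle, so its rank is one
          less than the number of points. That number is even because the circle consists of whole
          arcs.\<close>
        then have "?c = insert p {e \<in> ?c. e < p}" using comp_of_refl[of p ?E]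
          by (auto simp: not_less_iff_gr_or_eq)
        then have "card ?c = Suc (idx ?c p)"
          unfolding idx_def by (metis (no_types, lifting) card_insert_disjoint fin finite_insert
              mem_Collect_eq order_less_irrefl p(1))
        moreover have "even (card ?c)"
          by (rule arc_matching_even[OF MA sub[OF p(1)] clA])
        ultimately show ?thesis by (simp add: lam_def)
      qed
      have "(\<forall>(p, q)\<in>?E. lam p \<noteq> lam q) \<and>
        (\<forall>p\<in>X. p < 1 \<longrightarrow> lam p) \<and> (\<forall>p\<in>X. int n < p \<longrightarrow> \<not> lam p)"
        using e l r by auto
      then have "\<exists>lam :: int \<Rightarrow> bool. (\<forall>(p, q)\<in>?E. lam p \<noteq> lam q) \<and>
        (\<forall>p\<in>X. p < 1 \<longrightarrow> lam p) \<and> (\<forall>p\<in>X. int n < p \<longrightarrow> \<not> lam p)"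
        by (rule exI[of _ lam])
      with no show False by (rule notE)
    qed
  qed
qed

lemma int_range_cases:
  fixes q :: int
  obtains "q \<le> 0" | p where "1 \<le> p" "p \<le> n" "q = int p" | "int n < q"
proof -
  consider "q \<le> 0" | "int n < q" | "1 \<le> nat q" "nat q \<le> n" "q = int (nat q)" by linarith
  then show thesis using that by cases blast+
qed

section \<open>The extended cup diagram of a tableau\<close>

context two_row_tableau
begin

lemma rows_bounds: "x \<in> set (fst w) \<Longrightarrow> 1 \<le> x \<and> x \<le> n" "x \<in> set (snd w) \<Longrightarrow> 1 \<le> x \<and> x \<le> n"
  using rows_subset is_pos[of x] is_le[of x] by auto

lemma lab_Down_le: "lab p = Some Down \<Longrightarrow> p \<le> int n" and lab_Up_ge: "lab q = Some Up \<Longrightarrow> 1 \<le> q"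
  by (auto simp: ext_label_def split: if_splits)

lemma lab_None: "lab p = None \<longleftrightarrow> p < - int (n - k) + 1 \<or> int n + int k < p"
proof -
  consider "p \<le> 0" | "1 \<le> p" "p \<le> int n" | "int n < p" by linarith
  then show ?thesis
  proof cases
    case 2
    then have "lab (int (nat p)) \<noteq> None" by (subst lab_inner) auto
    with 2 show ?thesis by auto
  qed (auto simp: lab_left lab_right)
qed

lemma lab_Up_iff: "lab q = Some Up \<longleftrightarrow> q \<in> int ` (set (fst w) - dbl) \<union> {int n + 1..int n + int k}"
proof -
  show ?thesis
  proof (cases q rule: int_range_cases[where n = n])
    case 1 then show ?thesis by (auto simp: lab_left dest: rows_bounds)
  next
    case (2 p)
    have "p \<in> set (fst w) \<Longrightarrow> Suc p \<notin> dbl" using rows_subset crs_not_pos by (auto simp: pos_def)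
    with 2 show ?thesis by (auto simp: lab_inner crs_def)
  next
    case 3 then show ?thesis by (auto simp: lab_right dest: rows_bounds)
  qed
qed

lemma lab_Down_iff: "lab p = Some Down \<longleftrightarrow> p \<in> int ` (set (snd w) - dbl) \<union> {- int (n - k) + 1..0}"
proof -
  show ?thesis
  proof (cases p rule: int_range_cases[where n = n])
    case 1 then show ?thesis by (auto simp: lab_left dest: rows_bounds)
  next
    case (2 q)
    have "q \<in> set (snd w) \<Longrightarrow> Suc q \<notin> dbl" using rows_subset crs_not_pos by (auto simp: pos_def)
    moreover have "crs q \<Longrightarrow> q \<in> dbl \<or> Suc q \<in> dbl" by (simp add: crs_def)
    ultimately show ?thesis using 2 rows_single[of q] by (auto simp: lab_inner crs_def)
  next
    case 3 then show ?thesis by (auto simp: lab_right dest: rows_bounds)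
  qed
qed

lemma card_rows: "card (set (fst w)) = n - k" "card (set (snd w)) = k"
  using rs distinct_rows by (auto simp: row_strict_tableau_def distinct_card)

text \<open>The number of added points is exactly what the counting hypotheses require: all n - k
  prepended Downs precede an inner Up, while at most n - k - 1 other Ups do; symmetrically for the k
  appended Ups.\<close>

lemma C_reach: "C \<in> cup_reach n lab" and C_complete: "cups_complete n lab C"
proof -
  have fin: "finite {p. lab p \<noteq> None}"
    by (rule finite_subset[of _ "{- int (n - k) + 1..int n + int k}"]) (auto simp: lab_None simp del: not_None_eq)
  have "\<exists>!C. C \<in> cup_reach n lab \<and> cups_complete n lab C"
  proof (rule cup_reach_complete_ex1[OF _ _ fin])
    show "lab r \<noteq> None" if "lab p = Some Down" "lab q = Some Up" "p < r" "r < q" for p q r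
      using that lab_None[of p] lab_None[of q] lab_None[of r] by auto
  next
    fix i assume i: "1 \<le> i" "i \<le> int n" "lab i = Some Up"
    have "i \<in> int ` set (fst w)" using i by (auto simp: lab_Up_iff)
    then have "card (int ` set (fst w) - {i}) < card (int ` set (fst w))"
      by (intro psubset_card_mono) auto
    also have "\<dots> = n - k" using card_rows by (simp add: card_image)
    finally have 1: "card (int ` set (fst w) - {i}) < n - k" .
    have "card {q. lab q = Some Up \<and> q < i} \<le> card (int ` set (fst w) - {i})"
      by (rule card_mono) (use i in \<open>auto simp: lab_Up_iff\<close>)
    also note 1
    also have "n - k = card {- int (n - k) + 1..0}" by simp
    also have "\<dots> \<le> card {p. lab p = Some Down \<and> p < i}"
      by (rule card_mono) (use i in \<open>auto simp: lab_Down_iff intro: finite_subset[OF _ fin]\<close>)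
    finally show "card {q. lab q = Some Up \<and> q < i} < card {p. lab p = Some Down \<and> p < i}" .
  next
    fix i assume i: "1 \<le> i" "i \<le> int n" "lab i = Some Down"
    have "i \<in> int ` set (snd w)" using i by (auto simp: lab_Down_iff)
    then have "card (int ` set (snd w) - {i}) < card (int ` set (snd w))"
      by (intro psubset_card_mono) auto
    also have "\<dots> = k" using card_rows by (simp add: card_image)
    finally have 1: "card (int ` set (snd w) - {i}) < k" .
    have "card {p. lab p = Some Down \<and> i < p} \<le> card (int ` set (snd w) - {i})"
      by (rule card_mono) (use i in \<open>auto simp: lab_Down_iff\<close>)
    also note 1
    also have "k = card {int n + 1..int n + int k}" by simp
    also have "\<dots> \<le> card {q. lab q = Some Up \<and> i < q}"
      by (rule card_mono) (use i in \<open>auto simp: lab_Up_iff intro: finite_subset[OF _ fin]\<close>)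
    finally show "card {p. lab p = Some Down \<and> i < p} < card {q. lab q = Some Up \<and> i < q}" .
  qed (fact lab_Down_le lab_Up_ge)+
  then have "C \<in> cup_reach n lab \<and> cups_complete n lab C"
    unfolding C_def ext_cups_def cups_complete_def by (rule theI')
  then show "C \<in> cup_reach n lab" "cups_complete n lab C" by simp_all
qed

lemma C_matching: "cup_matching n lab C"
  by (rule cup_reach_matching[OF C_reach]) (fact lab_Down_le lab_Up_ge)+

lemmas CD = cup_matchingD[OF C_matching]

lemma C_joined: "\<lbrakk>1 \<le> p; p \<le> n; \<not> crs p\<rbrakk> \<Longrightarrow> int p \<in> joined C"
  using C_complete by (auto simp: cups_complete_def lab_inner)

lemma C_disj: "(p, q) \<in> C \<Longrightarrow> (q, r) \<notin> C"
  using CD(3,4) by force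

lemma joined_lab: "p \<in> joined C \<Longrightarrow> lab p = Some Up \<or> lab p = Some Down"
  using CD(3,4) by (auto simp: joined_iff)

lemma joined_inner_iff: "1 \<le> p \<Longrightarrow> p \<le> n \<Longrightarrow> int p \<in> joined C \<longleftrightarrow> \<not> crs p"
  using C_joined joined_lab[of "int p"] by (auto simp: lab_inner split: if_splits)

lemma C_inside:
  assumes "(p, q) \<in> C" "p < r" "r < q" "r \<in> joined C"
  shows "(\<exists>s. (r, s) \<in> C \<and> s < q) \<or> (\<exists>s. (s, r) \<in> C \<and> p < s)"
  using CD(8)[OF assms(1-3)] joined_lab[OF assms(4)] by auto

lemma finite_joined: "finite (joined C)"
  using CD(1) by (simp add: joined_def)

end

section \<open>Which added points are used, and how many\<close>

lemma upward_closed_interval: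
  assumes "finite S" "\<And>p. p \<in> S \<Longrightarrow> p \<le> (0::int)" "\<And>p r. p \<in> S \<Longrightarrow> p < r \<Longrightarrow> r \<le> 0 \<Longrightarrow> r \<in> S"
  shows "S = {1 - int (card S)..0}"
proof (cases "S = {}")
  case False
  define m where "m = Min S"
  have m: "m \<in> S" "\<And>p. p \<in> S \<Longrightarrow> m \<le> p" using assms(1) False by (auto simp: m_def)
  have "S = {m..0}" using m assms(2) assms(3)[OF m(1)] by (force simp: order.order_iff_strict)
  then have "card S = nat (1 - m)" by simp
  with assms(2)[OF m(1)] have "1 - int (card S) = m" by simp
  with \<open>S = {m..0}\<close> show ?thesis by (simp only:)
qed simp

lemma downward_closed_interval:
  assumes "finite S" "\<And>p. p \<in> S \<Longrightarrow> a < (p::int)" "\<And>p r. p \<in> S \<Longrightarrow> r < p \<Longrightarrow> a < r \<Longrightarrow> r \<in> S"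
  shows "S = {a + 1..a + int (card S)}"
proof (cases "S = {}")
  case False
  define m where "m = Max S"
  have m: "m \<in> S" "\<And>p. p \<in> S \<Longrightarrow> p \<le> m" using assms(1) False by (auto simp: m_def)
  have "S = {a + 1..m}" using m assms(2) assms(3)[OF m(1)] by (force simp: order.order_iff_strict)
  then have "card S = nat (m - a)" by simp
  with assms(2)[OF m(1)] have "a + int (card S) = m" by simp
  with \<open>S = {a + 1..m}\<close> show ?thesis by (simp only:)
qed simp

context two_row_tableau
begin

definition nl :: nat where "nl = card (left_outer C)"
definition nr :: nat where "nr = card (right_outer n C)"

text \<open>A cup from a left outer point \<open>p\<close> ends at a position >= 1 and so passes
  over every added point between \<open>p\<close> and 1. Those are Downs, not crosses, hence joined
  as well.\<close>

lemma left_outer_eq: "left_outer C = {1 - int nl..0}"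
  unfolding nl_def
proof (rule upward_closed_interval)
  show "finite (left_outer C)" using finite_joined by (simp add: left_outer_def)
  fix p r assume p: "p \<in> left_outer C" and r: "p < r" "r \<le> 0"
  then have "p \<in> joined C" by (simp add: left_outer_def)
  then obtain q where q: "(p, q) \<in> C" using CD(10) p by (force simp: joined_iff left_outer_def)
  with CD(8)[OF q r(1)] CD(10)[OF q] r have "lab r = Some Cross \<or> r \<in> joined C"
    by (auto simp: joined_iff)
  then show "r \<in> left_outer C" using r by (auto simp: left_outer_def lab_left split: if_splits)
qed (auto simp: left_outer_def)

lemma right_outer_eq: "right_outer n C = {int n + 1..int n + int nr}"
  unfolding nr_def
proof (rule downward_closed_interval)
  show "finite (right_outer n C)" using finite_joined by (simp add: right_outer_def)
  fix q r assume q: "q \<in> right_outer n C" and r: "r < q" "int n < r"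
  then have "q \<in> joined C" by (simp add: right_outer_def)
  then obtain p where p: "(p, q) \<in> C" using CD(9) q by (force simp: joined_iff right_outer_def)
  with CD(8)[OF p _ r(1)] CD(9)[OF p] r have "lab r = Some Cross \<or> r \<in> joined C"
    by (auto simp: joined_iff)
  then show "r \<in> right_outer n C" using r by (auto simp: right_outer_def lab_right split: if_splits)
qed (auto simp: right_outer_def)

text \<open>The cups are counted by left and by right ends: left ends are the left outer points and
  the bottom entries that are not double, right ends are the right outer points and the top entries
  that are not double. Hence the difference of \<open>nl\<close> and \<open>nr\<close> is the same
  for all tableaux, and the extra points of one diagram occur equally often on both sides.\<close>

lemma outer_balance: "nl + 2 * k = nr + n"
proof -
  let ?d = "card dbl"
  have dsub: "dbl \<subseteq> set (fst w)" "dbl \<subseteq> set (snd w)" using rows_dbl by auto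
  have find: "finite dbl" using dsub finite_subset by blast
  have inj: "inj_on fst C" "inj_on snd C" using CD(6,7) by (auto simp: inj_on_def)
  have f: "fst ` C = left_outer C \<union> int ` (set (snd w) - dbl)"
  proof (intro equalityI subsetI)
    fix p assume "p \<in> fst ` C"
    then obtain q where q: "(p, q) \<in> C" by auto
    with CD(3)[OF q] CD(9)[OF q] show "p \<in> left_outer C \<union> int ` (set (snd w) - dbl)"
      by (auto simp: lab_Down_iff left_outer_def joined_iff)
  next
    fix p assume p: "p \<in> left_outer C \<union> int ` (set (snd w) - dbl)"
    then have "lab p = Some Down"
      using joined_lab[of p] lab_Up_ge[of p] by (auto simp: left_outer_def lab_Down_iff)
    moreover have "p \<in> joined C"
    proof (cases "p \<in> left_outer C")
      case False
      with p obtain x where x: "x \<in> set (snd w)" "x \<notin> dbl" "p = int x" by auto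
      then have "1 \<le> x" "x \<le> n" "\<not> crs x" using rows_subset is_pos[of x] is_le crs_not_pos[of x]
        by (auto simp: crs_def pos_def Suc_le_eq)
      then show ?thesis using C_joined x by blast
    qed (simp add: left_outer_def)
    ultimately show "p \<in> fst ` C" using CD(4) by (force simp: joined_iff)
  qed
  have s: "snd ` C = right_outer n C \<union> int ` (set (fst w) - dbl)"
  proof (intro equalityI subsetI)
    fix q assume "q \<in> snd ` C"
    then obtain p where p: "(p, q) \<in> C" by auto
    with CD(4)[OF p] CD(10)[OF p] show "q \<in> right_outer n C \<union> int ` (set (fst w) - dbl)"
      by (auto simp: lab_Up_iff right_outer_def joined_iff)
  next
    fix q assume q: "q \<in> right_outer n C \<union> int ` (set (fst w) - dbl)"
    then have "lab q = Some Up"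
      using joined_lab[of q] lab_Down_le[of q] by (auto simp: right_outer_def lab_Up_iff)
    moreover have "q \<in> joined C"
    proof (cases "q \<in> right_outer n C")
      case False
      with q obtain x where x: "x \<in> set (fst w)" "x \<notin> dbl" "q = int x" by auto
      then have "1 \<le> x" "x \<le> n" "\<not> crs x" using rows_subset is_pos[of x] is_le crs_not_pos[of x]
        by (auto simp: crs_def pos_def Suc_le_eq)
      then show ?thesis using C_joined x by blast
    qed (simp add: right_outer_def)
    ultimately show "q \<in> snd ` C" using CD(3) by (force simp: joined_iff)
  qed
  have "card C = nl + (k - ?d)"
  proof -
    have "left_outer C \<inter> int ` (set (snd w) - dbl) = {}"
      by (auto simp: left_outer_def dest: rows_bounds)
    moreover have "card (int ` (set (snd w) - dbl)) = k - ?d"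
      using card_Diff_subset[OF find dsub(2)] card_rows by (simp add: card_image)
    ultimately show ?thesis
      using card_image[OF inj(1)] unfolding f nl_def
      by (subst (asm) card_Un_disjoint) (auto simp: left_outer_def finite_joined)
  qed
  moreover have "card C = nr + (n - k - ?d)"
  proof -
    have "right_outer n C \<inter> int ` (set (fst w) - dbl) = {}"
      by (auto simp: right_outer_def dest: rows_bounds)
    moreover have "card (int ` (set (fst w) - dbl)) = n - k - ?d"
      using card_Diff_subset[OF find dsub(1)] card_rows by (simp add: card_image)
    ultimately show ?thesis
      using card_image[OF inj(2)] unfolding s nr_def
      by (subst (asm) card_Un_disjoint) (auto simp: right_outer_def finite_joined)
  qed
  moreover have "?d \<le> k" "?d \<le> n - k"
    using card_mono[OF _ dsub(2)] card_mono[OF _ dsub(1)] card_rows by auto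
  ultimately show ?thesis using kn by linarith
qed

end

text \<open>True stands for Down; this is the orientation pattern of a torus-fixed flag in both components.\<close>

definition orient :: "nat \<Rightarrow> (int \<times> int) set \<Rightarrow> (int \<Rightarrow> bool) \<Rightarrow> bool" where
  "orient n C lam \<longleftrightarrow> (\<forall>(p, q)\<in>C. lam p \<noteq> lam q) \<and>
     (\<forall>p\<in>left_outer C. lam p) \<and> (\<forall>p\<in>right_outer n C. \<not> lam p)"

section \<open>Completion of the two diagrams by the extra arcs\<close>

lemma sorted_list_of_set_upto: "sorted_list_of_set {i..j::int} = [i..j]"
  by (rule sorted_distinct_set_unique) auto

text \<open>The hypothesis makes both intervals equally long, so \<open>zip\<close> drops nothing;
  truncated subtraction covers the case in which both are empty. Arc \<open>t\<close> joins the
  points that are \<open>t\<close> steps outward from the innermost extra points.\<close>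

lemma extra_arcs_intervals:
  assumes "a' + b = a + (b' :: nat)"
  shows "extra_arcs {1 - int a'..- int a} {R + int b + 1..R + int b'} =
    {(- int a - int t, R + int b + 1 + int t) | t. t < a' - a}"
proof -
  let ?x = "rev [1 - int a'..- int a]" and ?y = "[R + int b + 1..R + int b']"
  have len: "length ?x = a' - a" "length ?y = a' - a" using assms by auto
  have x: "?x ! t = - int a - int t" and y: "?y ! t = R + int b + 1 + int t" if "t < a' - a" for t
  proof -
    have "?x ! t = [1 - int a'..- int a] ! (a' - a - Suc t)"
      using rev_nth[of t "[1 - int a'..- int a]"] that len by simp
    also have "\<dots> = 1 - int a' + int (a' - a - Suc t)" by (rule nth_upto) (use that in simp)
    also have "\<dots> = - int a - int t" using that by simp
    finally show "?x ! t = - int a - int t" .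
    show "?y ! t = R + int b + 1 + int t" by (rule nth_upto) (use that assms in simp)
  qed
  show ?thesis
    unfolding extra_arcs_def sorted_list_of_set_upto set_zip len min.idem
    by (rule Collect_cong) (metis x y)
qed

text \<open>The added points used by \<open>C\<close> are those nearest to the inner points, so the
  extra arcs run concentrically around all cups of \<open>C\<close> and cross nothing. The second
  claim serves for orientations: both ends of an extra arc are outer points of the other
  diagram.\<close>

lemma completed_arcs:
  assumes "two_row_tableau n k is w" "two_row_tableau n k is w'"
  defines "C \<equiv> ext_cups n k is w" and "C' \<equiv> ext_cups n k is w'"
  defines "Z \<equiv> extra_arcs (left_outer C' - left_outer C) (right_outer n C' - right_outer n C)"
  shows "arc_matching (joined C \<union> joined C') (C \<union> Z)"
    and "\<And>p q. (p, q) \<in> Z \<Longrightarrow> p \<in> left_outer C' \<and> q \<in> right_outer n C'"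
proof -
  interpret W: two_row_tableau n k "is" w by fact
  interpret V: two_row_tableau n k "is" w' by fact
  have Ceq: "C = W.C" "C' = V.C" by (simp_all add: C_def C'_def W.C_def V.C_def)
  note lo = W.left_outer_eq V.left_outer_eq and ro = W.right_outer_eq V.right_outer_eq
  have EL: "left_outer C' - left_outer C = {1 - int V.nl..- int W.nl}"
    unfolding Ceq lo by auto
  have ER: "right_outer n C' - right_outer n C = {int n + int W.nr + 1..int n + int V.nr}"
    unfolding Ceq ro by auto
  have bal: "V.nl + W.nr = W.nl + V.nr" using W.outer_balance V.outer_balance by linarith
  have Z: "Z = {(- int W.nl - int t, int n + int W.nr + 1 + int t) | t. t < V.nl - W.nl}"
    unfolding Z_def EL ER by (rule extra_arcs_intervals[OF bal])
  show Zouter: "p \<in> left_outer C' \<and> q \<in> right_outer n C'" if "(p, q) \<in> Z" for p q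
    using that bal unfolding Z Ceq lo ro by auto
  have Zfst: "p \<notin> joined C" and Zsnd: "q \<notin> joined C" and Zlt: "p < q" if z: "(p, q) \<in> Z" for p q
  proof -
    obtain t where "p = - int W.nl - int t" "q = int n + int W.nr + 1 + int t" using z unfolding Z by blast
    then have "p \<notin> left_outer C" "p < 1" "q \<notin> right_outer n C" "q > int n" "p < q"
      unfolding Ceq lo ro by auto
    then show "p \<notin> joined C" "q \<notin> joined C" "p < q" by (auto simp: left_outer_def right_outer_def)
  qed
  \<comment> \<open>Crossed points are determined by the type alone, so both diagrams join the same
    inner points.\<close>
  have inner: "x \<in> joined C' \<longleftrightarrow> x \<in> joined C" if "1 \<le> x" "x \<le> int n" for x
    using that W.joined_inner_iff[of "nat x"] V.joined_inner_iff[of "nat x"]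
    by (simp add: Ceq W.crs_def V.crs_def)
  have jZ: "joined Z = {- int W.nl - int t | t. t < V.nl - W.nl} \<union>
      {int n + int W.nr + 1 + int t | t. t < V.nl - W.nl}"
    by (rule Set.set_eqI) (unfold joined_iff Z, blast)
  have X: "joined C \<union> joined C' = joined (C \<union> Z)"
  proof (rule equalityI; rule subsetI)
    fix x assume x: "x \<in> joined C \<union> joined C'"
    show "x \<in> joined (C \<union> Z)"
    proof (cases "x \<in> joined C")
      case False
      with x have x': "x \<in> joined C'" by simp
      with inner[of x] False consider "x < 1" | "x > int n" by linarith
      then show ?thesis
      proof cases
        case 1
        then have "x \<in> left_outer C' - left_outer C" using x' False by (simp add: left_outer_def)
        then have "x = - int W.nl - int (nat (- int W.nl - x))" "nat (- int W.nl - x) < V.nl - W.nl"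
          unfolding EL by auto
        then have "x \<in> joined Z" unfolding jZ by blast
        then show ?thesis by (simp add: joined_Un)
      next
        case 2
        then have "x \<in> right_outer n C' - right_outer n C" using x' False by (simp add: right_outer_def)
        then have "x = int n + int W.nr + 1 + int (nat (x - (int n + int W.nr + 1)))"
          "nat (x - (int n + int W.nr + 1)) < V.nl - W.nl"
          unfolding ER using bal by auto
        then have "x \<in> joined Z" unfolding jZ by blast
        then show ?thesis by (simp add: joined_Un)
      qed
    qed (simp add: joined_Un)
  next
    fix x assume "x \<in> joined (C \<union> Z)"
    then have "x \<in> joined C \<or> x \<in> joined Z" by (simp add: joined_Un)
    moreover have "x \<in> joined C'" if "x \<in> joined Z"
      using that Zouter by (auto simp: joined_iff left_outer_def right_outer_def)
    ultimately show "x \<in> joined C \<union> joined C'" by blast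
  qed
  have CJ: "p \<in> joined C" "q \<in> joined C" if "(p, q) \<in> C" for p q
    using that by (auto simp: joined_iff)
  show "arc_matching (joined C \<union> joined C') (C \<union> Z)"
    unfolding arc_matching_def
  proof (intro conjI allI impI)
    show "finite (joined C \<union> joined C')" using W.finite_joined V.finite_joined by (simp add: Ceq)
    show "joined C \<union> joined C' = joined (C \<union> Z)" by (rule X)
  next
    fix p q r assume "(p, q) \<in> C \<union> Z"
    then show "(q, r) \<notin> C \<union> Z"
    proof
      assume a: "(p, q) \<in> C"
      then have "(q, r) \<notin> C" using W.C_disj[of p q r] by (simp add: Ceq)
      moreover have "(q, r) \<notin> Z" using Zfst CJ[OF a] by blast
      ultimately show ?thesis by simp
    next
      assume a: "(p, q) \<in> Z"
      have "(q, r) \<notin> C" using Zsnd[OF a] CJ by blast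
      moreover have "(q, r) \<notin> Z" using Zouter[OF a] Zouter[of q r] by (auto simp: left_outer_def right_outer_def)
      ultimately show ?thesis by simp
    qed
  next
    fix p q assume "(p, q) \<in> C \<union> Z"
    then show "p < q" using Zlt[of p q] W.CD(2)[of p q] Ceq by blast
  next
    fix p q p' q' assume a: "(p, q) \<in> C \<union> Z" "(p', q') \<in> C \<union> Z" "p = p' \<or> q = q'"
    have "p = p' \<and> q = q'"
    proof (cases "(p, q) \<in> C")
      case True
      then have "(p', q') \<in> C" using a Zfst Zsnd CJ[OF True] by blast
      then show ?thesis using a(3) True W.CD(6,7) Ceq by blast
    next
      case False
      then have z: "(p, q) \<in> Z" using a by simp
      then have "(p', q') \<in> Z" using a CJ[of p' q'] Zfst[OF z] Zsnd[OF z] by blast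
      then obtain t' where t': "p' = - int W.nl - int t'" "q' = int n + int W.nr + 1 + int t'"
        unfolding Z by blast
      from z obtain t where "p = - int W.nl - int t" "q = int n + int W.nr + 1 + int t"
        unfolding Z by blast
      with t' show ?thesis using a(3) by auto
    qed
    then show "p = p'" "q = q'" by simp_all
  next
    fix p q r assume a: "(p, q) \<in> C \<union> Z" "p < r" "r < q" and r: "r \<in> joined C \<union> joined C'"
    show "(\<exists>s. (r, s) \<in> C \<union> Z \<and> s < q) \<or> (\<exists>s. (s, r) \<in> C \<union> Z \<and> p < s)"
      using a(1)
    proof
      assume pq: "(p, q) \<in> C"
      \<comment> \<open>A point under a cup of \<open>C\<close> that \<open>C\<close> leaves free is
        crossed, hence an inner point, and so it is free in \<open>C'\<close> too.\<close>
      have "r \<in> joined C"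
      proof (rule ccontr)
        assume n: "r \<notin> joined C"
        have "lab = Some Cross" if "lab = ext_label n k is w r" for lab
          using W.CD(8)[of p q r] pq a(2,3) n that by (auto simp: Ceq joined_iff)
        then have lr: "ext_label n k is w r = Some Cross" by simp
        then have "1 \<le> r" "r \<le> int n" by (auto simp: ext_label_def split: if_splits)
        with inner[of r] r n show False by auto
      qed
      with W.C_inside[of p q r] pq a(2,3) show ?thesis unfolding Ceq by blast
    next
      assume pq: "(p, q) \<in> Z"
      then obtain t where t: "p = - int W.nl - int t" "q = int n + int W.nr + 1 + int t"
        unfolding Z by blast
      have Cb: "- int W.nl < x" "x < int n + int W.nr + 1" if x: "x \<in> joined C" for x
      proof -
        have "x \<in> left_outer C \<or> x \<in> right_outer n C \<or> 1 \<le> x \<and> x \<le> int n"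
          using x by (simp add: left_outer_def right_outer_def) linarith
        then show "- int W.nl < x" "x < int n + int W.nr + 1" unfolding Ceq lo ro by auto
      qed
      from r have "r \<in> joined (C \<union> Z)" unfolding X .
      then consider s where "(r, s) \<in> C" | s where "(s, r) \<in> C" | s where "(r, s) \<in> Z" | s where "(s, r) \<in> Z"
        unfolding joined_iff by blast
      then show ?thesis
      proof cases
        case 1
        have "s < q" using Cb(2)[OF CJ(2)[OF 1]] t by simp
        with 1 show ?thesis by blast
      next
        case 2
        have "p < s" using Cb(1)[OF CJ(1)[OF 2]] t by simp
        with 2 show ?thesis by blast
      next
        case 3
        then have "s < q" using a(2) t by (auto simp: Z)
        with 3 show ?thesis by blast
      next
        case 4
        then have "p < s" using a(3) t by (auto simp: Z)
        with 4 show ?thesis by blast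
      qed
    qed
  qed
qed

text \<open>An extra arc joins a left outer to a right outer point of one of the diagrams, and an
  orientation fixes different labels there. So a labelling of the completed diagrams amounts to a
  common orientation of the original ones.\<close>

lemma has_red_circle_iff:
  assumes t: "two_row_tableau n k is w" "two_row_tableau n k is w'"
  shows "has_red_circle n k is w w' \<longleftrightarrow>
    \<not> (\<exists>lam. orient n (ext_cups n k is w) lam \<and> orient n (ext_cups n k is w') lam)"
proof -
  define C where "C = ext_cups n k is w"
  define C' where "C' = ext_cups n k is w'"
  define Z where "Z = extra_arcs (left_outer C' - left_outer C) (right_outer n C' - right_outer n C)"
  define Z' where "Z' = extra_arcs (left_outer C - left_outer C') (right_outer n C - right_outer n C')"
  define X where "X = joined C \<union> joined C'"
  note A = completed_arcs[OF t, folded C_def C'_def, folded Z_def X_def]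
  note A' = completed_arcs[OF t(2,1), folded C_def C'_def, folded Z'_def, unfolded Un_commute[of "joined C'"], folded X_def]
  have E: "circle_edges n k is w w' = (C \<union> Z) \<union> (C' \<union> Z')"
    unfolding circle_edges_def Let_def C_def[symmetric] C'_def[symmetric] Z_def[symmetric] Z'_def[symmetric]
    by blast
  have J: "joined (circle_edges n k is w w') = X"
    using arc_matchingD(2)[OF A(1)] arc_matchingD(2)[OF A'(1)] unfolding E joined_Un[of "C \<union> Z"] by simp
  have "circles n k is w w' = {comp_of ((C \<union> Z) \<union> (C' \<union> Z')) v | v. v \<in> X}"
    unfolding circles_def Let_def J comp_of_def unfolding E by (rule refl)
  then have "has_red_circle n k is w w' \<longleftrightarrow> (\<exists>v\<in>X. red_circle n (comp_of ((C \<union> Z) \<union> (C' \<union> Z')) v))"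
    unfolding has_red_circle_def by auto
  also have "\<dots> \<longleftrightarrow> \<not> (\<exists>lam :: int \<Rightarrow> bool. (\<forall>(p, q)\<in>(C \<union> Z) \<union> (C' \<union> Z'). lam p \<noteq> lam q) \<and>
        (\<forall>p\<in>X. p < 1 \<longrightarrow> lam p) \<and> (\<forall>p\<in>X. int n < p \<longrightarrow> \<not> lam p))"
    by (rule red_comp_iff[OF A(1) A'(1)])
  also have "(\<exists>lam :: int \<Rightarrow> bool. (\<forall>(p, q)\<in>(C \<union> Z) \<union> (C' \<union> Z'). lam p \<noteq> lam q) \<and>
        (\<forall>p\<in>X. p < 1 \<longrightarrow> lam p) \<and> (\<forall>p\<in>X. int n < p \<longrightarrow> \<not> lam p)) \<longleftrightarrow>
      (\<exists>lam. orient n C lam \<and> orient n C' lam)" (is "(\<exists>lam. ?P lam) \<longleftrightarrow> (\<exists>lam. ?Q lam)")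
  proof -
    have "?Q lam" if P: "?P lam" for lam
    proof -
      have e: "lam p \<noteq> lam q" if "(p, q) \<in> C \<or> (p, q) \<in> C'" for p q
        using conjunct1[OF P] that by fast
      moreover have "lam p" if "p \<in> left_outer C \<or> p \<in> left_outer C'" for p
        using conjunct1[OF conjunct2[OF P]] that by (auto simp: X_def left_outer_def)
      moreover have "\<not> lam p" if "p \<in> right_outer n C \<or> p \<in> right_outer n C'" for p
        using conjunct2[OF conjunct2[OF P]] that by (auto simp: X_def right_outer_def)
      ultimately show ?thesis unfolding orient_def by blast
    qed
    moreover have "?P lam" if Q: "?Q lam" for lam
    proof -
      have o: "lam p" if "p \<in> left_outer C \<or> p \<in> left_outer C'" for p
        using Q that unfolding orient_def by blast
      have o': "\<not> lam p" if "p \<in> right_outer n C \<or> p \<in> right_outer n C'" for p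
        using Q that unfolding orient_def by blast
      have "lam p \<noteq> lam q" if "(p, q) \<in> C \<or> (p, q) \<in> C'" for p q
        using Q that unfolding orient_def by fast
      moreover have "lam p \<noteq> lam q" if "(p, q) \<in> Z \<or> (p, q) \<in> Z'" for p q
        using that A(2)[of p q] A'(2)[of p q] o[of p] o'[of q] by blast
      ultimately have "\<forall>(p, q)\<in>(C \<union> Z) \<union> (C' \<union> Z'). lam p \<noteq> lam q" by blast
      moreover have "\<forall>p\<in>X. p < 1 \<longrightarrow> lam p" using o by (auto simp: X_def left_outer_def)
      moreover have "\<forall>p\<in>X. int n < p \<longrightarrow> \<not> lam p" using o' by (auto simp: X_def right_outer_def)
      ultimately show ?thesis by (intro conjI)
    qed
    ultimately show ?thesis by (rule ex_cong1[OF iffI])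
  qed
  finally show ?thesis unfolding C_def C'_def .
qed

section \<open>Segments closed under the cups\<close>

context two_row_tableau
begin

lemma C_nest:
  assumes "(p, q) \<in> C" "(p', q') \<in> C" "p < p'" "p' < q"
  shows "q' < q"
proof -
  have "(s, p') \<notin> C" for s using C_disj[of s p' q'] assms(2) by blast
  with CD(8)[OF assms(1,3,4)] CD(3)[OF assms(2)] obtain s where "(p', s) \<in> C" "s < q" by auto
  with CD(6)[OF assms(2)] show ?thesis by blast
qed

lemma C_nest':
  assumes "(p, q) \<in> C" "(p', q') \<in> C" "p < q'" "q' < q"
  shows "p < p'"
proof -
  have "(q', s) \<notin> C" for s using C_disj[of p' q' s] assms(2) by blast
  with CD(8)[OF assms(1,3,4)] CD(4)[OF assms(2)] obtain s where "(s, q') \<in> C" "p < s" by auto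
  with CD(7)[OF assms(2)] show ?thesis by blast
qed

definition black :: "nat \<Rightarrow> nat \<Rightarrow> bool" where
  "black i j \<longleftrightarrow> (int i, int j) \<in> C \<and> 1 \<le> i \<and> j \<le> n"

text \<open>A number \<open>a\<close> here marks the gap after point \<open>a\<close>, that is, the
  flag member of dimension \<open>a\<close>. The points between the two gaps are crossed or paired
  off among themselves, so on a cell N^((b - a) div 2) carries F_b into F_a.\<close>

definition closed_seg :: "nat \<Rightarrow> nat \<Rightarrow> bool" where
  "closed_seg a b \<longleftrightarrow> a \<le> b \<and> a \<in> pos \<and> b \<in> pos \<and>
     (\<forall>p q. (p, q) \<in> C \<longrightarrow> (int a < p \<and> p \<le> int b \<longleftrightarrow> int a < q \<and> q \<le> int b))"

text \<open>The points 1..b are crossed, paired within, or joined to left outer points; at such a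
  gap the flag member on a cell is a coordinate space. \<open>rclosed\<close> is the mirror
  condition on the points after the gap.\<close>

definition lclosed :: "nat \<Rightarrow> bool" where
  "lclosed b \<longleftrightarrow> b \<in> pos \<and> (\<forall>p q. (p, q) \<in> C \<longrightarrow> 1 \<le> p \<longrightarrow> p \<le> int b \<longrightarrow> q \<le> int b)"

definition rclosed :: "nat \<Rightarrow> bool" where
  "rclosed a \<longleftrightarrow> a \<in> pos \<and> (\<forall>p q. (p, q) \<in> C \<longrightarrow> int a < q \<longrightarrow> q \<le> int n \<longrightarrow> int a < p)"

definition outer_pos :: "nat \<Rightarrow> bool" where
  "outer_pos a \<longleftrightarrow> a \<in> pos \<and> (\<forall>i j. black i j \<longrightarrow> \<not> (i \<le> a \<and> a < j))"

lemma inner_single: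
  assumes "int i \<in> joined C" "1 \<le> i" "i \<le> n"
  shows "\<not> crs i" "i \<in> pos" "i - 1 \<in> pos" "i \<notin> dbl" "i \<in> set is"
  using assms joined_inner_iff[of i] single[of i] by auto

lemma not_joined_dbl: "q \<in> dbl \<Longrightarrow> int q \<notin> joined C" "q \<in> dbl \<Longrightarrow> int (q - 1) \<notin> joined C"
  using joined_inner_iff[of q] joined_inner_iff[of "q - 1"] dblD(2,5)[of q] by (auto simp: crs_def)

lemma blackD:
  assumes "black i j"
  shows "(int i, int j) \<in> C" "1 \<le> i" "i < j" "j \<le> n"
    "i \<in> pos" "i - 1 \<in> pos" "j \<in> pos" "j - 1 \<in> pos" "i \<notin> dbl" "j \<notin> dbl" "\<not> crs i" "\<not> crs j"
    "lab (int i) = Some Down" "lab (int j) = Some Up" "i \<in> set is" "j \<in> set is"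
proof -
  have c: "(int i, int j) \<in> C" "1 \<le> i" "j \<le> n" using assms by (auto simp: black_def)
  then have lt: "i < j" using CD(2) by fastforce
  have J: "int i \<in> joined C" "int j \<in> joined C" using c by (auto simp: joined_iff)
  show "(int i, int j) \<in> C" "1 \<le> i" "i < j" "j \<le> n" using c lt by auto
  show "i \<in> pos" "i - 1 \<in> pos" "j \<in> pos" "j - 1 \<in> pos" "i \<notin> dbl" "j \<notin> dbl" "\<not> crs i" "\<not> crs j" "i \<in> set is" "j \<in> set is"
    using inner_single[OF J(1)] inner_single[OF J(2)] c lt by auto
  show "lab (int i) = Some Down" "lab (int j) = Some Up" using CD(3,4)[OF c(1)] .
qed

lemma black_closed: "black i j \<Longrightarrow> closed_seg i (j - 1)"
proof -
  assume b: "black i j"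
  note D = blackD[OF b]
  have "(int i < p \<and> p \<le> int (j - 1)) = (int i < q \<and> q \<le> int (j - 1))" if "(p, q) \<in> C" for p q
    using C_nest[OF D(1) that] C_nest'[OF D(1) that] CD(2)[OF that] D by auto
  then show ?thesis using D by (auto simp: closed_seg_def)
qed

text \<open>The last piece of a segment is a crossed pair or a black cup (i, j), which leaves the
  closed segments before and under that cup. This is the usual decomposition of balanced bracket
  words.\<close>

lemma closed_induct [consumes 1, case_names refl cross cup]:
  assumes "closed_seg a b"
    and refl: "\<And>a. a \<in> pos \<Longrightarrow> R a a"
    and cross: "\<And>a b. closed_seg a b \<Longrightarrow> R a b \<Longrightarrow> b + 2 \<in> dbl \<Longrightarrow> R a (b + 2)"
    and cup: "\<And>a i j. closed_seg a (i - 1) \<Longrightarrow> R a (i - 1) \<Longrightarrow> black i j \<Longrightarrow>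
        closed_seg i (j - 1) \<Longrightarrow> R i (j - 1) \<Longrightarrow> R a j"
  shows "R a b"
  using assms(1)
proof (induction "b - a" arbitrary: a b rule: less_induct)
  case less
  note cl = less.prems
  then have ab: "a \<le> b" "a \<in> pos" "b \<in> pos"
    and mt: "\<And>p q. (p, q) \<in> C \<Longrightarrow> (int a < p \<and> p \<le> int b \<longleftrightarrow> int a < q \<and> q \<le> int b)"
    by (auto simp: closed_seg_def)
  show ?case
  proof (cases "a = b")
    case True
    then show ?thesis using refl ab by simp
  next
    case False
    with ab have lt: "a < b" by simp
    from ab(3) show ?thesis
    proof (cases rule: pos_cases)
      case 1
      then show ?thesis using lt by simp
    next
      case 2
      have "a \<noteq> b - 1" using ab(2) dblD(4)[OF 2(1)] by auto
      then have le: "a \<le> b - 2" using lt by simp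
      have "closed_seg a (b - 2)"
        unfolding closed_seg_def
      proof (intro conjI allI impI)
        fix p q assume c: "(p, q) \<in> C"
        then have "p \<in> joined C" "q \<in> joined C" by (auto simp: joined_iff)
        then have "p \<noteq> int b" "p \<noteq> int (b - 1)" "q \<noteq> int b" "q \<noteq> int (b - 1)"
          using not_joined_dbl[OF 2(1)] by auto
        then have "p \<le> int (b - 2) \<longleftrightarrow> p \<le> int b" "q \<le> int (b - 2) \<longleftrightarrow> q \<le> int b"
          using 2(2) by linarith+
        with mt[OF c] show "(int a < p \<and> p \<le> int (b - 2)) = (int a < q \<and> q \<le> int (b - 2))" by simp
      qed (use le ab 2 in auto)
      moreover from less.hyps[OF _ this] have "R a (b - 2)" using le lt 2 by simp
      ultimately show ?thesis using cross[of a "b - 2", unfolded le_add_diff_inverse2[OF 2(2)]] 2 by blast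
    next
      case 3
      then have "int b \<in> joined C" using joined_inner_iff by simp
      then obtain p where "(int b, p) \<in> C \<or> (p, int b) \<in> C" by (auto simp: joined_iff)
      moreover have "(int b, p) \<notin> C" using mt[of "int b" p] CD(2)[of "int b" p] lt by auto
      ultimately have pC: "(p, int b) \<in> C" by simp
      have p: "int a < p" "p < int b" using mt[OF pC] lt CD(2)[OF pC] by auto
      define i where "i = nat p"
      have i: "p = int i" "1 \<le> i" "a < i" "i < b" using p by (auto simp: i_def)
      have bl: "black i b" using pC i 3 by (simp add: black_def)
      note bD = blackD[OF bl]
      have "closed_seg a (i - 1)"
        unfolding closed_seg_def
      proof (intro conjI allI impI)
        fix p' q' assume c: "(p', q') \<in> C"
        show "(int a < p' \<and> p' \<le> int (i - 1)) = (int a < q' \<and> q' \<le> int (i - 1))"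
        proof (cases "p' = int i")
          case True
          then have "q' = int b" using CD(6)[OF pC] c i by simp
          with True i show ?thesis by simp
        next
          case False
          then have "q' \<noteq> int b" using CD(7)[OF pC c[THEN back_subst[of "\<lambda>z. (p', z) \<in> C"]]] i by metis
          moreover have "q' \<noteq> int i" using C_disj[of p' "int i" "int b"] c pC i by auto
          moreover have "p' \<noteq> int b" using C_disj[of "int i" "int b" q'] c pC i by auto
          moreover have "q' < int i" if "p' < int i" "q' \<le> int b"
            using C_nest'[OF bD(1) c] that calculation by force
          ultimately show ?thesis using mt[OF c] CD(2)[OF c] False i by auto
        qed
      qed (use i ab bD in auto)
      moreover from less.hyps[OF _ this] have "R a (i - 1)" using i by simp
      moreover note bl black_closed[OF bl]
      moreover have "R i (b - 1)" by (rule less.hyps[OF _ black_closed[OF bl]]) (use i in simp)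
      ultimately show ?thesis using cup by blast
    qed
  qed
qed

text \<open>A black cup has its Down in the bottom row and its Up in the top row, and a double entry
  lies in both rows, so the two counts grow equally.\<close>

lemma closed_counts:
  assumes "closed_seg a b"
  shows "even (b - a) \<and> a \<le> b \<and> T b = T a + (b - a) div 2 \<and> B b = B a + (b - a) div 2"
  using assms
proof (induction rule: closed_induct)
  case (cross a b)
  then show ?case using T_dbl[of "b + 2"] B_dbl[of "b + 2"] by (auto simp: Suc_diff_le)
next
  case (cup a i j)
  note D = blackD[OF cup.hyps(2)]
  have Ti: "T i = T (i - 1)" "B i = B (i - 1) + 1" using T_single[of i] B_single[of i] D by auto
  have Tj: "T j = T (j - 1) + 1" "B j = B (j - 1)" using T_single[of j] B_single[of j] D by auto
  have le: "a \<le> i - 1" "i \<le> j - 1" using cup.IH by auto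
  from cup.IH obtain c d where "i - 1 - a = 2 * c" and "j - 1 - i = 2 * d" unfolding dvd_def by blast
  with le have "i - 1 = a + 2 * c" "j - 1 = i + 2 * d" by (metis le_add_diff_inverse)+
  with D(2,3) have i: "i = Suc (a + 2 * c)" and j: "j = Suc (Suc (a + 2 * c) + 2 * d)" by auto
  have "j - a = 2 * (c + d + 1)" "a \<le> j" "i - 1 - a = 2 * c" "j - 1 - i = 2 * d" unfolding j i by auto
  then show ?case using Ti Tj cup.IH by simp
qed simp

lemma closed_cup: "black i j \<Longrightarrow> closed_seg (i - 1) j"
proof -
  assume b: "black i j"
  note D = blackD[OF b]
  have "(int (i - 1) < p \<and> p \<le> int j) = (int (i - 1) < q \<and> q \<le> int j)" if c: "(p, q) \<in> C" for p q
  proof (cases "p = int i \<or> q = int j")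
    case True
    then have "p = int i" "q = int j" using CD(6)[OF D(1)] CD(7)[OF D(1)] c by blast+
    then show ?thesis using D by auto
  next
    case False
    have "q \<noteq> int i" "p \<noteq> int j" using C_disj c D(1) by blast+
    with False show ?thesis
      using C_nest[OF D(1) c] C_nest'[OF D(1) c] CD(2)[OF c] D by auto
  qed
  then show ?thesis using D by (auto simp: closed_seg_def)
qed

text \<open>The new kind of last piece is the right end of a green cup coming from the left. The
  interior of a black cup is not recursed into, since facts about closed segments cover it.\<close>

lemma lclosed_induct [consumes 1, case_names zero cross cup green]:
  assumes "lclosed b"
    and zero: "R 0"
    and cross: "\<And>b. lclosed b \<Longrightarrow> R b \<Longrightarrow> b + 2 \<in> dbl \<Longrightarrow> R (b + 2)"
    and cup: "\<And>i j. lclosed (i - 1) \<Longrightarrow> R (i - 1) \<Longrightarrow> black i j \<Longrightarrow> R j"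
    and green: "\<And>p b. lclosed (b - 1) \<Longrightarrow> R (b - 1) \<Longrightarrow> (p, int b) \<in> C \<Longrightarrow> p < 1 \<Longrightarrow> 1 \<le> b \<Longrightarrow> b \<le> n \<Longrightarrow> R b"
  shows "R b"
  using assms(1)
proof (induction b rule: less_induct)
  case (less b)
  then have b: "b \<in> pos" and lc: "\<And>p q. (p, q) \<in> C \<Longrightarrow> 1 \<le> p \<Longrightarrow> p \<le> int b \<Longrightarrow> q \<le> int b"
    by (auto simp: lclosed_def)
  from b show ?case
  proof (cases rule: pos_cases)
    case 1 then show ?thesis using zero by simp
  next
    case 2
    have "lclosed (b - 2)" unfolding lclosed_def
    proof (intro conjI allI impI)
      fix p q assume c: "(p, q) \<in> C" "1 \<le> p" "p \<le> int (b - 2)"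
      then have "q \<in> joined C" by (auto simp: joined_iff)
      then have "q \<noteq> int b" "q \<noteq> int (b - 1)" using not_joined_dbl[OF 2(1)] by auto
      then show "q \<le> int (b - 2)" using lc[OF c(1,2)] c(3) by linarith
    qed (use 2 in auto)
    then show ?thesis using less.IH[of "b - 2"] cross[of "b - 2", unfolded le_add_diff_inverse2[OF 2(2)]] 2 by simp
  next
    case 3
    then have "int b \<in> joined C" using joined_inner_iff by simp
    then obtain p where "(int b, p) \<in> C \<or> (p, int b) \<in> C" by (auto simp: joined_iff)
    moreover have "(int b, p) \<notin> C" using lc[of "int b" p] CD(2)[of "int b" p] 3 by auto
    ultimately have pC: "(p, int b) \<in> C" by simp
    show ?thesis
    proof (cases "p < 1")
      case True
      have "lclosed (b - 1)" unfolding lclosed_def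
      proof (intro conjI allI impI)
        fix p' q assume c: "(p', q) \<in> C" "1 \<le> p'" "p' \<le> int (b - 1)"
        then have "q \<noteq> int b" using CD(7)[OF pC, of p'] True by auto
        then show "q \<le> int (b - 1)" using lc[OF c(1,2)] c(3) by linarith
      qed (use 3 in auto)
      then show ?thesis using less.IH[of "b - 1"] green[of b p] pC True 3 by simp
    next
      case False
      define i where "i = nat p"
      have i: "p = int i" "1 \<le> i" "i < b" using False CD(2)[OF pC] by (auto simp: i_def)
      have bl: "black i b" using pC i 3 by (simp add: black_def)
      note D = blackD[OF bl]
      have "lclosed (i - 1)" unfolding lclosed_def
      proof (intro conjI allI impI)
        fix p' q assume c: "(p', q) \<in> C" "1 \<le> p'" "p' \<le> int (i - 1)"
        then have "q \<noteq> int b" "q \<noteq> int i" "q \<le> int b"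
          using CD(7)[OF D(1), of p'] C_disj[of p' "int i"] D lc[OF c(1,2)] by auto
        then show "q \<le> int (i - 1)" using C_nest'[OF D(1) c(1)] c(3) i by linarith
      qed (use D in auto)
      then show ?thesis using less.IH[of "i - 1"] cup[OF _ _ bl] i by simp
    qed
  qed
qed

text \<open>The mirror image removes pieces at the first point after the gap, so the induction
  descends from the whole space at \<open>n\<close>.\<close>

lemma rclosed_induct [consumes 1, case_names last cross cup green]:
  assumes "rclosed a"
    and last: "R n"
    and cross: "\<And>a. rclosed (a + 2) \<Longrightarrow> R (a + 2) \<Longrightarrow> a + 2 \<in> dbl \<Longrightarrow> R a"
    and cup: "\<And>i j. rclosed j \<Longrightarrow> R j \<Longrightarrow> black i j \<Longrightarrow> R (i - 1)"
    and green: "\<And>q a. rclosed a \<Longrightarrow> R a \<Longrightarrow> (int a, q) \<in> C \<Longrightarrow> int n < q \<Longrightarrow> 1 \<le> a \<Longrightarrow> a \<le> n \<Longrightarrow> R (a - 1)"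
  shows "R a"
  using assms(1)
proof (induction "n - a" arbitrary: a rule: less_induct)
  case less
  then have a: "a \<in> pos" and rc: "\<And>p q. (p, q) \<in> C \<Longrightarrow> int a < q \<Longrightarrow> q \<le> int n \<Longrightarrow> int a < p"
    by (auto simp: rclosed_def)
  note an = pos_le[OF a]
  show ?case
  proof (cases "a = n")
    case False
    with an have lt: "a < n" by simp
    show ?thesis
    proof (cases "crs (Suc a)")
      case True
      then have d: "a + 2 \<in> dbl"
        using dblD(4)[of "Suc a"] a unfolding crs_def by (auto simp: numeral_2_eq_2)
      have "rclosed (a + 2)" unfolding rclosed_def
      proof (intro conjI allI impI)
        fix p q assume c: "(p, q) \<in> C" "int (a + 2) < q" "q \<le> int n"
        then have "p \<in> joined C" by (auto simp: joined_iff)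
        then have "p \<noteq> int (a + 2)" "p \<noteq> int (a + 1)" using not_joined_dbl[OF d] by auto
        then show "int (a + 2) < p" using rc[OF c(1)] c(2,3) by auto
      qed (use dblD d in auto)
      then show ?thesis using less.hyps[of "a + 2"] cross[of a] lt d dblD(5)[OF d] by simp
    next
      case sing: False
      then have J: "int (Suc a) \<in> joined C" using joined_inner_iff[of "Suc a"] lt by simp
      then obtain q where "(int (Suc a), q) \<in> C \<or> (q, int (Suc a)) \<in> C" unfolding joined_iff by blast
      moreover have "(q, int (Suc a)) \<notin> C" using rc[of q "int (Suc a)"] CD(2)[of q "int (Suc a)"] lt by auto
      ultimately have qC: "(int (Suc a), q) \<in> C" by simp
      show ?thesis
      proof (cases "int n < q")
        case True
        have "rclosed (Suc a)" unfolding rclosed_def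
        proof (intro conjI allI impI)
          fix p q' assume c: "(p, q') \<in> C" "int (Suc a) < q'" "q' \<le> int n"
          then have "p \<noteq> int (Suc a)" using CD(6)[OF qC, of q'] True by auto
          then show "int (Suc a) < p" using rc[OF c(1)] c(2,3) by auto
        qed (use inner_single[OF J] lt in auto)
        then show ?thesis using less.hyps[of "Suc a"] green[of "Suc a" q] qC True lt by simp
      next
        case False
        define j where "j = nat q"
        have j: "q = int j" "j \<le> n" "Suc a < j" using False CD(2)[OF qC] by (auto simp: j_def)
        have bl: "black (Suc a) j" using qC j by (simp add: black_def)
        note D = blackD[OF bl]
        have "rclosed j" unfolding rclosed_def
        proof (intro conjI allI impI)
          fix p q' assume c: "(p, q') \<in> C" "int j < q'" "q' \<le> int n"
          then have "p \<noteq> int j" "p \<noteq> int (Suc a)" "int a < p"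
            using CD(6)[OF D(1), of q'] C_disj[OF D(1)] D rc[OF c(1)] j by auto
          then show "int j < p" using C_nest[OF D(1) c(1)] c(2) j by fastforce
        qed (use D in auto)
        then show ?thesis using less.hyps[of j] cup[OF _ _ bl] j by simp
      qed
    qed
  qed (use last in simp)
qed

text \<open>Outermost black cups are removed whole, so that otherwise only crossed pairs and inner
  ends of green cups have to be passed.\<close>

lemma outer_induct [consumes 1, case_names zero cross cup green]:
  assumes "outer_pos b"
    and zero: "R 0"
    and cross: "\<And>b. outer_pos b \<Longrightarrow> R b \<Longrightarrow> b + 2 \<in> dbl \<Longrightarrow> R (b + 2)"
    and cup: "\<And>i j. outer_pos (i - 1) \<Longrightarrow> R (i - 1) \<Longrightarrow> black i j \<Longrightarrow> R j"
    and green: "\<And>b. outer_pos (b - 1) \<Longrightarrow> R (b - 1) \<Longrightarrow> 1 \<le> b \<Longrightarrow> b \<le> n \<Longrightarrow> \<not> crs b \<Longrightarrow>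
       (\<exists>p<1. (p, int b) \<in> C) \<or> (\<exists>q>int n. (int b, q) \<in> C) \<Longrightarrow> R b"
  shows "R b"
  using assms(1)
proof (induction b rule: less_induct)
  case (less b)
  then have b: "b \<in> pos" and nb: "\<And>i j. black i j \<Longrightarrow> i \<le> b \<Longrightarrow> j \<le> b"
    by (auto simp: outer_pos_def not_less)
  from b show ?case
  proof (cases rule: pos_cases)
    case 1 then show ?thesis using zero by simp
  next
    case 2
    have "outer_pos (b - 2)" unfolding outer_pos_def
    proof (intro conjI allI impI notI)
      fix i j assume bl: "black i j" and c: "i \<le> b - 2 \<and> b - 2 < j"
      have "j \<le> b" using nb[OF bl] c by linarith
      moreover have "j \<noteq> b" "j \<noteq> b - 1" using blackD(12)[OF bl] 2 by (auto simp: crs_def)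
      ultimately show False using c by linarith
    qed (use 2 in auto)
    then show ?thesis using less.IH[of "b - 2"] cross[of "b - 2", unfolded le_add_diff_inverse2[OF 2(2)]] 2 by simp
  next
    case 3
    then have J: "int b \<in> joined C" using joined_inner_iff by simp
    show ?thesis
    proof (cases "\<exists>i. black i b")
      case True
      then obtain i where bl: "black i b" by blast
      note D = blackD[OF bl]
      have "outer_pos (i - 1)" unfolding outer_pos_def
      proof (intro conjI allI impI notI)
        fix i' j' assume bl': "black i' j'" and c: "i' \<le> i - 1 \<and> i - 1 < j'"
        note D' = blackD[OF bl']
        have "j' \<le> b" using nb[OF bl'] c D(2,3) by linarith
        moreover have "j' \<noteq> b" using CD(7)[OF D(1), of "int i'"] D'(1) c D(2) by auto
        moreover have "j' \<noteq> i" using C_disj[OF D'(1)] D(1) by auto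
        ultimately show False using C_nest'[OF D(1) D'(1)] c D(2) by fastforce
      qed (use D in auto)
      then show ?thesis using less.IH[of "i - 1"] cup[OF _ _ bl] D by simp
    next
      case False
      have g: "(\<exists>p<1. (p, int b) \<in> C) \<or> (\<exists>q>int n. (int b, q) \<in> C)"
      proof -
        from J obtain y where "(int b, y) \<in> C \<or> (y, int b) \<in> C" by (auto simp: joined_iff)
        then show ?thesis
        proof
          assume y: "(int b, y) \<in> C"
          show ?thesis
          proof (cases "y > int n")
            case False
            then have "black b (nat y)" using y CD(2)[OF y] 3 by (auto simp: black_def)
            then show ?thesis using nb[of b "nat y"] CD(2)[OF y] blackD(3) by force
          qed (use y in blast)
        next
          assume y: "(y, int b) \<in> C"
          show ?thesis
          proof (cases "y < 1")
            case False
            then have "black (nat y) b" using y 3 by (auto simp: black_def)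
            then show ?thesis using \<open>\<not> (\<exists>i. black i b)\<close> by blast
          qed (use y in blast)
        qed
      qed
      have "outer_pos (b - 1)" unfolding outer_pos_def
      proof (intro conjI allI impI notI)
        fix i j assume bl: "black i j" and c: "i \<le> b - 1 \<and> b - 1 < j"
        have "j \<le> b" using nb[OF bl] c by linarith
        with c have "j = b" using 3(1) by linarith
        with bl False show False by blast
      qed (use 3 in auto)
      then show ?thesis using less.IH[of "b - 1"] green[OF _ _ 3(1-3) g] 3 by simp
    qed
  qed
qed

lemma outer_pos_n: "outer_pos n"
  unfolding outer_pos_def using pos_n blackD(4) by fastforce

lemma green_left:
  assumes "(p, int b) \<in> C" "p < 1" "b \<le> n"
  shows "1 \<le> b" "lclosed b" "lclosed (b - 1)"
proof -
  show b1: "1 \<le> b" using CD(10)[OF assms(1)] by simp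
  have J: "int b \<in> joined C" using assms(1) by (auto simp: joined_iff)
  note D = inner_single[OF J b1 assms(3)]
  have *: "q < int b" if c: "(p', q) \<in> C" "1 \<le> p'" "p' \<le> int b" for p' q
  proof -
    have "p' \<noteq> int b" using C_disj[OF assms(1)] c by auto
    then show ?thesis using C_nest[OF assms(1) c(1)] assms(2) c by auto
  qed
  show "lclosed b" "lclosed (b - 1)" unfolding lclosed_def using D * b1 by (auto, fastforce+)
qed

lemma green_right:
  assumes "(int a, q) \<in> C" "int n < q" "1 \<le> a"
  shows "a \<le> n" "rclosed a" "rclosed (a - 1)"
proof -
  show an: "a \<le> n" using CD(9)[OF assms(1)] by simp
  have J: "int a \<in> joined C" using assms(1) by (auto simp: joined_iff)
  note D = inner_single[OF J assms(3) an]
  have *: "int a < p" if c: "(p, q') \<in> C" "int a \<le> q'" "q' \<le> int n" for p q'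
  proof -
    have "q' \<noteq> int a" using C_disj[of p q'] assms(1) c by auto
    then show ?thesis using C_nest'[OF assms(1) c(1)] assms(2) c by auto
  qed
  show "rclosed a" "rclosed (a - 1)" unfolding rclosed_def using D * assms(3) by (auto, fastforce+)
qed

end

section \<open>Leading indices of subspaces\<close>

definition subsp :: "nat \<Rightarrow> complex vec set \<Rightarrow> bool" where
  "subsp n F \<longleftrightarrow> F \<subseteq> carrier_vec n \<and> 0\<^sub>v n \<in> F \<and>
     (\<forall>x\<in>F. \<forall>y\<in>F. x + y \<in> F) \<and> (\<forall>a. \<forall>x\<in>F. a \<cdot>\<^sub>v x \<in> F)"

lemma subspD:
  assumes "subsp n F"
  shows "x \<in> F \<Longrightarrow> x \<in> carrier_vec n" "x \<in> F \<Longrightarrow> dim_vec x = n" "0\<^sub>v n \<in> F"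
    "x \<in> F \<Longrightarrow> y \<in> F \<Longrightarrow> x + y \<in> F" "x \<in> F \<Longrightarrow> a \<cdot>\<^sub>v x \<in> F"
  using assms unfolding subsp_def by (auto simp: subset_iff)

lemma subsp_comb: "subsp n F \<Longrightarrow> x \<in> F \<Longrightarrow> y \<in> F \<Longrightarrow> x + a \<cdot>\<^sub>v y \<in> F"
  by (simp add: subspD)

lemma subsp_diff: "subsp n F \<Longrightarrow> x \<in> F \<Longrightarrow> y \<in> F \<Longrightarrow> x - y \<in> F"
proof -
  assume a: "subsp n F" "x \<in> F" "y \<in> F"
  have "x - y = x + (- 1) \<cdot>\<^sub>v y"
    by (rule eq_vecI) (use a subspD(2)[OF a(1)] in auto)
  then show ?thesis using subsp_comb[OF a, of "-1"] by simp
qed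

definition leads :: "nat \<Rightarrow> complex vec \<Rightarrow> nat \<Rightarrow> bool" where
  "leads n x c \<longleftrightarrow> c < n \<and> x $ c \<noteq> 0 \<and> (\<forall>i. c < i \<longrightarrow> i < n \<longrightarrow> x $ i = 0)"

lemma leads_exists:
  assumes "i < n" "x $ i \<noteq> 0"
  obtains c where "i \<le> c" "leads n x c"
proof -
  define S where "S = {c. c < n \<and> x $ c \<noteq> 0}"
  have S: "finite S" "i \<in> S" using assms by (auto simp: S_def)
  then have m: "Max S \<in> S" using Max_in[of S] by blast
  have "x $ j = 0" if "Max S < j" "j < n" for j
  proof (rule ccontr)
    assume "x $ j \<noteq> 0"
    then have "j \<in> S" using that by (simp add: S_def)
    from Max_ge[OF S(1) this] that show False by simp
  qed
  moreover have "Max S < n" "x $ Max S \<noteq> 0" using m unfolding S_def by blast+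
  ultimately have "leads n x (Max S)" by (simp add: leads_def)
  with Max_ge[OF S] show thesis by (rule that)
qed

text \<open>The pivots of an echelon basis with respect to the last nonzero coordinate; for the
  members of a flag their number is the dimension. As the f-coordinates come last, the nonzero
  vectors of P are those with leading index below \<open>n - k\<close>, so the pivots see P and the
  projection to Q separately.\<close>

definition piv :: "nat \<Rightarrow> complex vec set \<Rightarrow> nat set" where
  "piv n F = {c. \<exists>x\<in>F. leads n x c}"

lemma finite_piv: "finite (piv n F)"
  by (auto simp: piv_def leads_def intro!: finite_subset[of _ "{..<n}"])

lemma piv_mono: "F \<subseteq> G \<Longrightarrow> piv n F \<subseteq> piv n G"
  by (auto simp: piv_def)

lemma nonzero_index: "x \<in> carrier_vec n \<Longrightarrow> x \<noteq> 0\<^sub>v n \<Longrightarrow> \<exists>i<n. x $ i \<noteq> 0"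
  by (metis carrier_vecD eq_vecI index_zero_vec)

text \<open>The new pivot is the smallest leading index in the coset of the added vector.\<close>

lemma piv_extend:
  assumes F: "subsp n F" and g: "g \<in> carrier_vec n" "g \<notin> F"
  shows "\<exists>c. c \<notin> piv n F \<and> piv n {y + a \<cdot>\<^sub>v g | y a. y \<in> F} = insert c (piv n F)"
proof -
  note D = subspD[OF F]
  let ?G = "{y + a \<cdot>\<^sub>v g | y a. y \<in> F}"
  have nz: "\<exists>c. leads n (y + g) c" if "y \<in> F" for y
  proof -
    have "y + g \<noteq> 0\<^sub>v n"
    proof
      assume "y + g = 0\<^sub>v n"
      then have "(y + g) $ i = 0" if "i < n" for i using that by simp
      then have "g = (- 1) \<cdot>\<^sub>v y"
        using D(2)[OF \<open>y \<in> F\<close>] g by (intro eq_vecI) (auto simp: eq_neg_iff_add_eq_0 add.commute)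
      with D(5)[OF \<open>y \<in> F\<close>] g show False by auto
    qed
    with nonzero_index[of "y + g" n] D(1)[OF that] g obtain i where "i < n" "(y + g) $ i \<noteq> 0" by auto
    then show ?thesis using leads_exists by metis
  qed
  define Q where "Q c \<longleftrightarrow> (\<exists>y\<in>F. leads n (y + g) c)" for c
  have "\<exists>c. Q c" using nz[OF D(3)] D(3) by (auto simp: Q_def)
  define c where "c = (LEAST c. Q c)"
  have Qc: "Q c" unfolding c_def using \<open>\<exists>c. Q c\<close> by (rule LeastI_ex)
  have least: "c \<le> e" if "Q e" for e unfolding c_def using that by (rule Least_le)
  from Qc obtain y0 where y0: "y0 \<in> F" "leads n (y0 + g) c" by (auto simp: Q_def)
  have dim: "dim_vec y = n" if "y \<in> F" for y by (rule D(2)[OF that])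
  have dg: "dim_vec g = n" using g by simp
  have "c \<notin> piv n F"
  proof
    assume "c \<in> piv n F"
    then obtain z where z: "z \<in> F" "leads n z c" by (auto simp: piv_def)
    \<comment> \<open>This multiple of \<open>z\<close> cancels the entry at \<open>c\<close>, so
      the coset would contain a vector with a smaller leading index.\<close>
    define a where "a = - ((y0 + g) $ c / z $ c)"
    have y1: "y0 + a \<cdot>\<^sub>v z \<in> F" by (rule subsp_comb[OF F y0(1) z(1)])
    obtain e where e: "leads n (y0 + a \<cdot>\<^sub>v z + g) e" using nz[OF y1] by blast
    have "(y0 + a \<cdot>\<^sub>v z + g) $ i = 0" if "c \<le> i" "i < n" for i
    proof (cases "i = c")
      case True
      then show ?thesis using that z(2) dim[OF y0(1)] dim[OF z(1)] dg unfolding a_def leads_def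
        by (simp add: field_simps)
    next
      case False
      then have "c < i" using that by simp
      then show ?thesis using that z(2) y0(2) dim[OF y0(1)] dim[OF z(1)] dg
        unfolding leads_def by (auto simp: algebra_simps)
    qed
    then have "e < c" using e by (force simp: leads_def not_le[symmetric])
    moreover have "Q e" using e y1 by (auto simp: Q_def)
    ultimately show False using least by force
  qed
  moreover have "piv n ?G = insert c (piv n F)"
  proof (intro equalityI subsetI)
    fix e assume "e \<in> piv n ?G"
    then obtain y a where y: "y \<in> F" and e: "leads n (y + a \<cdot>\<^sub>v g) e" by (auto simp: piv_def)
    show "e \<in> insert c (piv n F)"
    proof (cases "a = 0")
      case True
      have "y + a \<cdot>\<^sub>v g = y" using True dim[OF y] dg by (intro eq_vecI) auto
      then show ?thesis using e y by (auto simp: piv_def)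
    next
      case False
      have "leads n ((1 / a) \<cdot>\<^sub>v y + g) e"
        using e False dim[OF y] dg unfolding leads_def by (auto simp: field_simps)
      then have "Q e" using D(5)[OF y] by (auto simp: Q_def)
      from least[OF this] consider "e = c" | "c < e" by linarith
      then show ?thesis
      proof cases
        case 2
        \<comment> \<open>This is (y + a g) - a (y0 + g); entries above \<open>c\<close> are
          unaffected, since \<open>y0 + g\<close> vanishes there.\<close>
        have u: "y + (- a) \<cdot>\<^sub>v y0 \<in> F" by (rule subsp_comb[OF F y y0(1)])
        have eq: "(y + (- a) \<cdot>\<^sub>v y0) $ i = (y + a \<cdot>\<^sub>v g) $ i" if "c < i" "i < n" for i
        proof -
          have "y0 $ i + g $ i = 0" using y0(2) that dim[OF y0(1)] dg by (auto simp: leads_def)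
          then have "g $ i = - y0 $ i" by (simp add: eq_neg_iff_add_eq_0 add.commute)
          then show ?thesis using that dim[OF y] dim[OF y0(1)] dg by simp
        qed
        have "leads n (y + (- a) \<cdot>\<^sub>v y0) e"
          using e 2 eq unfolding leads_def by (metis order.strict_trans)
        then show ?thesis using u by (auto simp: piv_def)
      qed simp
    qed
  next
    fix e assume "e \<in> insert c (piv n F)"
    then show "e \<in> piv n ?G"
    proof
      assume e: "e = c"
      have "y0 + g = y0 + 1 \<cdot>\<^sub>v g" by simp
      then have "y0 + g \<in> ?G" using y0(1) by blast
      then show ?thesis using y0(2) unfolding piv_def e by blast
    next
      assume "e \<in> piv n F"
      moreover have "F \<subseteq> ?G"
      proof
        fix y assume "y \<in> F"
        moreover have "y = y + 0 \<cdot>\<^sub>v g" using dim[OF \<open>y \<in> F\<close>] dg by (intro eq_vecI) auto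
        ultimately show "y \<in> ?G" by blast
      qed
      ultimately show ?thesis using piv_mono by blast
    qed
  qed
  ultimately show ?thesis by blast
qed

section \<open>Spans of the first columns of a matrix\<close>

lemma mult_mat_vec_zero:
  fixes g :: "complex mat"
  shows "g \<in> carrier_mat n n \<Longrightarrow> g *\<^sub>v 0\<^sub>v n = 0\<^sub>v n"
  by (intro eq_vecI) (auto simp: scalar_prod_def)

lemma col_span_subsp:
  assumes g: "g \<in> carrier_mat n n"
  shows "subsp n (col_span n g d)"
  unfolding subsp_def
proof (intro conjI ballI allI)
  show "col_span n g d \<subseteq> carrier_vec n" using g by (auto simp: col_span_def)
  have "0\<^sub>v n = g *\<^sub>v 0\<^sub>v n" by (rule mult_mat_vec_zero[OF g, symmetric])
  then show "0\<^sub>v n \<in> col_span n g d" unfolding col_span_def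
    by (intro CollectI exI[of _ "0\<^sub>v n"]) auto
next
  fix x y assume "x \<in> col_span n g d" "y \<in> col_span n g d"
  then obtain u v where u: "u \<in> carrier_vec n" "\<forall>i<n. d \<le> i \<longrightarrow> u $ i = 0" "x = g *\<^sub>v u"
    and v: "v \<in> carrier_vec n" "\<forall>i<n. d \<le> i \<longrightarrow> v $ i = 0" "y = g *\<^sub>v v" by (auto simp: col_span_def)
  then have "x + y = g *\<^sub>v (u + v)" using mult_add_distrib_mat_vec[OF g u(1) v(1)] by simp
  then show "x + y \<in> col_span n g d" unfolding col_span_def using u v
    by (intro CollectI exI[of _ "u + v"]) auto
next
  fix a x assume "x \<in> col_span n g d"
  then obtain u where u: "u \<in> carrier_vec n" "\<forall>i<n. d \<le> i \<longrightarrow> u $ i = 0" "x = g *\<^sub>v u"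
    by (auto simp: col_span_def)
  then have "a \<cdot>\<^sub>v x = g *\<^sub>v (a \<cdot>\<^sub>v u)" using mult_mat_vec[OF g u(1)] by simp
  then show "a \<cdot>\<^sub>v x \<in> col_span n g d" unfolding col_span_def using u
    by (intro CollectI exI[of _ "a \<cdot>\<^sub>v u"]) auto
qed

lemma col_span_0: "g \<in> carrier_mat n n \<Longrightarrow> col_span n g 0 = {0\<^sub>v n}"
proof (intro equalityI subsetI)
  fix x assume g: "g \<in> carrier_mat n n" and "x \<in> col_span n g 0"
  then obtain u where u: "u \<in> carrier_vec n" "\<forall>i<n. u $ i = 0" "x = g *\<^sub>v u" by (auto simp: col_span_def)
  then have "u = 0\<^sub>v n" by (intro eq_vecI) auto
  then show "x \<in> {0\<^sub>v n}" using mult_mat_vec_zero[OF g] u by simp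
qed (use subspD(3)[OF col_span_subsp] in auto)

lemma col_span_mono: "d \<le> e \<Longrightarrow> col_span n g d \<subseteq> col_span n g e"
  unfolding col_span_def by fastforce

lemma mult_mat_vec_split:
  fixes g :: "complex mat"
  assumes g: "g \<in> carrier_mat n n" and u: "u \<in> carrier_vec n" and d: "d < n"
  shows "g *\<^sub>v u = g *\<^sub>v (vec n (\<lambda>i. if i = d then 0 else u $ i)) + u $ d \<cdot>\<^sub>v col g d"
proof -
  let ?u = "vec n (\<lambda>i. if i = d then 0 else u $ i)"
  have "u = ?u + u $ d \<cdot>\<^sub>v unit_vec n d" using u d by (intro eq_vecI) auto
  then have "g *\<^sub>v u = g *\<^sub>v (?u + u $ d \<cdot>\<^sub>v unit_vec n d)" by simp
  also have "\<dots> = g *\<^sub>v ?u + g *\<^sub>v (u $ d \<cdot>\<^sub>v unit_vec n d)"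
    by (rule mult_add_distrib_mat_vec[OF g]) auto
  also have "g *\<^sub>v (u $ d \<cdot>\<^sub>v unit_vec n d) = u $ d \<cdot>\<^sub>v (g *\<^sub>v unit_vec n d)"
    by (rule mult_mat_vec[OF g]) auto
  also have "g *\<^sub>v unit_vec n d = col g d"
    using g d by (intro eq_vecI) auto
  finally show ?thesis .
qed

lemma col_span_Suc:
  assumes g: "g \<in> carrier_mat n n" and d: "d < n"
  shows "col_span n g (Suc d) = {y + a \<cdot>\<^sub>v col g d | y a. y \<in> col_span n g d}"
proof (intro equalityI subsetI)
  fix x assume "x \<in> col_span n g (Suc d)"
  then obtain u where u: "u \<in> carrier_vec n" "\<forall>i<n. Suc d \<le> i \<longrightarrow> u $ i = 0" "x = g *\<^sub>v u"
    by (auto simp: col_span_def)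
  let ?u = "vec n (\<lambda>i. if i = d then 0 else u $ i)"
  have "g *\<^sub>v ?u \<in> col_span n g d" unfolding col_span_def using u
    by (intro CollectI exI[of _ ?u]) auto
  then show "x \<in> {y + a \<cdot>\<^sub>v col g d | y a. y \<in> col_span n g d}"
    using mult_mat_vec_split[OF g u(1) d] u(3) by blast
next
  fix x assume "x \<in> {y + a \<cdot>\<^sub>v col g d | y a. y \<in> col_span n g d}"
  then obtain u a where u: "u \<in> carrier_vec n" "\<forall>i<n. d \<le> i \<longrightarrow> u $ i = 0"
    and x: "x = g *\<^sub>v u + a \<cdot>\<^sub>v col g d" by (auto simp: col_span_def)
  let ?v = "vec n (\<lambda>i. if i = d then a else u $ i)"
  have "vec n (\<lambda>i. if i = d then 0 else ?v $ i) = u" using u d by (intro eq_vecI) auto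
  then have "x = g *\<^sub>v ?v" using mult_mat_vec_split[OF g _ d, of ?v] d x by simp
  then show "x \<in> col_span n g (Suc d)" unfolding col_span_def using u
    by (intro CollectI exI[of _ ?v]) auto
qed

lemma GLn_carrier: "g \<in> GLn n \<Longrightarrow> g \<in> carrier_mat n n"
  by (simp add: GLn_def)

lemma GLn_inj:
  assumes "g \<in> GLn n" "x \<in> carrier_vec n" "g *\<^sub>v x = 0\<^sub>v n"
  shows "x = 0\<^sub>v n"
  using assms det_0_iff_vec_prod_zero[of g n] by (auto simp: GLn_def)

lemma col_notin_col_span:
  assumes "g \<in> GLn n" "d < n"
  shows "col g d \<notin> col_span n g d"
proof
  note g = GLn_carrier[OF assms(1)]
  assume "col g d \<in> col_span n g d"
  then obtain u where u: "u \<in> carrier_vec n" "\<forall>i<n. d \<le> i \<longrightarrow> u $ i = 0" "col g d = g *\<^sub>v u"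
    by (auto simp: col_span_def)
  let ?v = "vec n (\<lambda>i. if i = d then - 1 else u $ i)"
  have uv: "vec n (\<lambda>i. if i = d then 0 else ?v $ i) = u" using u assms(2) by (intro eq_vecI) auto
  have "g *\<^sub>v ?v = g *\<^sub>v u + ?v $ d \<cdot>\<^sub>v col g d"
    using mult_mat_vec_split[OF g _ assms(2), of ?v] unfolding uv by simp
  also have "?v $ d = - 1" using assms(2) by simp
  also have "g *\<^sub>v u + (- 1) \<cdot>\<^sub>v col g d = 0\<^sub>v n" unfolding u(3) using g u by (intro eq_vecI) auto
  finally have "g *\<^sub>v ?v = 0\<^sub>v n" .
  from GLn_inj[OF assms(1) _ this] have "?v = 0\<^sub>v n" by simp
  from arg_cong[OF this, of "\<lambda>v. v $ d"] show False using assms(2) by simp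
qed

text \<open>Every column of an invertible matrix lies outside the span of the earlier ones and so
  adds one pivot. All dimension counts for flags rest on this number.\<close>

lemma card_piv_col_span:
  assumes g: "g \<in> GLn n"
  shows "d \<le> n \<Longrightarrow> card (piv n (col_span n g d)) = d"
proof (induction d)
  case 0
  have "piv n {0\<^sub>v n} = {}" by (auto simp: piv_def leads_def)
  then show ?case using col_span_0[OF GLn_carrier[OF g]] by simp
next
  case (Suc d)
  note gc = GLn_carrier[OF g]
  have d: "d < n" using Suc.prems by simp
  have "col g d \<in> carrier_vec n" using gc by (intro carrier_vecI) simp
  from piv_extend[OF col_span_subsp[OF gc] this col_notin_col_span[OF g d]]
  obtain c where "c \<notin> piv n (col_span n g d)"
    "piv n (col_span n g (Suc d)) = insert c (piv n (col_span n g d))"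
    unfolding col_span_Suc[OF gc d] by blast
  then show ?case using Suc finite_piv by simp
qed

section \<open>Powers of N and leading indices\<close>

lemma Nmap_carrier [simp]: "Nmap n k x \<in> carrier_vec n" "dim_vec (Nmap n k x) = n"
  by (simp_all add: Nmap_def)

lemma Nmap_pow_dim: "x \<in> carrier_vec n \<Longrightarrow> (Nmap n k ^^ c) x \<in> carrier_vec n"
  by (cases c) auto

lemma Nmap_pow_index:
  assumes "x \<in> carrier_vec n" "i < n"
  shows "(Nmap n k ^^ c) x $ i = (if i + c < n \<and> (i < n - k \<longrightarrow> i + c < n - k) then x $ (i + c) else 0)"
  using assms
proof (induction c arbitrary: x)
  case (Suc c)
  have "(Nmap n k ^^ Suc c) x $ i = (Nmap n k ^^ c) (Nmap n k x) $ i" by (simp add: funpow_swap1)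
  also have "\<dots> = (if i + c < n \<and> (i < n - k \<longrightarrow> i + c < n - k) then Nmap n k x $ (i + c) else 0)"
    by (rule Suc.IH) (use Suc.prems in auto)
  also have "\<dots> = (if i + Suc c < n \<and> (i < n - k \<longrightarrow> i + Suc c < n - k) then x $ (i + Suc c) else 0)"
    by (auto simp: Nmap_def)
  finally show ?case .
qed simp

lemma Nmap_pow_add:
  assumes "x \<in> carrier_vec n" "y \<in> carrier_vec n"
  shows "(Nmap n k ^^ c) (x + y) = (Nmap n k ^^ c) x + (Nmap n k ^^ c) y"
  using assms Nmap_pow_dim[OF assms(1), of c k] Nmap_pow_dim[OF assms(2), of c k]
    Nmap_pow_dim[of "x + y" n c k]
  by (intro eq_vecI) (auto simp: Nmap_pow_index)

lemma Nmap_pow_smult: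
  assumes "x \<in> carrier_vec n"
  shows "(Nmap n k ^^ c) (a \<cdot>\<^sub>v x) = a \<cdot>\<^sub>v (Nmap n k ^^ c) x"
  using assms Nmap_pow_dim[OF assms(1), of c k] Nmap_pow_dim[of "a \<cdot>\<^sub>v x" n c k]
  by (intro eq_vecI) (auto simp: Nmap_pow_index)

lemma leads_max: "leads n x c \<Longrightarrow> i < n \<Longrightarrow> x $ i \<noteq> 0 \<Longrightarrow> i \<le> c"
  unfolding leads_def by (metis not_le)

text \<open>On N-stable subspaces F these are the dimensions of the intersection of F with P and of the
  projection of F to Q.\<close>

definition tp :: "nat \<Rightarrow> nat \<Rightarrow> complex vec set \<Rightarrow> nat" where
  "tp n k F = card {c \<in> piv n F. c < n - k}"

definition bp :: "nat \<Rightarrow> nat \<Rightarrow> complex vec set \<Rightarrow> nat" where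
  "bp n k F = card {c \<in> piv n F. n - k \<le> c}"

lemma tp_bp: "tp n k F + bp n k F = card (piv n F)"
proof -
  have "piv n F = {c \<in> piv n F. c < n - k} \<union> {c \<in> piv n F. n - k \<le> c}" by auto
  then show ?thesis unfolding tp_def bp_def using finite_piv[of n F]
    by (metis (no_types, lifting) card_Un_disjoint disjoint_iff finite_Un mem_Collect_eq not_le)
qed

lemma bp_mono: "F \<subseteq> G \<Longrightarrow> bp n k F \<le> bp n k G"
  unfolding bp_def using piv_mono[of F G n] finite_piv[of n G]
  by (auto intro!: card_mono)

lemma card_shift_le:
  fixes A A' :: "nat set"
  assumes "finite A'" "\<And>e. e \<in> A \<Longrightarrow> lo \<le> e" "\<And>e. e \<in> A \<Longrightarrow> lo + c \<le> e \<Longrightarrow> e - c \<in> A'"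
  shows "card A \<le> card A' + c"
proof -
  have "A \<subseteq> {lo..<lo + c} \<union> (\<lambda>x. x + c) ` A'"
  proof
    fix e assume e: "e \<in> A"
    show "e \<in> {lo..<lo + c} \<union> (\<lambda>x. x + c) ` A'"
    proof (cases "lo + c \<le> e")
      case True
      then have "e = (e - c) + c" by simp
      then show ?thesis using assms(3)[OF e True] by blast
    qed (use assms(2)[OF e] in auto)
  qed
  then have "card A \<le> card ({lo..<lo + c} \<union> (\<lambda>x. x + c) ` A')"
    by (rule card_mono[rotated]) (use assms(1) in auto)
  also have "\<dots> \<le> card {lo..<lo + c} + card ((\<lambda>x. x + c) ` A')" by (rule card_Un_le)
  also have "card ((\<lambda>x. x + c) ` A') \<le> card A'" using assms(1) by (rule card_image_le)
  finally show ?thesis by simp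
qed

lemma leads_shift:
  assumes "x \<in> carrier_vec n" "leads n x e" "c \<le> e" "e < n - k \<or> n - k + c \<le> e"
  shows "leads n ((Nmap n k ^^ c) x) (e - c)"
  unfolding leads_def
proof (intro conjI allI impI)
  have e: "e < n" "x $ e \<noteq> 0" "\<And>i. e < i \<Longrightarrow> i < n \<Longrightarrow> x $ i = 0" using assms(2) by (auto simp: leads_def)
  show "e - c < n" using e by simp
  show "(Nmap n k ^^ c) x $ (e - c) \<noteq> 0"
    using Nmap_pow_index[OF assms(1), of "e - c" c k] assms e by auto
  fix i assume i: "e - c < i" "i < n"
  then have "e < i + c" using assms(3) by simp
  then show "(Nmap n k ^^ c) x $ i = 0" using Nmap_pow_index[OF assms(1) i(2), of c k] e(3) by auto
qed

text \<open>N^c lowers a leading index by \<open>c\<close> inside its Jordan block unless the index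
  is among the first \<open>c\<close> of that block. The e- and f-directions are bounded separately,
  so that a known total difference of 2 c forces both bounds to be sharp.\<close>

lemma tp_bp_shift:
  assumes F: "F \<subseteq> carrier_vec n" and s: "(Nmap n k ^^ c) ` F \<subseteq> G"
  shows "tp n k F \<le> tp n k G + c" "bp n k F \<le> bp n k G + c"
proof -
  show "tp n k F \<le> tp n k G + c" unfolding tp_def
  proof (rule card_shift_le[where lo = 0])
    fix e assume "e \<in> {c \<in> piv n F. c < n - k}" and c: "0 + c \<le> e"
    then obtain x where x: "x \<in> F" "leads n x e" "e < n - k" by (auto simp: piv_def)
    then have "leads n ((Nmap n k ^^ c) x) (e - c)" using leads_shift[of x n e c k] F c by auto
    then show "e - c \<in> {c \<in> piv n G. c < n - k}" using x s by (auto simp: piv_def)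
  qed (simp_all add: finite_piv)
  show "bp n k F \<le> bp n k G + c" unfolding bp_def
  proof (rule card_shift_le[where lo = "n - k"])
    fix e assume "e \<in> {c \<in> piv n F. n - k \<le> c}" and c: "n - k + c \<le> e"
    then obtain x where x: "x \<in> F" "leads n x e" by (auto simp: piv_def)
    then have "leads n ((Nmap n k ^^ c) x) (e - c)" using leads_shift[of x n e c k] F c by auto
    then show "e - c \<in> {c \<in> piv n G. n - k \<le> c}" using x s c by (auto simp: piv_def)
  qed (simp_all add: finite_piv)
qed

definition CS :: "nat \<Rightarrow> nat \<Rightarrow> nat \<Rightarrow> nat \<Rightarrow> complex vec set" where
  "CS n k t b = {v \<in> carrier_vec n. \<forall>i<n. v $ i \<noteq> 0 \<longrightarrow>
      (i < n - k \<and> i < t) \<or> (n - k \<le> i \<and> i - (n - k) < b)}"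

lemma coord_space_CS: "coord_space n k w s = CS n k (tcount (fst w) s) (tcount (snd w) s)"
  by (simp add: coord_space_def CS_def)

lemma tp_bp_CS:
  assumes "F \<subseteq> CS n k t b"
  shows "tp n k F \<le> t" "bp n k F \<le> b"
proof -
  have p: "(c < n - k \<and> c < t) \<or> (n - k \<le> c \<and> c - (n - k) < b)" if c: "c \<in> piv n F" for c
  proof -
    obtain x where "x \<in> F" "leads n x c" using c by (auto simp: piv_def)
    then show ?thesis using assms unfolding CS_def leads_def by blast
  qed
  have "card {c \<in> piv n F. c < n - k} \<le> card {..<t}" using p by (intro card_mono) force+
  then show "tp n k F \<le> t" by (simp add: tp_def)
  have "card {c \<in> piv n F. n - k \<le> c} \<le> card {n - k..<n - k + b}" using p by (intro card_mono) force+
  then show "bp n k F \<le> b" by (simp add: bp_def)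
qed

section \<open>N-stable subspaces and the passage from F to F'\<close>

lemma rho_index [simp]: "i < n \<Longrightarrow> rho n k x $ i = (if i < n - k then 0 else x $ i)"
  and rho_carrier [simp]: "rho n k x \<in> carrier_vec n" "dim_vec (rho n k x) = n"
  by (simp_all add: rho_def)

lemma Nmap_rho: "x \<in> carrier_vec n \<Longrightarrow> Nmap n k (rho n k x) = rho n k (Nmap n k x)"
  by (intro eq_vecI) (auto simp: Nmap_def rho_def)

text \<open>On the block starting at \<open>lo\<close> the map N is a single Jordan block, so a
  vector reaching up to \<open>c\<close> generates everything up to \<open>c\<close>: subtracting a
  multiple of \<open>x\<close> removes the entry at \<open>c\<close>, and N x deals with the
  rest.\<close>

lemma stable_fill:
  assumes G: "subsp n G" "Nmap n k ` G \<subseteq> G"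
    and lo: "lo = 0 \<or> lo = n - k" and blk: "lo \<le> c" "c < n" "c < n - k \<or> n - k \<le> lo"
    and x: "x \<in> G" "x $ c \<noteq> 0" "\<And>i. i < n \<Longrightarrow> x $ i \<noteq> 0 \<Longrightarrow> lo \<le> i \<and> i \<le> c"
    and y: "y \<in> carrier_vec n" "\<And>i. i < n \<Longrightarrow> y $ i \<noteq> 0 \<Longrightarrow> lo \<le> i \<and> i \<le> c"
  shows "y \<in> G"
  using blk x y
proof (induction "c - lo" arbitrary: c x y)
  case 0
  have dx: "dim_vec x = n" by (rule subspD(2)[OF G(1) "0.prems"(4)])
  have "c = lo" using 0 by simp
  then have "y = (y $ c / x $ c) \<cdot>\<^sub>v x"
  proof (intro eq_vecI)
    fix i assume "i < dim_vec ((y $ c / x $ c) \<cdot>\<^sub>v x)"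
    then have i: "i < n" using dx by simp
    show "y $ i = ((y $ c / x $ c) \<cdot>\<^sub>v x) $ i"
    proof (cases "i = c")
      case True
      then show ?thesis using "0.prems"(5) i dx by simp
    next
      case False
      then have "x $ i = 0" "y $ i = 0" using "0.prems"(6,8)[OF i] \<open>c = lo\<close> by fastforce+
      then show ?thesis using i dx by simp
    qed
  qed (use "0.prems" dx in simp)
  then show ?case using subspD(5)[OF G(1) "0.prems"(4)] by metis
next
  case (Suc m)
  have dx: "dim_vec x = n" by (rule subspD(2)[OF G(1) Suc.prems(4)])
  let ?z = "y - (y $ c / x $ c) \<cdot>\<^sub>v x"
  have c: "lo < c" using Suc.hyps by simp
  have "?z \<in> G"
  proof (rule Suc.hyps(1)[of "c - 1" "Nmap n k x"])
    show "m = c - 1 - lo" "lo \<le> c - 1" "c - 1 < n" "c - 1 < n - k \<or> n - k \<le> lo" using Suc c by auto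
    show "Nmap n k x \<in> G" using G Suc.prems by blast
    \<comment> \<open>\<open>c\<close> is not the first index of its block, so N moves its entry to
      \<open>c - 1\<close> instead of killing it.\<close>
    have "c \<noteq> n - k" using Suc.prems(3) c by auto
    then show "Nmap n k x $ (c - 1) \<noteq> 0" using Suc.prems c by (auto simp: Nmap_def)
    show "lo \<le> i \<and> i \<le> c - 1" if "i < n" "Nmap n k x $ i \<noteq> 0" for i
    proof -
      have "i + 1 < n" "i + 1 \<noteq> n - k" "x $ (i + 1) \<noteq> 0" using that by (auto simp: Nmap_def split: if_splits)
      with Suc.prems(6)[of "i + 1"] lo show ?thesis by auto
    qed
    show "?z \<in> carrier_vec n" using Suc.prems(7) dx by auto
    show "lo \<le> i \<and> i \<le> c - 1" if i: "i < n" "?z $ i \<noteq> 0" for i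
    proof -
      have zi: "?z $ i = y $ i - y $ c / x $ c * x $ i" using i Suc.prems(7) dx by simp
      then have "i \<noteq> c" using i Suc.prems(5) by auto
      moreover have "x $ i \<noteq> 0 \<or> y $ i \<noteq> 0" using zi i by auto
      ultimately show ?thesis using Suc.prems(6,8) i(1) by fastforce
    qed
  qed
  moreover have "y = ?z + (y $ c / x $ c) \<cdot>\<^sub>v x" using Suc.prems(7) dx by (intro eq_vecI) auto
  ultimately show ?case using subsp_comb[OF G(1) _ Suc.prems(4)] by metis
qed

lemma initial_segment:
  fixes S :: "nat set"
  assumes "finite S" "\<And>c. c \<in> S \<Longrightarrow> lo \<le> c" "\<And>c. c \<in> S \<Longrightarrow> lo < c \<Longrightarrow> c - 1 \<in> S"
  shows "S = {lo..<lo + card S}"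
proof (cases "S = {}")
  case False
  define m where "m = Max S"
  have m: "m \<in> S" "\<And>c. c \<in> S \<Longrightarrow> c \<le> m" using assms(1) False by (auto simp: m_def)
  have "d \<in> S" if "lo \<le> d" "d \<le> m" for d
    using that(2,1) m(1)
  proof (induction rule: inc_induct)
    case (step d)
    then show ?case using assms(3)[of "Suc d"] by simp
  qed
  moreover have "lo \<le> c \<and> c \<le> m" if "c \<in> S" for c using assms(2)[OF that] m(2)[OF that] by simp
  ultimately have "c \<in> S \<longleftrightarrow> c \<in> {lo..<Suc m}" for c by (metis atLeastLessThan_iff less_Suc_eq_le)
  then have S: "S = {lo..<Suc m}" by blast
  then have "card S = Suc m - lo" by simp
  with assms(2)[OF m(1)] have "lo + card S = Suc m" by simp
  with S show ?thesis by simp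
qed simp

lemma piv_stable:
  assumes F: "subsp n F" and N: "Nmap n k ` F \<subseteq> F"
  shows "{c \<in> piv n F. c < n - k} = {0..<tp n k F}"
    and "{c \<in> piv n F. n - k \<le> c} = {n - k..<n - k + bp n k F}"
proof -
  have dn: "c - 1 \<in> piv n F" if c: "c \<in> piv n F" "0 < c" "c \<noteq> n - k" for c
  proof -
    obtain x where x: "x \<in> F" "leads n x c" using c by (auto simp: piv_def)
    have "leads n ((Nmap n k ^^ 1) x) (c - 1)"
      by (rule leads_shift) (use x c subspD(1)[OF F] in auto)
    then show ?thesis using x N by (auto simp: piv_def)
  qed
  show "{c \<in> piv n F. c < n - k} = {0..<tp n k F}"
    unfolding tp_def by (rule initial_segment[where lo = 0, simplified]) (use dn finite_piv in auto)
  show "{c \<in> piv n F. n - k \<le> c} = {n - k..<n - k + bp n k F}"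
    unfolding bp_def by (rule initial_segment) (use dn finite_piv in auto)
qed

text \<open>N acts on P and on Q as a single Jordan block, whose stable subspaces form a chain and
  are determined by their dimensions. Hence F' carries exactly the two numbers \<open>tp\<close> and
  \<open>bp\<close>.\<close>

lemma Fprime_stable:
  assumes F: "subsp n F" and N: "Nmap n k ` F \<subseteq> F"
  shows "Fprime n k F = CS n k (tp n k F) (bp n k F)"
proof -
  note D = subspD[OF F] and P = piv_stable[OF F N]
  have P1: "x \<in> CS n k (tp n k F) 0" if x: "x \<in> F" "x \<in> Pspace n k" for x
  proof -
    have "i < n - k \<and> i < tp n k F" if i: "i < n" "x $ i \<noteq> 0" for i
    proof -
      obtain c where c: "i \<le> c" "leads n x c" using leads_exists[OF i] by blast
      then have "c < n" "x $ c \<noteq> 0" by (simp_all add: leads_def)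
      then have "c < n - k" using x(2) unfolding Pspace_def by (metis (mono_tags, lifting) mem_Collect_eq not_le)
      moreover have "c \<in> piv n F" using c x by (auto simp: piv_def)
      ultimately have "c \<in> {0..<tp n k F}" using P(1) by blast
      then show ?thesis using c \<open>c < n - k\<close> by simp
    qed
    then show ?thesis using D(1)[OF x(1)] by (auto simp: CS_def)
  qed
  have P2: "x \<in> F \<and> x \<in> Pspace n k" if x: "x \<in> CS n k (tp n k F) 0" for x
  proof (cases "tp n k F")
    case 0
    then have "x = 0\<^sub>v n" using x by (intro eq_vecI) (auto simp: CS_def)
    then show ?thesis using D(3) by (auto simp: Pspace_def)
  next
    case (Suc t)
    then have "t \<in> {c \<in> piv n F. c < n - k}" unfolding P(1) by simp
    then obtain y where y: "y \<in> F" "leads n y t" "t < n - k" by (auto simp: piv_def)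
    have xc: "x \<in> carrier_vec n" using x by (simp add: CS_def)
    have "x \<in> F"
    proof (rule stable_fill[OF F N, of 0 t y x])
      show "0 \<le> i \<and> i \<le> t" if "i < n" "x $ i \<noteq> 0" for i using x that Suc by (auto simp: CS_def)
      show "0 \<le> i \<and> i \<le> t" if "i < n" "y $ i \<noteq> 0" for i using leads_max[OF y(2) that] by simp
    qed (use y xc in \<open>auto simp: leads_def\<close>)
    moreover have "x \<in> Pspace n k" using x by (auto simp: CS_def Pspace_def)
    ultimately show ?thesis by simp
  qed
  have Q1: "rho n k x \<in> CS n k 0 (bp n k F)" if x: "x \<in> F" for x
  proof -
    have "n - k \<le> i \<and> i - (n - k) < bp n k F" if i: "i < n" "rho n k x $ i \<noteq> 0" for i
    proof -
      have ik: "n - k \<le> i" "x $ i \<noteq> 0" using i by (auto split: if_splits)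
      obtain c where c: "i \<le> c" "leads n x c" using leads_exists[OF i(1) ik(2)] by blast
      then have "c \<in> {c \<in> piv n F. n - k \<le> c}" using ik x by (auto simp: piv_def)
      then show ?thesis using c ik unfolding P(2) by auto
    qed
    then show ?thesis by (auto simp: CS_def)
  qed
  have Q2: "y \<in> rho n k ` F" if y: "y \<in> CS n k 0 (bp n k F)" for y
  proof (cases "bp n k F")
    case 0
    then have "y = rho n k (0\<^sub>v n)" using y by (intro eq_vecI) (auto simp: CS_def)
    then show ?thesis using D(3) by blast
  next
    case (Suc b)
    then have "n - k + b \<in> {c \<in> piv n F. n - k \<le> c}" unfolding P(2) by simp
    then obtain x where x: "x \<in> F" "leads n x (n - k + b)" by (auto simp: piv_def)
    have yc: "y \<in> carrier_vec n" using y by (simp add: CS_def)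
    have sub: "subsp n (rho n k ` F)" unfolding subsp_def
    proof (intro conjI ballI allI)
      have "rho n k (0\<^sub>v n) = 0\<^sub>v n" by (intro eq_vecI) auto
      then show "0\<^sub>v n \<in> rho n k ` F" using D(3) by force
      fix u v a assume "u \<in> rho n k ` F" "v \<in> rho n k ` F"
      then obtain u' v' where u': "u' \<in> F" "u = rho n k u'" "v' \<in> F" "v = rho n k v'" by blast
      have "u + v = rho n k (u' + v')" using u' D(2) by (intro eq_vecI) auto
      then show "u + v \<in> rho n k ` F" using D(4) u' by blast
    next
      fix u a assume "u \<in> rho n k ` F"
      then obtain u' where u': "u' \<in> F" "u = rho n k u'" by blast
      have "a \<cdot>\<^sub>v u = rho n k (a \<cdot>\<^sub>v u')" using u' D(2) by (intro eq_vecI) auto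
      then show "a \<cdot>\<^sub>v u \<in> rho n k ` F" using D(5) u' by blast
    qed auto
    have stab: "Nmap n k ` rho n k ` F \<subseteq> rho n k ` F"
    proof (rule image_subsetI)
      fix z assume "z \<in> rho n k ` F"
      then obtain u where u: "u \<in> F" "z = rho n k u" by blast
      then show "Nmap n k z \<in> rho n k ` F" using Nmap_rho[OF D(1)[OF u(1)], of k] N by auto
    qed
    show ?thesis
    proof (rule stable_fill[OF sub stab, of "n - k" "n - k + b" "rho n k x" y])
      show "n - k \<le> i \<and> i \<le> n - k + b" if "i < n" "y $ i \<noteq> 0" for i using y that Suc by (auto simp: CS_def)
      show "n - k \<le> i \<and> i \<le> n - k + b" if "i < n" "rho n k x $ i \<noteq> 0" for i
        using leads_max[OF x(2), of i] that by (auto split: if_splits)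
    qed (use x yc in \<open>auto simp: leads_def\<close>)
  qed
  show ?thesis
  proof (intro equalityI subsetI)
    fix v assume "v \<in> Fprime n k F"
    then obtain a x where v: "v = a + rho n k x" "a \<in> F" "a \<in> Pspace n k" "x \<in> F"
      by (auto simp: Fprime_def setsum_vec_def)
    have "(i < n - k \<and> i < tp n k F) \<or> (n - k \<le> i \<and> i - (n - k) < bp n k F)"
      if i: "i < n" "v $ i \<noteq> 0" for i
    proof -
      have "a $ i \<noteq> 0 \<or> rho n k x $ i \<noteq> 0" using i D(2)[OF v(2)] unfolding v(1) by auto
      then show ?thesis using P1[OF v(2,3)] Q1[OF v(4)] i(1) unfolding CS_def by blast
    qed
    moreover have "v \<in> carrier_vec n" unfolding v(1) using D(1)[OF v(2)] by simp
    ultimately show "v \<in> CS n k (tp n k F) (bp n k F)" unfolding CS_def by blast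
  next
    fix v assume v: "v \<in> CS n k (tp n k F) (bp n k F)"
    let ?a = "vec n (\<lambda>i. if i < n - k then v $ i else 0)"
    have "?a \<in> CS n k (tp n k F) 0" "rho n k v \<in> CS n k 0 (bp n k F)" using v by (auto simp: CS_def split: if_splits)
    then have "?a \<in> F \<inter> Pspace n k" "rho n k v \<in> rho n k ` F" using P2 Q2 by auto
    moreover have "v = ?a + rho n k v" using v by (intro eq_vecI) (auto simp: CS_def)
    ultimately show "v \<in> Fprime n k F" unfolding Fprime_def setsum_vec_def by blast
  qed
qed

lemma Fprime_eq_CS_D:
  assumes F: "subsp n F" and e: "Fprime n k F = CS n k t b"
  shows "F \<inter> Pspace n k = CS n k t 0" and "rho n k ` F = CS n k 0 b"
proof -
  note D = subspD[OF F]
  have z: "rho n k (0\<^sub>v n) = 0\<^sub>v n" by (intro eq_vecI) auto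
  show "F \<inter> Pspace n k = CS n k t 0"
  proof (intro equalityI subsetI)
    fix x assume x: "x \<in> F \<inter> Pspace n k"
    have "x = x + rho n k (0\<^sub>v n)" using x D(1) by (auto simp: z)
    then have "x \<in> Fprime n k F" unfolding Fprime_def setsum_vec_def using x D(3) by blast
    then have "x \<in> CS n k t b" using e by simp
    then show "x \<in> CS n k t 0" using x by (force simp: CS_def Pspace_def)
  next
    fix x assume x: "x \<in> CS n k t 0"
    then have "x \<in> CS n k t b" by (force simp: CS_def)
    then have "x \<in> Fprime n k F" unfolding e .
    then obtain a y where ay: "x = a + rho n k y" "a \<in> F" "a \<in> Pspace n k" "y \<in> F"
      by (auto simp: Fprime_def setsum_vec_def)
    have "x $ i = a $ i" if "i < n" for i
    proof (cases "i < n - k")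
      case True
      then show ?thesis using ay D(2) that by simp
    next
      case False
      then show ?thesis using x ay(3) that by (force simp: CS_def Pspace_def)
    qed
    then have "x = a" using x ay D(2) by (intro eq_vecI) (auto simp: CS_def)
    then show "x \<in> F \<inter> Pspace n k" using ay by simp
  qed
  show "rho n k ` F = CS n k 0 b"
  proof (intro equalityI subsetI)
    fix x assume "x \<in> rho n k ` F"
    then obtain y where y: "y \<in> F" "x = rho n k y" by blast
    have "x = 0\<^sub>v n + rho n k y" using y by simp
    moreover have "0\<^sub>v n \<in> F \<inter> Pspace n k" using D(3) by (auto simp: Pspace_def)
    ultimately have "x \<in> CS n k t b" using e y(1) unfolding Fprime_def setsum_vec_def by blast
    then show "x \<in> CS n k 0 b" using y by (auto simp: CS_def split: if_splits)
  next
    fix x assume x: "x \<in> CS n k 0 b"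
    then have "x \<in> CS n k t b" by (force simp: CS_def)
    then have "x \<in> Fprime n k F" unfolding e .
    then obtain a y where ay: "x = a + rho n k y" "a \<in> F" "a \<in> Pspace n k" "y \<in> F"
      by (auto simp: Fprime_def setsum_vec_def)
    have "x $ i = rho n k y $ i" if "i < n" for i
    proof (cases "i < n - k")
      case True
      then show ?thesis using x that by (force simp: CS_def)
    next
      case False
      then show ?thesis using ay D(2) that by (auto simp: Pspace_def)
    qed
    then have "x = rho n k y" using x by (intro eq_vecI) (auto simp: CS_def)
    then show "x \<in> rho n k ` F" using ay by simp
  qed
qed

section \<open>Zariski closed conditions on flags\<close>

lemma pf_sum: "finite A \<Longrightarrow> (\<And>x. x \<in> A \<Longrightarrow> f x \<in> polyfun n) \<Longrightarrow> (\<lambda>g. \<Sum>x\<in>A. f x g) \<in> polyfun n"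
  by (induction A rule: finite_induct) (auto intro: polyfun.intros)

lemma pf_prod: "finite A \<Longrightarrow> (\<And>x. x \<in> A \<Longrightarrow> f x \<in> polyfun n) \<Longrightarrow> (\<lambda>g. \<Prod>x\<in>A. f x g) \<in> polyfun n"
  by (induction A rule: finite_induct) (auto intro: polyfun.intros)

text \<open>The Leibniz formula for the minor, with \<open>R\<close> and \<open>S\<close> skipping
  the deleted row and column. A \<open>polyfun\<close> is a formula in fixed entries and does not
  see the size of its argument, so agreement is claimed on n by n matrices.\<close>

lemma pf_cofactor:
  assumes i: "i < n" and j: "j < n"
  shows "\<exists>p\<in>polyfun n. \<forall>g\<in>carrier_mat n n. p g = cofactor g i j"
proof -
  define R where "R x = (if x < i then x else Suc x)" for x
  define S where "S x = (if x < j then x else Suc x)" for x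
  define Pi where "Pi = {\<pi>. \<pi> permutes {0..<n - 1}}"
  define r where "r \<pi> g = (\<Prod>x = 0..<n - 1. g $$ (R x, S (\<pi> x)))" for \<pi> and g :: "complex mat"
  define p where "p g = (-1) ^ (i + j) * (\<Sum>\<pi>\<in>Pi. signof \<pi> * r \<pi> g)" for g :: "complex mat"
  have lt: "\<pi> x < n - 1" if "\<pi> \<in> Pi" "x < n - 1" for \<pi> x
    using permutes_in_image[of \<pi> "{0..<n - 1}" x] that by (simp add: Pi_def)
  have 1: "r \<pi> \<in> polyfun n" if \<pi>: "\<pi> \<in> Pi" for \<pi>
    unfolding r_def
  proof (rule pf_prod)
    fix x assume "x \<in> {0..<n - 1}"
    then have "x < n - 1" by simp
    with lt[OF \<pi> this] have "R x < n" "S (\<pi> x) < n" by (auto simp: R_def S_def)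
    then show "(\<lambda>g. g $$ (R x, S (\<pi> x))) \<in> polyfun n" by (rule pf_entry)
  qed simp
  have 2: "(\<lambda>g. signof \<pi> * r \<pi> g) \<in> polyfun n" if "\<pi> \<in> Pi" for \<pi>
    by (rule pf_mult[of "\<lambda>g. signof \<pi>" n "r \<pi>"]) (use 1 that in \<open>auto intro: pf_const\<close>)
  have fin: "finite Pi" unfolding Pi_def by (rule finite_permutations) simp
  have 3: "(\<lambda>g. \<Sum>\<pi>\<in>Pi. signof \<pi> * r \<pi> g) \<in> polyfun n"
    by (rule pf_sum[OF fin 2])
  have "p \<in> polyfun n"
    unfolding p_def by (rule pf_mult[OF pf_const 3])
  moreover have "p g = cofactor g i j" if g: "g \<in> carrier_mat n n" for g
  proof -
    have "mat_delete g i j \<in> carrier_mat (n - 1) (n - 1)" using g unfolding mat_delete_def by auto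
    then have "det (mat_delete g i j) =
      (\<Sum>\<pi>\<in>Pi. signof \<pi> * (\<Prod>x = 0..<n - 1. mat_delete g i j $$ (x, \<pi> x)))"
      unfolding Pi_def by (rule det_def')
    also have "\<dots> = (\<Sum>\<pi>\<in>Pi. signof \<pi> * r \<pi> g)"
    proof (rule sum.cong[OF refl])
      fix \<pi> assume \<pi>: "\<pi> \<in> Pi"
      have "(\<Prod>x = 0..<n - 1. mat_delete g i j $$ (x, \<pi> x)) = r \<pi> g"
        unfolding r_def
      proof (rule prod.cong[OF refl])
        fix x assume "x \<in> {0..<n - 1}"
        then have x: "x < n - 1" by simp
        show "mat_delete g i j $$ (x, \<pi> x) = g $$ (R x, S (\<pi> x))"
          using x lt[OF \<pi> x] g by (simp add: mat_delete_def R_def S_def)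
      qed
      then show "signof \<pi> * (\<Prod>x = 0..<n - 1. mat_delete g i j $$ (x, \<pi> x)) = signof \<pi> * r \<pi> g"
        by (rule arg_cong)
    qed
    finally show ?thesis unfolding cofactor_def p_def by (simp only:)
  qed
  ultimately show ?thesis by blast
qed

lemma col_span_iff_adj:
  assumes g: "g \<in> GLn n" and v: "v \<in> carrier_vec n"
  shows "v \<in> col_span n g b \<longleftrightarrow> (\<forall>r<n. b \<le> r \<longrightarrow> (adj_mat g *\<^sub>v v) $ r = 0)"
proof -
  note gc = GLn_carrier[OF g]
  have d: "det g \<noteq> 0" using g by (simp add: GLn_def)
  note A = adj_mat[OF gc]
  show ?thesis
  proof
    assume "v \<in> col_span n g b"
    then obtain u where u: "u \<in> carrier_vec n" "\<forall>i<n. b \<le> i \<longrightarrow> u $ i = 0" "v = g *\<^sub>v u"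
      by (auto simp: col_span_def)
    have "adj_mat g *\<^sub>v v = (adj_mat g * g) *\<^sub>v u"
      unfolding u(3) by (rule assoc_mult_mat_vec[OF A(1) gc u(1), symmetric])
    also have "\<dots> = det g \<cdot>\<^sub>v u" unfolding A(3) using u(1) by auto
    finally show "\<forall>r<n. b \<le> r \<longrightarrow> (adj_mat g *\<^sub>v v) $ r = 0" using u by auto
  next
    assume r: "\<forall>r<n. b \<le> r \<longrightarrow> (adj_mat g *\<^sub>v v) $ r = 0"
    let ?u = "(1 / det g) \<cdot>\<^sub>v (adj_mat g *\<^sub>v v)"
    have av: "adj_mat g *\<^sub>v v \<in> carrier_vec n" using A(1) v by simp
    have "g *\<^sub>v ?u = (1 / det g) \<cdot>\<^sub>v (g *\<^sub>v (adj_mat g *\<^sub>v v))"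
      by (rule mult_mat_vec[OF gc av])
    also have "g *\<^sub>v (adj_mat g *\<^sub>v v) = (g * adj_mat g) *\<^sub>v v"
      by (rule assoc_mult_mat_vec[OF gc A(1) v, symmetric])
    also have "\<dots> = det g \<cdot>\<^sub>v v" unfolding A(2) using v by auto
    also have "(1 / det g) \<cdot>\<^sub>v (det g \<cdot>\<^sub>v v) = v" using d v by (intro eq_vecI) auto
    finally have "g *\<^sub>v ?u = v" .
    moreover have "?u \<in> carrier_vec n" "\<forall>i<n. b \<le> i \<longrightarrow> ?u $ i = 0"
      using r av carrier_matD[OF A(1)] by (auto simp del: index_mult_mat_vec)
    ultimately show "v \<in> col_span n g b" unfolding col_span_def by (intro CollectI exI[of _ ?u]) simp
  qed
qed

text \<open>Linearity reduces an inclusion of spaces to finitely many columns, each of which then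
  gives polynomial equations. The case c = 0 yields plain inclusions.\<close>

lemma Nmap_pow_col_span_iff:
  assumes g: "g \<in> carrier_mat n n" and a: "a \<le> n" and G: "subsp n G"
  shows "(Nmap n k ^^ c) ` col_span n g a \<subseteq> G \<longleftrightarrow> (\<forall>s<a. (Nmap n k ^^ c) (col g s) \<in> G)"
proof
  assume h: "(Nmap n k ^^ c) ` col_span n g a \<subseteq> G"
  show "\<forall>s<a. (Nmap n k ^^ c) (col g s) \<in> G"
  proof (intro allI impI)
    fix s assume s: "s < a"
    have "col g s = 0\<^sub>v n + 1 \<cdot>\<^sub>v col g s" using g s a by (intro eq_vecI) auto
    then have "col g s \<in> col_span n g (Suc s)"
      unfolding col_span_Suc[OF g less_le_trans[OF s a]]
      using subspD(3)[OF col_span_subsp[OF g, of s]] by blast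
    then have "col g s \<in> col_span n g a" using col_span_mono[of "Suc s" a] s by auto
    then show "(Nmap n k ^^ c) (col g s) \<in> G" using h by auto
  qed
next
  assume "\<forall>s<a. (Nmap n k ^^ c) (col g s) \<in> G"
  then show "(Nmap n k ^^ c) ` col_span n g a \<subseteq> G" using a
  proof (induction a)
    case 0
    have "(Nmap n k ^^ c) (0\<^sub>v n) = 0\<^sub>v n"
      using Nmap_pow_dim[of "0\<^sub>v n" n c k] by (intro eq_vecI) (auto simp: Nmap_pow_index)
    then show ?case using col_span_0[OF g] subspD(3)[OF G] by simp
  next
    case (Suc a)
    have "(Nmap n k ^^ c) x \<in> G" if "x \<in> col_span n g (Suc a)" for x
    proof -
      from that obtain y b where y: "y \<in> col_span n g a" "x = y + b \<cdot>\<^sub>v col g a"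
        using col_span_Suc[OF g, of a] Suc.prems by auto
      have yc: "y \<in> carrier_vec n" using subspD(1)[OF col_span_subsp[OF g]] y by blast
      have cc: "col g a \<in> carrier_vec n" using g by (intro carrier_vecI) simp
      have "(Nmap n k ^^ c) x = (Nmap n k ^^ c) y + b \<cdot>\<^sub>v (Nmap n k ^^ c) (col g a)"
        unfolding y(2) using Nmap_pow_add[OF yc, of "b \<cdot>\<^sub>v col g a" c k] Nmap_pow_smult[OF cc, of c k b] cc by simp
      then show ?thesis using subsp_comb[OF G] Suc y by auto
    qed
    then show ?case by blast
  qed
qed

text \<open>Membership in a span of columns is tested with the adjugate instead of the inverse matrix, so
  that the conditions are polynomial.\<close>

lemma zclosed_Nmap_pow:
  assumes a: "a \<le> n"
  shows "GL_zclosed n {g \<in> GLn n. (Nmap n k ^^ c) ` col_span n g a \<subseteq> col_span n g b}"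
proof -
  have "\<exists>P. \<forall>r i. r < n \<longrightarrow> i < n \<longrightarrow> P r i \<in> polyfun n \<and> (\<forall>g\<in>carrier_mat n n. P r i g = cofactor g i r)"
  proof -
    have "\<forall>r i. \<exists>p. r < n \<longrightarrow> i < n \<longrightarrow> p \<in> polyfun n \<and> (\<forall>g\<in>carrier_mat n n. p g = cofactor g i r)"
      using pf_cofactor by blast
    then show ?thesis by (simp only: choice_iff)
  qed
  then obtain P where P: "\<And>r i. r < n \<Longrightarrow> i < n \<Longrightarrow> P r i \<in> polyfun n"
    "\<And>r i g. r < n \<Longrightarrow> i < n \<Longrightarrow> g \<in> carrier_mat n n \<Longrightarrow> P r i g = cofactor g i r" by blast
  define I where "I = {i. i < n \<and> i + c < n \<and> (i < n - k \<longrightarrow> i + c < n - k)}"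
  define q where "q r s g = (\<Sum>i\<in>I. P r i g * g $$ (i + c, s))" for r s and g :: "complex mat"
  have finI: "finite I" by (simp add: I_def)
  have q: "q r s \<in> polyfun n" if "r < n" "s < n" for r s
    unfolding q_def using P(1) that by (intro pf_sum finI pf_mult pf_entry) (auto simp: I_def)
  have qe: "q r s g = (adj_mat g *\<^sub>v (Nmap n k ^^ c) (col g s)) $ r"
    if r: "r < n" and s: "s < n" and g: "g \<in> carrier_mat n n" for r s g
  proof -
    have cc: "col g s \<in> carrier_vec n" using g by (intro carrier_vecI) simp
    note nc = Nmap_pow_dim[OF cc, of c k]
    have "(adj_mat g *\<^sub>v (Nmap n k ^^ c) (col g s)) $ r
        = (\<Sum>i = 0..<n. adj_mat g $$ (r, i) * (Nmap n k ^^ c) (col g s) $ i)"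
      using r adj_mat(1)[OF g] nc by (auto simp: scalar_prod_def)
    also have "\<dots> = (\<Sum>i = 0..<n. if i \<in> I then P r i g * g $$ (i + c, s) else 0)"
    proof (rule sum.cong[OF refl])
      fix i assume "i \<in> {0..<n}"
      then have i: "i < n" by simp
      show "adj_mat g $$ (r, i) * (Nmap n k ^^ c) (col g s) $ i = (if i \<in> I then P r i g * g $$ (i + c, s) else 0)"
        using P(2)[OF r i g] Nmap_pow_index[OF cc i, of c k] r i s g
        by (auto simp: I_def adj_mat_def)
    qed
    also have "\<dots> = q r s g"
      unfolding q_def by (rule sum.mono_neutral_cong_right) (auto simp: I_def)
    finally show ?thesis by simp
  qed
  let ?Ps = "{q r s | r s. r < n \<and> b \<le> r \<and> s < a}"
  have "?Ps \<subseteq> polyfun n" using q a by auto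
  moreover have "{g \<in> GLn n. (Nmap n k ^^ c) ` col_span n g a \<subseteq> col_span n g b} = {g \<in> GLn n. \<forall>p\<in>?Ps. p g = 0}"
  proof (rule Collect_cong, rule conj_cong[OF refl])
    fix g assume g: "g \<in> GLn n"
    note gc = GLn_carrier[OF g]
    have cc: "(Nmap n k ^^ c) (col g s) \<in> carrier_vec n" for s
      by (rule Nmap_pow_dim) (use gc in \<open>auto intro!: carrier_vecI\<close>)
    show "((Nmap n k ^^ c) ` col_span n g a \<subseteq> col_span n g b) = (\<forall>p\<in>?Ps. p g = 0)"
      unfolding Nmap_pow_col_span_iff[OF gc a col_span_subsp[OF gc]] col_span_iff_adj[OF g cc]
      using qe[OF _ _ gc] a by fastforce
  qed
  ultimately show ?thesis unfolding GL_zclosed_def by blast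
qed

lemma CS_subsp: "subsp n (CS n k t b)"
  unfolding subsp_def
proof (intro conjI ballI allI)
  fix x y assume "x \<in> CS n k t b" "y \<in> CS n k t b"
  then have x: "x \<in> carrier_vec n" "\<And>i. i < n \<Longrightarrow> x $ i \<noteq> 0 \<Longrightarrow> (i < n - k \<and> i < t) \<or> (n - k \<le> i \<and> i - (n - k) < b)"
    and y: "y \<in> carrier_vec n" "\<And>i. i < n \<Longrightarrow> y $ i \<noteq> 0 \<Longrightarrow> (i < n - k \<and> i < t) \<or> (n - k \<le> i \<and> i - (n - k) < b)"
    by (auto simp: CS_def)
  have "x $ i \<noteq> 0 \<or> y $ i \<noteq> 0" if "i < n" "(x + y) $ i \<noteq> 0" for i using that x(1) y(1) by auto
  then have "(i < n - k \<and> i < t) \<or> (n - k \<le> i \<and> i - (n - k) < b)" if "i < n" "(x + y) $ i \<noteq> 0" for i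
    using x(2)[of i] y(2)[of i] that by blast
  moreover have "x + y \<in> carrier_vec n" using x(1) y(1) by simp
  ultimately show "x + y \<in> CS n k t b" unfolding CS_def by blast
qed (auto simp: CS_def)

lemma zclosed_CS:
  assumes a: "a \<le> n"
  shows "GL_zclosed n {g \<in> GLn n. col_span n g a \<subseteq> CS n k t b}"
proof -
  let ?Ps = "{(\<lambda>g. g $$ (i, s)) | i s. i < n \<and> s < a \<and>
      \<not> ((i < n - k \<and> i < t) \<or> (n - k \<le> i \<and> i - (n - k) < b))} :: (complex mat \<Rightarrow> complex) set"
  have "?Ps \<subseteq> polyfun n" using a by (auto intro!: pf_entry)
  moreover have "{g \<in> GLn n. col_span n g a \<subseteq> CS n k t b} = {g \<in> GLn n. \<forall>p\<in>?Ps. p g = 0}"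
  proof (rule Collect_cong, rule conj_cong[OF refl])
    fix g assume g: "g \<in> GLn n"
    note gc = GLn_carrier[OF g]
    have "col_span n g a \<subseteq> CS n k t b \<longleftrightarrow> (\<forall>s<a. col g s \<in> CS n k t b)"
      using Nmap_pow_col_span_iff[OF gc a CS_subsp[of n k t b], where c = 0] by simp
    also have "\<dots> \<longleftrightarrow> (\<forall>p\<in>?Ps. p g = 0)"
      unfolding CS_def using gc a by (fastforce intro!: carrier_vecI)
    finally show "col_span n g a \<subseteq> CS n k t b \<longleftrightarrow> (\<forall>p\<in>?Ps. p g = 0)" .
  qed
  ultimately show ?thesis unfolding GL_zclosed_def by blast
qed

text \<open>Invariance makes the preimage of the set of flags satisfying \<open>P\<close> equal to
  the set of matrices satisfying \<open>P\<close>. That set of flags is therefore closed in the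
  quotient topology and contains the closure of \<open>S\<close>.\<close>

lemma flag_closure_cond:
  assumes cl: "GL_zclosed n {g \<in> GLn n. P g}"
    and inv: "\<And>g h. g \<in> GLn n \<Longrightarrow> h \<in> GLn n \<Longrightarrow> flag_of n is g = flag_of n is h \<Longrightarrow> P g = P h"
    and S: "\<And>g. g \<in> GLn n \<Longrightarrow> flag_of n is g \<in> S \<Longrightarrow> P g" and SF: "S \<subseteq> FlagVar n is"
    and g: "g \<in> GLn n" "flag_of n is g \<in> flag_zclosure n is S"
  shows "P g"
proof -
  let ?C = "flag_of n is ` {g \<in> GLn n. P g}"
  have "{g \<in> GLn n. flag_of n is g \<in> ?C} = {g \<in> GLn n. P g}"
  proof (intro Collect_cong conj_cong refl)
    fix h assume h: "h \<in> GLn n"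
    show "flag_of n is h \<in> ?C \<longleftrightarrow> P h" using inv[OF h] h by blast
  qed
  then have "flag_zclosed n is ?C" using cl unfolding flag_zclosed_def FlagVar_def by auto
  moreover have "S \<subseteq> ?C" using S SF by (auto simp: FlagVar_def)
  ultimately have "flag_of n is g \<in> ?C" using g(2) unfolding flag_zclosure_def by blast
  then show ?thesis using inv g(1) by blast
qed

section \<open>Flags in the closure of a cell\<close>

lemma CS_mono: "t \<le> t' \<Longrightarrow> b \<le> b' \<Longrightarrow> CS n k t b \<subseteq> CS n k t' b'"
  unfolding CS_def by fastforce

lemma CS_shift:
  assumes "x \<in> CS n k t b"
  shows "(Nmap n k ^^ c) x \<in> CS n k (t - c) (b - c)"
proof -
  have x: "x \<in> carrier_vec n" "\<And>i. i < n \<Longrightarrow> x $ i \<noteq> 0 \<Longrightarrow> (i < n - k \<and> i < t) \<or> (n - k \<le> i \<and> i - (n - k) < b)"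
    using assms by (auto simp: CS_def)
  have "(i < n - k \<and> i < t - c) \<or> (n - k \<le> i \<and> i - (n - k) < b - c)"
    if i: "i < n" "(Nmap n k ^^ c) x $ i \<noteq> 0" for i
  proof -
    have "i + c < n" "i < n - k \<longrightarrow> i + c < n - k" "x $ (i + c) \<noteq> 0"
      using i Nmap_pow_index[OF x(1) i(1), of c k] by (auto split: if_splits)
    then show ?thesis using x(2)[of "i + c"] by auto
  qed
  then show ?thesis using Nmap_pow_dim[OF x(1), of c k] by (auto simp: CS_def)
qed

lemma CS_unshift:
  assumes x: "x \<in> carrier_vec n" and s: "(Nmap n k ^^ c) x \<in> CS n k t b"
  shows "x \<in> CS n k (t + c) (b + c)"
proof -
  have "(i < n - k \<and> i < t + c) \<or> (n - k \<le> i \<and> i - (n - k) < b + c)" if i: "i < n" "x $ i \<noteq> 0" for i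
  proof (cases "c \<le> i \<and> (i < n - k \<or> n - k \<le> i - c)")
    case True
    then have e: "i - c < n" "i - c + c = i" using i by auto
    have "(Nmap n k ^^ c) x $ (i - c) = x $ i"
      using Nmap_pow_index[OF x e(1), of c k] True i unfolding e(2) by auto
    then have "(i - c < n - k \<and> i - c < t) \<or> (n - k \<le> i - c \<and> i - c - (n - k) < b)"
      using s i e(1) unfolding CS_def by auto
    then show ?thesis using True i by auto
  qed auto
  then show ?thesis using x by (auto simp: CS_def)
qed

lemma CS_shift_surj:
  assumes y: "y \<in> CS n k t b" and le: "t + c \<le> n - k" "b + c \<le> k" and kn: "k \<le> n"
  shows "\<exists>x\<in>CS n k (t + c) (b + c). (Nmap n k ^^ c) x = y"
proof -
  define x where "x = vec n (\<lambda>i. if i < n - k then (if i < c then 0 else y $ (i - c))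
    else (if i - (n - k) < c then 0 else y $ (i - c)))"
  have yc: "y \<in> carrier_vec n" "\<And>i. i < n \<Longrightarrow> y $ i \<noteq> 0 \<Longrightarrow> (i < n - k \<and> i < t) \<or> (n - k \<le> i \<and> i - (n - k) < b)"
    using y by (auto simp: CS_def)
  have xc: "x \<in> carrier_vec n" by (simp add: x_def)
  have sh: "(Nmap n k ^^ c) x = y"
  proof (rule eq_vecI)
    show "dim_vec ((Nmap n k ^^ c) x) = dim_vec y" using Nmap_pow_dim[OF xc, of c k] yc by simp
    fix i assume "i < dim_vec y"
    then have i: "i < n" using yc by simp
    show "(Nmap n k ^^ c) x $ i = y $ i"
    proof (cases "i + c < n \<and> (i < n - k \<longrightarrow> i + c < n - k)")
      case True
      then have "x $ (i + c) = y $ i" by (auto simp: x_def)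
      then show ?thesis using Nmap_pow_index[OF xc i, of c k] True by simp
    next
      case False
      have "y $ i = 0"
      proof (rule ccontr)
        assume "y $ i \<noteq> 0"
        from yc(2)[OF i this] False le kn i show False by linarith
      qed
      then show ?thesis using Nmap_pow_index[OF xc i, of c k] False by auto
    qed
  qed
  have "x \<in> CS n k (t + c) (b + c)" by (rule CS_unshift[OF xc]) (simp add: sh y)
  with sh show ?thesis by blast
qed

lemma col_span_GLn_full: "g \<in> GLn n \<Longrightarrow> v \<in> carrier_vec n \<Longrightarrow> v \<in> col_span n g n"
  by (subst col_span_iff_adj) auto

lemma flag_of_col_span:
  assumes "g \<in> GLn n" "h \<in> GLn n" "flag_of n is g = flag_of n is h" "p \<in> insert 0 (set is)"
  shows "col_span n g p = col_span n h p"
  using assms col_span_0[OF GLn_carrier] unfolding flag_of_def by auto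

text \<open>The orientation read off from a flag: an f-step is a jump of the projection to Q.\<close>

definition lamF :: "nat \<Rightarrow> nat \<Rightarrow> complex mat \<Rightarrow> int \<Rightarrow> bool" where
  "lamF n k g p \<longleftrightarrow> p < 1 \<or> (p \<le> int n \<and>
     bp n k (col_span n g (nat p - 1)) < bp n k (col_span n g (nat p)))"

section \<open>Inclusions valid on a cell and on its closure\<close>

context two_row_tableau
begin

definition good :: "complex mat \<Rightarrow> bool" where
  "good g \<longleftrightarrow> g \<in> GLn n \<and> (\<forall>p\<in>set is. Nmap n k ` col_span n g p \<subseteq> col_span n g (prv p))"

definition cell :: "complex mat \<Rightarrow> bool" where
  "cell g \<longleftrightarrow> good g \<and> (\<forall>p\<in>set is. Fprime n k (col_span n g p) = CS n k (T p) (B p))"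

lemma Ytilde_iff:
  assumes "g \<in> GLn n"
  shows "flag_of n is g \<in> Ytilde n k is \<longleftrightarrow> good g"
proof -
  have nth: "flag_of n is g ! l = col_span n g (is ! l)" if "l < length is" for l
    using that by (simp add: flag_of_def)
  have "(if l = 0 then {0\<^sub>v n} else flag_of n is g ! (l - 1)) = col_span n g (prv (is ! l))"
    if "l < length is" for l
    using nth_cases(1)[OF that] that col_span_0[OF GLn_carrier[OF assms]] by (auto simp: nth)
  then have "flag_of n is g \<in> Ytilde n k is \<longleftrightarrow>
     (\<forall>l<length is. Nmap n k ` col_span n g (is ! l) \<subseteq> col_span n g (prv (is ! l)))"
    using assms by (auto simp: Ytilde_def FlagVar_def nth)
  also have "\<dots> \<longleftrightarrow> good g" unfolding good_def using assms by (auto simp: all_set_conv_all_nth)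
  finally show ?thesis .
qed

lemma cell_iff:
  assumes "g \<in> GLn n"
  shows "flag_of n is g \<in> {F \<in> Ytilde n k is. map (Fprime n k) F = map (coord_space n k w) is} \<longleftrightarrow> cell g"
  using Ytilde_iff[OF assms] by (auto simp: cell_def flag_of_def coord_space_CS T_def B_def)

lemma goodD:
  assumes "good g"
  shows "g \<in> GLn n" "g \<in> carrier_mat n n" "subsp n (col_span n g p)"
    "p \<in> set is \<Longrightarrow> Nmap n k ` col_span n g p \<subseteq> col_span n g (prv p)"
    "p \<in> pos \<Longrightarrow> Nmap n k ` col_span n g p \<subseteq> col_span n g p"
proof -
  show g: "g \<in> GLn n" "g \<in> carrier_mat n n" using assms by (auto simp: good_def GLn_def)
  show "subsp n (col_span n g p)" by (rule col_span_subsp[OF g(2)])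
  show N: "p \<in> set is \<Longrightarrow> Nmap n k ` col_span n g p \<subseteq> col_span n g (prv p)" using assms by (auto simp: good_def)
  assume "p \<in> pos"
  then consider "p = 0" | "p \<in> set is" by (auto simp: pos_def)
  then show "Nmap n k ` col_span n g p \<subseteq> col_span n g p"
  proof cases
    case 1
    have "Nmap n k (0\<^sub>v n) = 0\<^sub>v n" by (intro eq_vecI) (auto simp: Nmap_def)
    then show ?thesis using 1 col_span_0[OF g(2)] by simp
  next
    case 2
    have "prv p \<le> p" by (simp add: prv_def)
    from col_span_mono[OF this] N[OF 2] show ?thesis by blast
  qed
qed

lemma good_dim: "good g \<Longrightarrow> p \<le> n \<Longrightarrow> tp n k (col_span n g p) + bp n k (col_span n g p) = p"
  using card_piv_col_span[OF goodD(1)] by (simp add: tp_bp)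

lemma cellD:
  assumes "cell g" "p \<in> pos"
  shows "col_span n g p \<inter> Pspace n k = CS n k (T p) 0" "rho n k ` col_span n g p = CS n k 0 (B p)"
proof -
  have g: "good g" using assms by (simp add: cell_def)
  note S = goodD(3)[OF g]
  have "Fprime n k (col_span n g p) = CS n k (T p) (B p)"
  proof (cases "p = 0")
    case True
    have z: "piv n (col_span n g p) = {}"
      unfolding True col_span_0[OF goodD(2)[OF g]] by (auto simp: piv_def leads_def)
    show ?thesis unfolding Fprime_stable[OF S goodD(5)[OF g assms(2)]] using True
      by (simp add: tp_def bp_def z[unfolded True])
  next
    case False
    then show ?thesis using assms by (simp add: cell_def pos_def)
  qed
  from Fprime_eq_CS_D[OF S this]
  show "col_span n g p \<inter> Pspace n k = CS n k (T p) 0" "rho n k ` col_span n g p = CS n k 0 (B p)" .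
qed

lemma cell_CS_sub: "cell g \<Longrightarrow> p \<in> pos \<Longrightarrow> CS n k (T p) 0 \<subseteq> col_span n g p"
  using cellD(1) by blast

lemma rho_eq_diff:
  assumes "x \<in> carrier_vec n" "y \<in> carrier_vec n" "rho n k x = rho n k y"
  shows "x - y \<in> Pspace n k" "x = y + (x - y)"
proof -
  have "x $ i = y $ i" if "n - k \<le> i" "i < n" for i
    using arg_cong[OF assms(3), of "\<lambda>v. v $ i"] that by simp
  then show "x - y \<in> Pspace n k" using assms by (auto simp: Pspace_def)
  show "x = y + (x - y)" using assms by (intro eq_vecI) auto
qed

text \<open>An Up leaves the projection to Q unchanged, so modulo P nothing new appears at step
  \<open>p\<close>. The correction lies in the intersection of F_p with P, which on the cell is
  spanned by the first \<open>T p\<close> of the e's.\<close>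

lemma cell_up:
  assumes c: "cell g" and p: "1 \<le> p" "p \<le> n" "\<not> crs p" "lab (int p) = Some Up" and x: "x \<in> col_span n g p"
  obtains y z where "y \<in> col_span n g (p - 1)" "z \<in> CS n k (T p) 0" "x = y + z"
proof -
  have g: "good g" using c by (simp add: cell_def)
  note S = subspD(1)[OF goodD(3)[OF g]]
  note P = single[OF p(1-3)]
  have "rho n k x \<in> CS n k 0 (B p)" using cellD(2)[OF c P(3)] x by blast
  also have "B p = B (p - 1)" using B_single[OF p(1-3)] p(4) by simp
  finally have "rho n k x \<in> rho n k ` col_span n g (p - 1)" using cellD(2)[OF c P(2)] by simp
  then obtain y where y: "y \<in> col_span n g (p - 1)" "rho n k x = rho n k y" by blast
  have y': "y \<in> col_span n g p" using y(1) col_span_mono[of "p - 1" p] by auto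
  note d = rho_eq_diff[OF S[OF x] S[OF y'] y(2)]
  have "x - y \<in> col_span n g p" by (rule subsp_diff[OF goodD(3)[OF g] x y'])
  then have "x - y \<in> CS n k (T p) 0" using d(1) cellD(1)[OF c P(3)] by blast
  with y(1) d(2) that show thesis by blast
qed

text \<open>At a cup (i, j) with j - i + 1 = 2 (d + 1), \<open>cell_up\<close> splits a vector of
  F_j into y in F_(j-1) and z in the span of the first \<open>T j\<close> of the e's. N^d moves y
  into F_i by the induction under the cup, and one further N into F_(i-1). N^(d+1) moves z into the
  span of the first \<open>T (i - 1)\<close> of the e's, which lies in F_(i-1).\<close>

lemma cell_closed_seg:
  assumes c: "cell g" and "closed_seg a b"
  shows "(Nmap n k ^^ ((b - a) div 2)) ` col_span n g b \<subseteq> col_span n g a"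
  using assms(2)
proof (induction rule: closed_induct)
  case (refl a)
  then show ?case by simp
next
  case (cross a b)
  have g: "good g" using c by (simp add: cell_def)
  have "a \<le> b" using closed_counts[OF cross.hyps(1)] by simp
  then have e: "(b + 2 - a) div 2 = Suc ((b - a) div 2)" by (simp add: Suc_diff_le)
  have "Nmap n k ` col_span n g (b + 2) \<subseteq> col_span n g b"
    using goodD(4)[OF g dblD(1)[OF cross.hyps(2)]] cross.hyps(2) by (simp add: prv_def)
  then show ?case using cross.IH unfolding e funpow_Suc_right by auto
next
  case (cup a i j)
  have g: "good g" using c by (simp add: cell_def)
  note S = goodD(3)[OF g]
  note D = blackD[OF cup.hyps(2)]
  define m where "m = (i - 1 - a) div 2"
  define d where "d = (j - 1 - i) div 2"
  have 1: "even (i - 1 - a)" "a \<le> i - 1" "even (j - 1 - i)" "i \<le> j - 1"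
    using closed_counts[OF cup.hyps(1)] closed_counts[OF cup.hyps(3)] by auto
  then have im: "i - 1 = a + 2 * m" "j - 1 = i + 2 * d" by (auto simp: m_def d_def)
  then have e: "(j - a) div 2 = m + (d + 1)" "(j - (i - 1)) div 2 = d + 1" using D by auto
  have Tj: "T j = T (i - 1) + (d + 1)" using closed_counts[OF closed_cup[OF cup.hyps(2)]] e by simp
  have Ni: "Nmap n k ` col_span n g i \<subseteq> col_span n g (i - 1)"
    using goodD(4)[OF g D(15)] D by (simp add: prv_def)
  have step: "(Nmap n k ^^ (d + 1)) x \<in> col_span n g (i - 1)" if x: "x \<in> col_span n g j" for x
  proof -
    obtain y z where y: "y \<in> col_span n g (j - 1)" and z: "z \<in> CS n k (T j) 0" and xyz: "x = y + z"
      using cell_up[OF c _ D(4,12,14) x] D by auto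
    have "(Nmap n k ^^ d) y \<in> col_span n g i" using cup.IH(2) y by (auto simp: d_def)
    then have "(Nmap n k ^^ (d + 1)) y \<in> col_span n g (i - 1)" using Ni by auto
    moreover have "(Nmap n k ^^ (d + 1)) z \<in> col_span n g (i - 1)"
      using CS_shift[OF z, of "d + 1"] cell_CS_sub[OF c D(6)] Tj by auto
    moreover have "(Nmap n k ^^ (d + 1)) x = (Nmap n k ^^ (d + 1)) y + (Nmap n k ^^ (d + 1)) z"
      unfolding xyz by (rule Nmap_pow_add) (use subspD(1)[OF S y] z in \<open>auto simp: CS_def\<close>)
    ultimately show ?thesis using subspD(4)[OF S] by simp
  qed
  show ?case unfolding e(1)
  proof (rule image_subsetI)
    fix x assume "x \<in> col_span n g j"
    from step[OF this] show "(Nmap n k ^^ (m + (d + 1))) x \<in> col_span n g a"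
      using cup.IH(1) unfolding m_def[symmetric] funpow_add[of m] o_apply by blast
  qed
qed

text \<open>A vector mapped by N^c into a coordinate space lies in the one enlarged by
  \<open>c\<close> in both rows; this handles crosses and black cups. The right end of a green cup
  is an Up and only adds vectors from P.\<close>

lemma cell_lclosed:
  assumes c: "cell g" and "lclosed b"
  shows "col_span n g b \<subseteq> CS n k (T b) (B b)"
  using assms(2)
proof (induction rule: lclosed_induct)
  case zero
  have g: "good g" using c by (simp add: cell_def)
  show ?case using col_span_0[OF goodD(2)[OF g]] by (auto simp: CS_def)
next
  case (cross b)
  have g: "good g" using c by (simp add: cell_def)
  have N: "Nmap n k ` col_span n g (b + 2) \<subseteq> col_span n g b"
    using goodD(4)[OF g dblD(1)[OF cross.hyps(2)]] cross.hyps(2) by (simp add: prv_def)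
  show ?case
  proof
    fix x assume x: "x \<in> col_span n g (b + 2)"
    then have "(Nmap n k ^^ 1) x \<in> CS n k (T b) (B b)" using N cross.IH by auto
    from CS_unshift[OF subspD(1)[OF goodD(3)[OF g] x] this]
    show "x \<in> CS n k (T (b + 2)) (B (b + 2))" using T_dbl[OF cross.hyps(2)] B_dbl[OF cross.hyps(2)] by simp
  qed
next
  case (cup i j)
  have g: "good g" using c by (simp add: cell_def)
  note cc = closed_counts[OF closed_cup[OF cup.hyps(2)]]
  show ?case
  proof
    fix x assume x: "x \<in> col_span n g j"
    then have "(Nmap n k ^^ ((j - (i - 1)) div 2)) x \<in> CS n k (T (i - 1)) (B (i - 1))"
      using cell_closed_seg[OF c closed_cup[OF cup.hyps(2)]] cup.IH by blast
    from CS_unshift[OF subspD(1)[OF goodD(3)[OF g] x] this] show "x \<in> CS n k (T j) (B j)" using cc by simp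
  qed
next
  case (green p b)
  have J: "int b \<in> joined C" using green.hyps by (auto simp: joined_iff)
  note ns = inner_single(1)[OF J green.hyps(4,5)]
  have up: "lab (int b) = Some Up" using CD(4)[OF green.hyps(2)] .
  show ?case
  proof
    fix x assume x: "x \<in> col_span n g b"
    obtain y z where y: "y \<in> col_span n g (b - 1)" and z: "z \<in> CS n k (T b) 0" and xyz: "x = y + z"
      using cell_up[OF c green.hyps(4,5) ns up x] .
    have "y \<in> CS n k (T b) (B b)" using y green.IH CS_mono[OF T_mono B_mono, of "b - 1" b "b - 1" b n k] by auto
    moreover have "z \<in> CS n k (T b) (B b)" using z CS_mono[of "T b" "T b" 0 "B b" n k] by auto
    ultimately show "x \<in> CS n k (T b) (B b)" unfolding xyz by (rule subspD(4)[OF CS_subsp])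
  qed
qed

text \<open>If F_a contains the coordinate space, it contains \<open>rho n k x\<close> for each of
  its vectors \<open>x\<close>, so \<open>x\<close> splits within F_a into its P- and Q-parts, both
  of the prescribed size.\<close>

lemma cell_CS_eqI:
  assumes c: "cell g" and a: "a \<in> pos" and s: "CS n k (T a) (B a) \<subseteq> col_span n g a"
  shows "col_span n g a = CS n k (T a) (B a)"
proof (rule equalityI[OF subsetI s])
  have g: "good g" using c by (simp add: cell_def)
  note S = goodD(3)[OF g]
  fix x assume x: "x \<in> col_span n g a"
  then have r: "rho n k x \<in> CS n k 0 (B a)" using cellD(2)[OF c a] by blast
  then have r': "rho n k x \<in> CS n k (T a) (B a)" using CS_mono[of 0 "T a" "B a" "B a" n k] by auto
  have xc: "x \<in> carrier_vec n" using subspD(1)[OF S x] .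
  have rr: "rho n k x = rho n k (rho n k x)" by (intro eq_vecI) auto
  note d = rho_eq_diff[OF xc _ rr]
  have "x - rho n k x \<in> col_span n g a" using subsp_diff[OF S x] r' s by blast
  then have "x - rho n k x \<in> CS n k (T a) 0" using d(1) cellD(1)[OF c a] by auto
  then have "x - rho n k x \<in> CS n k (T a) (B a)" using CS_mono[of "T a" "T a" 0 "B a" n k] by auto
  from subspD(4)[OF CS_subsp r' this] show "x \<in> CS n k (T a) (B a)" using d(2) by simp
qed

lemma T_le: "p \<in> pos \<Longrightarrow> T p \<le> n - k" and B_le: "p \<in> pos \<Longrightarrow> B p \<le> k"
  using T_mono[OF pos_le] B_mono[OF pos_le] T_n B_n by auto

text \<open>Going down from the whole space, F_(i-1) contains the image of the coordinate space F_j
  under N^c, and that image is the coordinate space smaller by \<open>c\<close> in both rows. At the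
  left end of a green cup, a Down, F_(a-1) inherits the bound on the e's from F_a, and its
  projection bounds the f's.\<close>

lemma cell_rclosed:
  assumes c: "cell g" and "rclosed a"
  shows "col_span n g a = CS n k (T a) (B a)"
  using assms(2)
proof (induction rule: rclosed_induct)
  case last
  have g: "good g" using c by (simp add: cell_def)
  show ?case
    by (rule cell_CS_eqI[OF c pos_n]) (use col_span_GLn_full[OF goodD(1)[OF g]] in \<open>auto simp: CS_def\<close>)
next
  case (cross a)
  have g: "good g" using c by (simp add: cell_def)
  have a: "a \<in> pos" using dblD(3)[OF cross.hyps(2)] by simp
  have N: "Nmap n k ` col_span n g (a + 2) \<subseteq> col_span n g a"
    using goodD(4)[OF g dblD(1)[OF cross.hyps(2)]] cross.hyps(2) by (simp add: prv_def)
  note TB' = T_dbl[OF cross.hyps(2)] B_dbl[OF cross.hyps(2)]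
  show ?case
  proof (rule cell_CS_eqI[OF c a], rule subsetI)
    fix y assume y: "y \<in> CS n k (T a) (B a)"
    obtain x where "x \<in> CS n k (T a + 1) (B a + 1)" "(Nmap n k ^^ 1) x = y"
      using CS_shift_surj[OF y, of 1] T_le[OF dblD(6)[OF cross.hyps(2)]] B_le[OF dblD(6)[OF cross.hyps(2)]] TB' kn
      by auto
    then show "y \<in> col_span n g a" using N cross.IH TB' by auto
  qed
next
  case (cup i j)
  note D = blackD[OF cup.hyps(2)]
  note cc = closed_counts[OF closed_cup[OF cup.hyps(2)]]
  let ?c = "(j - (i - 1)) div 2"
  show ?case
  proof (rule cell_CS_eqI[OF c D(6)], rule subsetI)
    fix y assume y: "y \<in> CS n k (T (i - 1)) (B (i - 1))"
    have "T (i - 1) + ?c \<le> n - k" "B (i - 1) + ?c \<le> k" using cc T_le[OF D(7)] B_le[OF D(7)] by auto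
    moreover have "k \<le> n" using kn by simp
    ultimately obtain x where x: "x \<in> CS n k (T (i - 1) + ?c) (B (i - 1) + ?c)" "(Nmap n k ^^ ?c) x = y"
      using CS_shift_surj[OF y] by blast
    have "T j = T (i - 1) + ?c" "B j = B (i - 1) + ?c" using cc by simp_all
    then have "x \<in> col_span n g j" using x(1) unfolding cup.IH by simp
    then show "y \<in> col_span n g (i - 1)"
      using cell_closed_seg[OF c closed_cup[OF cup.hyps(2)]] x(2) by blast
  qed
next
  case (green q a)
  have g: "good g" using c by (simp add: cell_def)
  note S = goodD(3)[OF g]
  have J: "int a \<in> joined C" using green.hyps by (auto simp: joined_iff)
  note ns = inner_single[OF J green.hyps(4,5)]
  have dn: "lab (int a) = Some Down" using CD(3)[OF green.hyps(2)] .
  have TB': "T a = T (a - 1)" using T_single[OF green.hyps(4,5) ns(1)] dn by simp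
  have sub: "col_span n g (a - 1) \<subseteq> CS n k (T (a - 1)) (B (a - 1))"
  proof
    fix x assume x: "x \<in> col_span n g (a - 1)"
    then have "x \<in> CS n k (T (a - 1)) (B a)" using col_span_mono[of "a - 1" a n g] green.IH TB' by auto
    moreover have "rho n k x \<in> CS n k 0 (B (a - 1))" using x cellD(2)[OF c ns(3)] by blast
    ultimately have "(i < n - k \<and> i < T (a - 1)) \<or> (n - k \<le> i \<and> i - (n - k) < B (a - 1))"
      if i: "i < n" "x $ i \<noteq> 0" for i
    proof (cases "i < n - k")
      case True
      then show ?thesis using \<open>x \<in> CS n k (T (a - 1)) (B a)\<close> i by (auto simp: CS_def)
    next
      case False
      then have "rho n k x $ i \<noteq> 0" using i by simp
      then show ?thesis using \<open>rho n k x \<in> CS n k 0 (B (a - 1))\<close> i(1) by (auto simp: CS_def)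
    qed
    then show "x \<in> CS n k (T (a - 1)) (B (a - 1))"
      using subspD(1)[OF S x] unfolding CS_def by blast
  qed
  show ?case
  proof (rule equalityI[OF sub subsetI])
    fix x assume x: "x \<in> CS n k (T (a - 1)) (B (a - 1))"
    then have xc: "x \<in> carrier_vec n" by (simp add: CS_def)
    have "rho n k x \<in> CS n k 0 (B (a - 1))" using x by (auto simp: CS_def split: if_splits)
    then obtain y where y: "y \<in> col_span n g (a - 1)" "rho n k x = rho n k y"
      using cellD(2)[OF c ns(3)] by (metis imageE)
    have yC: "y \<in> CS n k (T (a - 1)) (B (a - 1))" using y sub by blast
    note d = rho_eq_diff[OF xc subspD(1)[OF S y(1)] y(2)]
    have "x - y \<in> CS n k (T (a - 1)) (B (a - 1))" by (rule subsp_diff[OF CS_subsp x yC])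
    then have "(i < n - k \<and> i < T (a - 1))" if "i < n" "(x - y) $ i \<noteq> 0" for i
      using d(1) that unfolding CS_def Pspace_def by (cases "n - k \<le> i") blast+
    then have "x - y \<in> CS n k (T (a - 1)) 0" using d(1) unfolding CS_def Pspace_def by blast
    then have "x - y \<in> col_span n g (a - 1)" using cell_CS_sub[OF c ns(3)] by blast
    then show "x \<in> col_span n g (a - 1)" using d(2) subspD(4)[OF S y(1)] by metis
  qed
qed

text \<open>Each condition is an inclusion cutting out a Zariski closed set of matrices and
  depending on the flag alone, so it extends from the cell to its closure. The endpoints have to be
  flag dimensions, because other column spans change with the representing matrix.\<close>

lemma closure_conds:
  assumes g: "g \<in> GLn n" and f: "flag_of n is g \<in> Ytilde_w n k is w"
  shows "good g"
    and "closed_seg a b \<Longrightarrow> (Nmap n k ^^ ((b - a) div 2)) ` col_span n g b \<subseteq> col_span n g a"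
    and "lclosed a \<or> rclosed a \<Longrightarrow> col_span n g a \<subseteq> CS n k (T a) (B a)"
proof -
  let ?S = "{F \<in> Ytilde n k is. map (Fprime n k) F = map (coord_space n k w) is}"
  have SF: "?S \<subseteq> FlagVar n is" by (auto simp: Ytilde_def)
  have fc: "flag_of n is g \<in> flag_zclosure n is ?S" and fY: "flag_of n is g \<in> Ytilde n k is"
    using f by (simp_all add: Ytilde_w_def)
  show "good g" using fY Ytilde_iff[OF g] by simp
  show "(Nmap n k ^^ ((b - a) div 2)) ` col_span n g b \<subseteq> col_span n g a" if ab: "closed_seg a b"
  proof (rule flag_closure_cond[OF zclosed_Nmap_pow _ _ SF g fc])
    have ab': "a \<in> pos" "b \<in> pos" using ab by (auto simp: closed_seg_def)
    show "b \<le> n" using pos_le[OF ab'(2)] .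
    show "((Nmap n k ^^ ((b - a) div 2)) ` col_span n g b \<subseteq> col_span n g a) =
       ((Nmap n k ^^ ((b - a) div 2)) ` col_span n h b \<subseteq> col_span n h a)"
      if "g \<in> GLn n" "h \<in> GLn n" "flag_of n is g = flag_of n is h" for g h
      using flag_of_col_span[OF that] ab' unfolding pos_def by simp
    show "(Nmap n k ^^ ((b - a) div 2)) ` col_span n g b \<subseteq> col_span n g a"
      if "g \<in> GLn n" "flag_of n is g \<in> ?S" for g
      using cell_closed_seg[OF _ ab] cell_iff[OF that(1)] that(2) by blast
  qed
  show "col_span n g a \<subseteq> CS n k (T a) (B a)" if a: "lclosed a \<or> rclosed a"
  proof (rule flag_closure_cond[OF zclosed_CS _ _ SF g fc])
    have a': "a \<in> pos" using a by (auto simp: lclosed_def rclosed_def)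
    show "a \<le> n" using pos_le[OF a'] .
    show "(col_span n g a \<subseteq> CS n k (T a) (B a)) = (col_span n h a \<subseteq> CS n k (T a) (B a))"
      if "g \<in> GLn n" "h \<in> GLn n" "flag_of n is g = flag_of n is h" for g h
      using flag_of_col_span[OF that] a' unfolding pos_def by simp
    show "col_span n g a \<subseteq> CS n k (T a) (B a)"
      if "g \<in> GLn n" "flag_of n is g \<in> ?S" for g
      using cell_lclosed cell_rclosed a cell_iff[OF that(1)] that(2) by blast
  qed
qed

text \<open>Over a closed segment \<open>tp\<close> and \<open>bp\<close> grow by at most half the
  length each, hence by exactly half. Comparing the segment of a black cup with the segment under it
  leaves a growth of one in \<open>bp\<close> for its two ends together, so exactly one end is a
  jump. At a green cup \<open>bp\<close> equals \<open>B\<close> on both sides of the inner end, and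
  the weight label decides.\<close>

lemma orient_lamF:
  assumes g: "g \<in> GLn n" and f: "flag_of n is g \<in> Ytilde_w n k is w"
  shows "orient n C (lamF n k g)"
proof -
  note cond = closure_conds[OF g f]
  note G = cond(1)
  let ?b = "\<lambda>p. bp n k (col_span n g p)" and ?t = "\<lambda>p. tp n k (col_span n g p)"
  have cs: "?b b = ?b a + (b - a) div 2" if ab: "closed_seg a b" for a b
  proof -
    have ab': "a \<le> n" "b \<le> n" using ab pos_le by (auto simp: closed_seg_def)
    have ev: "even (b - a)" "a \<le> b" using closed_counts[OF ab] by auto
    have sub: "col_span n g b \<subseteq> carrier_vec n" using goodD(3)[OF G] by (simp add: subsp_def)
    note sh = tp_bp_shift[OF sub cond(2)[OF ab]]
    have "b = a + 2 * ((b - a) div 2)" using ev by simp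
    with sh good_dim[OF G ab'(1)] good_dim[OF G ab'(2)] show ?thesis by linarith
  qed
  have co: "?b a = B a" if a: "lclosed a \<or> rclosed a" for a
  proof -
    have a': "a \<in> pos" using a by (auto simp: lclosed_def rclosed_def)
    note le = tp_bp_CS[OF cond(3)[OF a]]
    with good_dim[OF G pos_le[OF a']] TB[OF a'] show ?thesis by linarith
  qed
  have mono: "?b (p - 1) \<le> ?b p" for p by (rule bp_mono, rule col_span_mono) simp
  have "lamF n k g p \<noteq> lamF n k g q" if pq: "(p, q) \<in> C" for p q
  proof -
    consider "p < 1" | "int n < q" | "1 \<le> p" "q \<le> int n" by linarith
    then show ?thesis
    proof cases
      case 1
      define b where "b = nat q"
      have q: "q = int b" "b \<le> n" using CD(5)[OF pq] CD(10)[OF pq] 1 by (auto simp: b_def)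
      note gl = green_left[OF pq[unfolded q(1)] 1 q(2)]
      have J: "int b \<in> joined C" using pq q by (auto simp: joined_iff)
      note ns = inner_single(1)[OF J gl(1) q(2)]
      have "B b = B (b - 1)" using B_single[OF gl(1) q(2) ns] CD(4)[OF pq] q(1) by simp
      then have "?b b = ?b (b - 1)" using co gl by simp
      then show ?thesis using 1 q gl(1) by (simp add: lamF_def)
    next
      case 2
      define a where "a = nat p"
      have p: "p = int a" "1 \<le> a" using CD(5)[OF pq] 2 by (auto simp: a_def)
      note gr = green_right[OF pq[unfolded p(1)] 2 p(2)]
      have J: "int a \<in> joined C" using pq p by (auto simp: joined_iff)
      note ns = inner_single(1)[OF J p(2) gr(1)]
      have "B a = B (a - 1) + 1" using B_single[OF p(2) gr(1) ns] CD(3)[OF pq] p(1) by simp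
      then have "?b (a - 1) < ?b a" using co gr by simp
      then show ?thesis using 2 p gr(1) by (simp add: lamF_def)
    next
      case 3
      define i where "i = nat p"
      define j where "j = nat q"
      have ij: "p = int i" "q = int j" using 3 CD(2)[OF pq] by (auto simp: i_def j_def)
      have bl: "black i j" using pq 3 unfolding black_def ij by simp
      note D = blackD[OF bl]
      have e: "(j - (i - 1)) div 2 = (j - 1 - i) div 2 + 1" using D by (simp add: div_if)
      have "?b j = ?b (i - 1) + ((j - 1 - i) div 2 + 1)" using cs[OF closed_cup[OF bl]] e by simp
      moreover have "?b (j - 1) = ?b i + (j - 1 - i) div 2" using cs[OF black_closed[OF bl]] .
      ultimately have "?b (i - 1) < ?b i \<longleftrightarrow> \<not> ?b (j - 1) < ?b j" using mono[of i] mono[of j] by linarith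
      then show ?thesis using D unfolding ij by (simp add: lamF_def)
    qed
  qed
  then show ?thesis unfolding orient_def by (auto simp: lamF_def left_outer_def right_outer_def)
qed

end

section \<open>Deformations of coordinate flags\<close>

type_synonym pp = "complex poly \<times> complex poly"

text \<open>A flag is generated by adding one vector at a time. The state is a pair of vectors (x, y)
  generating the current lattice over polynomials in N; label False adds a preimage under N of
  x + a y, label True of y + a x, and b undoes the corresponding base change at the other end of a
  cup. Both coordinates (along the e's and along the f's) evolve by the same rule, so a state of
  the recursion is one such coordinate of x and y, as polynomials in the formal inverse of N.\<close>

definition upd :: "bool \<Rightarrow> complex \<Rightarrow> complex \<Rightarrow> pp \<Rightarrow> pp" where
  "upd v a b z = (if v then (fst z - smult b (pCons 0 (snd z + smult a (fst z))), pCons 0 (snd z + smult a (fst z)))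
     else (pCons 0 (fst z + smult a (snd z)), snd z - smult b (pCons 0 (fst z + smult a (snd z)))))"

fun st :: "(nat \<Rightarrow> bool) \<Rightarrow> (nat \<Rightarrow> complex) \<Rightarrow> (nat \<Rightarrow> complex) \<Rightarrow> pp \<Rightarrow> nat \<Rightarrow> pp" where
  "st v al be z 0 = z"
| "st v al be z (Suc l) = upd (v (Suc l)) (al (Suc l)) (be (Suc l)) (st v al be z l)"

text \<open>X^d stands for e_d, respectively f_d, so multiplication by X inverts N. Constant terms
  are discarded because e_0 = f_0 = 0, and terms beyond the end of a Jordan block are cut
  off.\<close>

definition vecof :: "nat \<Rightarrow> nat \<Rightarrow> complex poly \<Rightarrow> complex poly \<Rightarrow> complex vec" where
  "vecof n k p q = vec n (\<lambda>c. if c < n - k then coeff p (c + 1) else coeff q (c - (n - k) + 1))"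

text \<open>The states \<open>(1, 0)\<close> and \<open>(0, 1)\<close> are the e- and the
  f-coordinates of the initial pair x = e_0, y = f_0; \<open>fst\<close> follows x, and
  \<open>snd\<close> in \<open>Yv\<close> follows y.\<close>

definition Xv :: "nat \<Rightarrow> nat \<Rightarrow> (nat \<Rightarrow> bool) \<Rightarrow> (nat \<Rightarrow> complex) \<Rightarrow> (nat \<Rightarrow> complex) \<Rightarrow> nat \<Rightarrow> complex vec" where
  "Xv n k v al be l = vecof n k (fst (st v al be (1, 0) l)) (fst (st v al be (0, 1) l))"

definition Yv :: "nat \<Rightarrow> nat \<Rightarrow> (nat \<Rightarrow> bool) \<Rightarrow> (nat \<Rightarrow> complex) \<Rightarrow> (nat \<Rightarrow> complex) \<Rightarrow> nat \<Rightarrow> complex vec" where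
  "Yv n k v al be l = vecof n k (snd (st v al be (1, 0) l)) (snd (st v al be (0, 1) l))"

definition Gm :: "nat \<Rightarrow> nat \<Rightarrow> (nat \<Rightarrow> bool) \<Rightarrow> (nat \<Rightarrow> complex) \<Rightarrow> (nat \<Rightarrow> complex) \<Rightarrow> complex mat" where
  "Gm n k v al be = mat n n (\<lambda>(r, c). (if v (Suc c) then Yv n k v al be (Suc c) else Xv n k v al be (Suc c)) $ r)"

definition bounded_pp :: "nat \<Rightarrow> pp \<Rightarrow> bool" where
  "bounded_pp D z \<longleftrightarrow> (\<forall>d>D. coeff (fst z) d = 0 \<and> coeff (snd z) d = 0)"

lemma vecof_carrier [simp]: "vecof n k p q \<in> carrier_vec n" "dim_vec (vecof n k p q) = n"
  by (simp_all add: vecof_def)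

lemma vecof_add_smult: "vecof n k (p + smult a p') (q + smult a q') = vecof n k p q + a \<cdot>\<^sub>v vecof n k p' q'"
  by (intro eq_vecI) (auto simp: vecof_def)

lemma vecof_diff_smult: "vecof n k (p - smult a p') (q - smult a q') = vecof n k p q + (- a) \<cdot>\<^sub>v vecof n k p' q'"
  by (intro eq_vecI) (auto simp: vecof_def)

text \<open>The two vanishing coefficients are those that multiplication by X would push past the
  ends of the Jordan blocks, where \<open>vecof\<close> cuts them off.\<close>

lemma Nmap_vecof:
  assumes "coeff p (n - k) = 0" "coeff q k = 0" "k \<le> n"
  shows "Nmap n k (vecof n k (pCons 0 p) (pCons 0 q)) = vecof n k p q"
proof (rule eq_vecI)
  fix c assume "c < dim_vec (vecof n k p q)"
  then have c: "c < n" by simp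
  consider "c + 1 < n - k" | "c + 1 = n - k" | "n - k \<le> c" "c + 1 < n" | "n - k \<le> c" "c + 1 = n" using c by linarith
  then show "Nmap n k (vecof n k (pCons 0 p) (pCons 0 q)) $ c = vecof n k p q $ c"
  proof cases
    case 2
    then have "coeff p (Suc c) = 0" using assms(1) by simp
    then show ?thesis using 2 c by (simp add: Nmap_def vecof_def)
  next
    case 4
    then have "c - (n - k) + 1 = k" using assms(3) by simp
    then have "coeff q (Suc (c - (n - k))) = 0" using assms(2) by simp
    then show ?thesis using 4 c by (simp add: Nmap_def vecof_def)
  next
    case 3
    then have "c + 1 - (n - k) = Suc (c - (n - k))" by simp
    then show ?thesis using 3 c by (simp add: Nmap_def vecof_def)
  qed (auto simp: Nmap_def vecof_def)
qed simp

text \<open>A bound after a step holds before it as well, since the multiple removed by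
  \<open>b\<close> is itself bounded and can be added back. Hence only the state at \<open>n\<close>
  has to be bounded.\<close>

lemma bounded_pp_upd:
  assumes "bounded_pp D (upd v a b z)"
  shows "bounded_pp D z"
    and "coeff ((if v then snd z + smult a (fst z) else fst z + smult a (snd z))) D = 0"
proof -
  have b1: "coeff (fst (upd v a b z)) d = 0" "coeff (snd (upd v a b z)) d = 0" if "D < d" for d
    using assms that by (auto simp: bounded_pp_def)
  show "coeff ((if v then snd z + smult a (fst z) else fst z + smult a (snd z))) D = 0"
    using b1[of "Suc D"] by (auto simp: upd_def split: if_splits)
  show "bounded_pp D z"
    unfolding bounded_pp_def
  proof (intro allI impI)
    fix d assume d: "D < d"
    then have d': "D < Suc d" by simp
    show "coeff (fst z) d = 0 \<and> coeff (snd z) d = 0"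
    proof (cases v)
      case True
      define w where "w = snd z + smult a (fst z)"
      have "coeff (fst z - smult b (pCons 0 w)) d = 0" "coeff (pCons 0 w) d = 0" "coeff (pCons 0 w) (Suc d) = 0"
        using b1[OF d] b1[OF d'] True unfolding upd_def w_def[symmetric] by simp_all
      then have "coeff (fst z) d = 0" "coeff w d = 0" by (simp_all del: smult_pCons)
      then show ?thesis by (simp add: w_def)
    next
      case False
      define w where "w = fst z + smult a (snd z)"
      have "coeff (snd z - smult b (pCons 0 w)) d = 0" "coeff (pCons 0 w) d = 0" "coeff (pCons 0 w) (Suc d) = 0"
        using b1[OF d] b1[OF d'] False unfolding upd_def w_def[symmetric] by simp_all
      then have "coeff (snd z) d = 0" "coeff w d = 0" by (simp_all del: smult_pCons)
      then show ?thesis by (simp add: w_def)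
    qed
  qed
qed

lemma bounded_pp_st:
  assumes "bounded_pp D (st v al be z n)" "l \<le> n"
  shows "bounded_pp D (st v al be z l)"
  using assms(2,1) by (induction rule: inc_induct) (auto dest: bounded_pp_upd)

lemma Gm_carrier [simp]: "Gm n k v al be \<in> carrier_mat n n"
  by (simp add: Gm_def)

lemma col_Gm: "c < n \<Longrightarrow> col (Gm n k v al be) c = (if v (Suc c) then Yv n k v al be (Suc c) else Xv n k v al be (Suc c))"
  by (intro eq_vecI) (auto simp: Gm_def Xv_def Yv_def)

lemma XY_Suc:
  "v (Suc l) \<Longrightarrow> Xv n k v al be (Suc l) = Xv n k v al be l + (- be (Suc l)) \<cdot>\<^sub>v Yv n k v al be (Suc l)"
  "\<not> v (Suc l) \<Longrightarrow> Yv n k v al be (Suc l) = Yv n k v al be l + (- be (Suc l)) \<cdot>\<^sub>v Xv n k v al be (Suc l)"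
  unfolding Xv_def Yv_def by (simp_all add: upd_def vecof_diff_smult del: smult_pCons)

lemma col_in_col_span: "g \<in> carrier_mat n n \<Longrightarrow> c < d \<Longrightarrow> d \<le> n \<Longrightarrow> col g c \<in> col_span n g d"
  using Nmap_pow_col_span_iff[of g n d "col_span n g d", where c = 0 and k = 0] col_span_subsp[of g n d] by auto

lemma XY_in_col_span:
  assumes "l \<le> n"
  shows "Xv n k v al be l \<in> col_span n (Gm n k v al be) l \<and> Yv n k v al be l \<in> col_span n (Gm n k v al be) l"
  using assms
proof (induction l)
  case 0
  have "vecof n k 1 0 = 0\<^sub>v n" "vecof n k 0 1 = 0\<^sub>v n" by (intro eq_vecI; simp add: vecof_def)+
  then show ?case using col_span_0[OF Gm_carrier] by (simp add: Xv_def Yv_def)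
next
  case (Suc l)
  let ?g = "Gm n k v al be"
  have S: "subsp n (col_span n ?g (Suc l))" by (rule col_span_subsp) simp
  have c: "col ?g l \<in> col_span n ?g (Suc l)" by (rule col_in_col_span) (use Suc.prems in auto)
  have IH: "Xv n k v al be l \<in> col_span n ?g (Suc l)" "Yv n k v al be l \<in> col_span n ?g (Suc l)"
    using Suc col_span_mono[of l "Suc l" n ?g] by auto
  show ?case
  proof (cases "v (Suc l)")
    case True
    then have y: "Yv n k v al be (Suc l) \<in> col_span n ?g (Suc l)" using c col_Gm[of l n] Suc.prems by simp
    then show ?thesis using subsp_comb[OF S IH(1) y] XY_Suc(1)[of v l n k al be] True by simp
  next
    case False
    then have x: "Xv n k v al be (Suc l) \<in> col_span n ?g (Suc l)" using c col_Gm[of l n] Suc.prems by simp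
    then show ?thesis using subsp_comb[OF S IH(2) x] XY_Suc(2)[of v l n k al be] False by simp
  qed
qed

lemma Nmap_col_Gm:
  assumes kn: "k \<le> n" and c: "c < n"
    and bd: "bounded_pp (n - k) (st v al be (1, 0) n)" "bounded_pp k (st v al be (0, 1) n)"
  shows "Nmap n k (col (Gm n k v al be) c) = (if v (Suc c)
      then Yv n k v al be c + al (Suc c) \<cdot>\<^sub>v Xv n k v al be c
      else Xv n k v al be c + al (Suc c) \<cdot>\<^sub>v Yv n k v al be c)"
proof -
  have b: "bounded_pp (n - k) (upd (v (Suc c)) (al (Suc c)) (be (Suc c)) (st v al be (1, 0) c))"
    "bounded_pp k (upd (v (Suc c)) (al (Suc c)) (be (Suc c)) (st v al be (0, 1) c))"
    using bounded_pp_st[OF bd(1), of "Suc c"] bounded_pp_st[OF bd(2), of "Suc c"] c by simp_all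
  note z = bounded_pp_upd(2)[OF b(1)] bounded_pp_upd(2)[OF b(2)]
  show ?thesis
  proof (cases "v (Suc c)")
    case True
    have "col (Gm n k v al be) c = vecof n k (pCons 0 (snd (st v al be (1, 0) c) + smult (al (Suc c)) (fst (st v al be (1, 0) c))))
        (pCons 0 (snd (st v al be (0, 1) c) + smult (al (Suc c)) (fst (st v al be (0, 1) c))))"
      using True c by (simp add: col_Gm Yv_def upd_def)
    then show ?thesis using Nmap_vecof[of _ n k, OF z[unfolded if_P[OF True]] kn] True
      by (simp add: vecof_add_smult Xv_def Yv_def)
  next
    case False
    have "col (Gm n k v al be) c = vecof n k (pCons 0 (fst (st v al be (1, 0) c) + smult (al (Suc c)) (snd (st v al be (1, 0) c))))
        (pCons 0 (fst (st v al be (0, 1) c) + smult (al (Suc c)) (snd (st v al be (0, 1) c))))"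
      using False c by (simp add: col_Gm Xv_def upd_def)
    then show ?thesis using Nmap_vecof[of _ n k, OF z[unfolded if_not_P[OF False]] kn] False
      by (simp add: vecof_add_smult Xv_def Yv_def)
  qed
qed

lemma Nmap_col_span_Gm:
  assumes kn: "k \<le> n" and p: "p < n"
    and bd: "bounded_pp (n - k) (st v al be (1, 0) n)" "bounded_pp k (st v al be (0, 1) n)"
  shows "Nmap n k ` col_span n (Gm n k v al be) (Suc p) \<subseteq> col_span n (Gm n k v al be) p"
proof -
  let ?g = "Gm n k v al be"
  have S: "subsp n (col_span n ?g p)" by (rule col_span_subsp) simp
  have "Nmap n k (col ?g c) \<in> col_span n ?g p" if "c < Suc p" for c
  proof -
    have "Nmap n k (col ?g c) \<in> col_span n ?g c"
      unfolding Nmap_col_Gm[OF kn less_le_trans[OF that Suc_leI[OF p]] bd]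
      using XY_in_col_span[of c n k v al be] subsp_comb[OF col_span_subsp[OF Gm_carrier]] that p by auto
    then show ?thesis using col_span_mono[of c p n ?g] that by auto
  qed
  then show ?thesis
    using Nmap_pow_col_span_iff[OF Gm_carrier _ S, of "Suc p" 1 k] p by simp
qed

lemma GLnI_surj:
  assumes g: "g \<in> carrier_mat n n" and s: "carrier_vec n \<subseteq> col_span n g n"
  shows "g \<in> GLn n"
proof -
  have "\<forall>j. \<exists>u. u \<in> carrier_vec n \<and> g *\<^sub>v u = unit_vec n j"
  proof
    fix j
    have "unit_vec n j \<in> col_span n g n" using s by auto
    then show "\<exists>u. u \<in> carrier_vec n \<and> g *\<^sub>v u = unit_vec n j" unfolding col_span_def by auto
  qed
  then obtain u where u: "\<And>j. u j \<in> carrier_vec n" "\<And>j. g *\<^sub>v u j = unit_vec n j" by metis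
  define h where "h = mat n n (\<lambda>(i, j). u j $ i)"
  have h: "h \<in> carrier_mat n n" by (simp add: h_def)
  have "g * h = 1\<^sub>m n"
  proof (rule eq_matI)
    fix i j assume "i < dim_row (1\<^sub>m n)" "j < dim_col (1\<^sub>m n)"
    then have ij: "i < n" "j < n" by auto
    have "col h j = u j" using ij u(1)[of j] by (intro eq_vecI) (auto simp: h_def)
    then have "(g * h) $$ (i, j) = (g *\<^sub>v u j) $ i" using g h ij by simp
    then show "(g * h) $$ (i, j) = 1\<^sub>m n $$ (i, j)" using u(2)[of j] ij by (simp add: unit_vec_def)
  qed (use g h in auto)
  then have "det g * det h = 1" using det_mult[OF g h] by simp
  then show ?thesis using g by (auto simp: GLn_def)
qed

text \<open>The final generators are x = e_(n-k) and y = f_k, which generate the two Jordan blocks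
  under N. Since the span of the columns is N-stable, it is the whole space.\<close>

lemma Gm_GLn:
  assumes kn: "2 * k \<le> n" "0 < n"
    and e: "st v al be (1, 0) n = (monom 1 (n - k), 0)" and f: "st v al be (0, 1) n = (0, monom 1 k)"
  shows "Gm n k v al be \<in> GLn n"
proof (rule GLnI_surj)
  let ?g = "Gm n k v al be"
  have bd: "bounded_pp (n - k) (st v al be (1, 0) n)" "bounded_pp k (st v al be (0, 1) n)"
    unfolding e f by (auto simp: bounded_pp_def)
  have S: "subsp n (col_span n ?g n)" by (rule col_span_subsp) simp
  have N: "Nmap n k ` col_span n ?g n \<subseteq> col_span n ?g n"
    using Nmap_col_span_Gm[of k n "n - 1" v al be, OF _ _ bd] kn col_span_mono[of "n - 1" n n ?g] by auto
  have X: "Xv n k v al be n \<in> col_span n ?g n" and Y: "Yv n k v al be n \<in> col_span n ?g n"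
    using XY_in_col_span[of n n k v al be] by auto
  have Xi: "Xv n k v al be n $ i = (if i = n - k - 1 then 1 else 0)" if "i < n" for i
    unfolding Xv_def e f vecof_def using that kn by auto
  have Yi: "Yv n k v al be n $ i = (if n - k \<le> i \<and> i = n - 1 then 1 else 0)" if "i < n" for i
    unfolding Yv_def e f vecof_def using that kn by auto
  show "carrier_vec n \<subseteq> col_span n ?g n"
  proof
    fix y :: "complex vec" assume y: "y \<in> carrier_vec n"
    let ?a = "vec n (\<lambda>i. if i < n - k then y $ i else 0)"
    have a: "?a \<in> col_span n ?g n"
    proof (rule stable_fill[OF S N, of 0 "n - k - 1" "Xv n k v al be n"])
      show "0 \<le> i \<and> i \<le> n - k - 1" if "i < n" "Xv n k v al be n $ i \<noteq> 0" for i
        using Xi[OF that(1)] that by (auto split: if_splits)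
      show "0 \<le> i \<and> i \<le> n - k - 1" if "i < n" "?a $ i \<noteq> 0" for i
        using that by (auto split: if_splits)
      show "Xv n k v al be n $ (n - k - 1) \<noteq> 0" using Xi[of "n - k - 1"] kn by simp
    qed (use X kn in auto)
    have b: "rho n k y \<in> col_span n ?g n"
    proof (cases "k = 0")
      case True
      then have "rho n k y = 0\<^sub>v n" using y by (intro eq_vecI) auto
      then show ?thesis using subspD(3)[OF S] by simp
    next
      case False
      show ?thesis
      proof (rule stable_fill[OF S N, of "n - k" "n - 1" "Yv n k v al be n"])
        show "n - k \<le> i \<and> i \<le> n - 1" if "i < n" "Yv n k v al be n $ i \<noteq> 0" for i
          using Yi[OF that(1)] that by (auto split: if_splits)
        show "n - k \<le> i \<and> i \<le> n - 1" if "i < n" "rho n k y $ i \<noteq> 0" for i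
          using that by (auto split: if_splits)
        show "Yv n k v al be n $ (n - 1) \<noteq> 0" using Yi[of "n - 1"] kn False by simp
      qed (use Y kn False in auto)
    qed
    have "y = ?a + rho n k y" using y by (intro eq_vecI) auto
    then show "y \<in> col_span n ?g n" using subspD(4)[OF S a b] by simp
  qed
qed simp

section \<open>Entrywise limits of matrices\<close>

lemma st_cong:
  "(\<And>l. 1 \<le> l \<Longrightarrow> l \<le> L \<Longrightarrow> al l = al' l \<and> be l = be' l) \<Longrightarrow> st v al be z L = st v al' be' z L"
  by (induction L) auto

lemma tendsto_st:
  assumes "\<And>l. (\<lambda>m. al m l) \<longlonglongrightarrow> al0 l" "\<And>l. (\<lambda>m. be m l) \<longlonglongrightarrow> be0 l"
  shows "(\<lambda>m. coeff (fst (st v (al m) (be m) z l)) d) \<longlonglongrightarrow> coeff (fst (st v al0 be0 z l)) d \<and>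
         (\<lambda>m. coeff (snd (st v (al m) (be m) z l)) d) \<longlonglongrightarrow> coeff (snd (st v al0 be0 z l)) d"
proof (induction l arbitrary: d)
  case (Suc l)
  show ?case
    by (cases d; cases "v (Suc l)") (auto simp: upd_def intro!: tendsto_intros assms Suc[THEN conjunct1] Suc[THEN conjunct2])
qed simp

lemma tendsto_Gm:
  assumes "\<And>l. (\<lambda>m. al m l) \<longlonglongrightarrow> al0 l" "\<And>l. (\<lambda>m. be m l) \<longlonglongrightarrow> be0 l" "i < n" "j < n"
  shows "(\<lambda>m. Gm n k v (al m) (be m) $$ (i, j)) \<longlonglongrightarrow> Gm n k v al0 be0 $$ (i, j)"
  using tendsto_st[OF assms(1,2)] assms(3,4)
  by (cases "v (Suc j)"; cases "i < n - k") (simp_all add: Gm_def Xv_def Yv_def vecof_def del: st.simps)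

lemma tendsto_polyfun:
  assumes "p \<in> polyfun n" "\<And>i j. i < n \<Longrightarrow> j < n \<Longrightarrow> (\<lambda>m. g m $$ (i, j)) \<longlonglongrightarrow> g0 $$ (i, j)"
  shows "(\<lambda>m. p (g m)) \<longlonglongrightarrow> p g0"
  using assms(1) by induction (auto intro!: tendsto_intros assms(2))

text \<open>Polynomial functions are continuous for entrywise convergence, so their equations pass
  from all \<open>g m\<close> to the limit. Invertibility of \<open>g0\<close> is what lets the
  limit represent a flag.\<close>

lemma limit_in_flag_zclosure:
  assumes g: "\<And>m. g m \<in> GLn n" "\<And>m. flag_of n is (g m) \<in> S" and g0: "g0 \<in> GLn n"
    and lim: "\<And>i j. i < n \<Longrightarrow> j < n \<Longrightarrow> (\<lambda>m. g m $$ (i, j)) \<longlonglongrightarrow> g0 $$ (i, j)"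
  shows "flag_of n is g0 \<in> flag_zclosure n is S"
  unfolding flag_zclosure_def
proof (rule InterI)
  fix D assume "D \<in> {D. flag_zclosed n is D \<and> S \<subseteq> D}"
  then have D: "flag_zclosed n is D" "S \<subseteq> D" by auto
  then obtain Ps where Ps: "Ps \<subseteq> polyfun n" "{g \<in> GLn n. flag_of n is g \<in> D} = {g \<in> GLn n. \<forall>p\<in>Ps. p g = 0}"
    unfolding flag_zclosed_def GL_zclosed_def by blast
  have "p g0 = 0" if p: "p \<in> Ps" for p
  proof -
    have "g m \<in> {g \<in> GLn n. flag_of n is g \<in> D}" for m using g D by blast
    then have "p (g m) = 0" for m using Ps(2) p by blast
    then have "(\<lambda>m. p (g m)) \<longlonglongrightarrow> 0" by simp
    moreover have "(\<lambda>m. p (g m)) \<longlonglongrightarrow> p g0" by (rule tendsto_polyfun) (use Ps(1) p lim in auto)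
    ultimately show ?thesis using LIMSEQ_unique by blast
  qed
  with g0 have "g0 \<in> {g \<in> GLn n. flag_of n is g \<in> D}" unfolding Ps(2) by blast
  then show "flag_of n is g0 \<in> D" by simp
qed

text \<open>A crossed pair is treated as an e-step followed by an f-step.\<close>

definition vlab :: "nat list \<Rightarrow> (int \<Rightarrow> bool) \<Rightarrow> nat \<Rightarrow> bool" where
  "vlab is lam l = (if l \<in> double_entries is then True
     else if Suc l \<in> double_entries is then False else lam (int l))"

definition mulp :: "nat \<Rightarrow> pp \<Rightarrow> pp" where
  "mulp c z = (monom 1 c * fst z, monom 1 c * snd z)"

lemma mulp_0 [simp]: "mulp 0 z = z"
  by (simp add: mulp_def)

lemma mulp_mulp: "mulp a (mulp b z) = mulp (a + b) z"
  by (simp add: mulp_def mult_monom mult.assoc[symmetric])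

lemma mulp_Suc: "mulp (Suc c) z = (pCons 0 (monom 1 c * fst z), pCons 0 (monom 1 c * snd z))"
  by (simp add: mulp_def monom_Suc)

lemma upd_cross: "upd True 0 0 (upd False 0 0 z) = mulp 1 z"
  by (simp add: upd_def mulp_Suc)

text \<open>The core of the deformation: the base change with parameter \<open>c\<close> at the left
  end is undone at the right end, so the whole cup multiplies both generators by X^(d+1), whatever
  \<open>c\<close> is. The flag changes only inside the cup.\<close>

lemma upd_cup: "upd (\<not> v) 0 c (mulp d (upd v c 0 z)) = mulp (d + 1) z"
  by (cases v) (simp_all add: upd_def mulp_def monom_Suc algebra_simps smult_add_right)

lemma coeff_mulp: "coeff (fst (mulp c z)) (d + c) = coeff (fst z) d" "coeff (snd (mulp c z)) (d + c) = coeff (snd z) d"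
  by (simp_all add: mulp_def coeff_monom_mult)

lemma bounded_mulp: "bounded_pp D z \<Longrightarrow> bounded_pp (D + c) (mulp c z)"
  by (auto simp: bounded_pp_def mulp_def coeff_monom_mult)

section \<open>Deformed flags of an oriented diagram\<close>

context two_row_tableau
begin

text \<open>One free parameter per black cup, indexed by its left end; \<open>be\<close> looks it up
  again at the right end. At crossed and green points both vanish.\<close>

definition al :: "(nat \<Rightarrow> complex) \<Rightarrow> nat \<Rightarrow> complex" where
  "al s l = (if \<exists>j. black l j then s l else 0)"

definition be :: "(nat \<Rightarrow> complex) \<Rightarrow> nat \<Rightarrow> complex" where
  "be s l = (if \<exists>i. black i l then s (THE i. black i l) else 0)"

lemma black_unique: "black i j \<Longrightarrow> black i' j \<Longrightarrow> i = i'"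
  using CD(7)[of "int i" "int j" "int i'"] by (simp add: black_def)

lemma black_not_both: "black i j \<Longrightarrow> \<not> black j l"
  using C_disj[of "int i" "int j" "int l"] by (auto simp: black_def)

lemma be_black: "black i j \<Longrightarrow> be s j = s i"
  unfolding be_def using black_unique by (metis (mono_tags, lifting) theI_unique)

lemma al_black: "black i j \<Longrightarrow> al s i = s i" and al_black_right: "black i j \<Longrightarrow> al s j = 0"
  and be_black_left: "black i j \<Longrightarrow> be s i = 0"
  unfolding al_def be_def using black_not_both by auto

lemma al_be_crs: "crs l \<Longrightarrow> al s l = 0 \<and> be s l = 0"
  unfolding al_def be_def using blackD(11,12) by auto

lemma al_be_zero: "al (\<lambda>_. 0) = (\<lambda>_. 0)" "be (\<lambda>_. 0) = (\<lambda>_. 0)"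
  by (auto simp: al_def be_def)

lemma green_outer:
  "(p, int b) \<in> C \<Longrightarrow> p < 1 \<Longrightarrow> b \<le> n \<Longrightarrow> outer_pos b"
  "(int b, q) \<in> C \<Longrightarrow> int n < q \<Longrightarrow> 1 \<le> b \<Longrightarrow> outer_pos b"
proof -
  show "outer_pos b" if a: "(p, int b) \<in> C" "p < 1" "b \<le> n"
    unfolding outer_pos_def
  proof (intro conjI allI impI notI)
    show "b \<in> pos" using green_left(2)[OF a] by (simp add: lclosed_def)
    fix i j assume bl: "black i j" and ij: "i \<le> b \<and> b < j"
    note D = blackD[OF bl]
    have "i \<noteq> b" using C_disj[OF a(1)] D(1) by blast
    then have "int i < p" using C_nest'[OF D(1) a(1)] ij by simp
    then show False using a(2) D(2) by simp
  qed
  show "outer_pos b" if a: "(int b, q) \<in> C" "int n < q" "1 \<le> b"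
    unfolding outer_pos_def
  proof (intro conjI allI impI notI)
    show "b \<in> pos" using green_right(2)[OF a] by (simp add: rclosed_def)
    fix i j assume bl: "black i j" and ij: "i \<le> b \<and> b < j"
    note D = blackD[OF bl]
    have "i \<noteq> b"
    proof
      assume "i = b"
      then have "int j = q" using CD(6)[OF D(1)] a(1) by blast
      then show False using D(4) a(2) by simp
    qed
    then have "q < int j" using C_nest[OF D(1) a(1)] ij by simp
    then show False using a(2) D(4) by simp
  qed
qed

lemma green_params:
  assumes "(\<exists>p<1. (p, int b) \<in> C) \<or> (\<exists>q>int n. (int b, q) \<in> C)"
  shows "al s b = 0" "be s b = 0" "\<not> black b j" "\<not> black i b"
proof -
  have nl: "\<not> black b j" for j
  proof
    assume bl: "black b j"
    note D = blackD[OF bl]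
    from assms show False
    proof (elim disjE exE conjE)
      fix p assume "(p, int b) \<in> C" then show False using C_disj D(1) by blast
    next
      fix q assume "int n < q" "(int b, q) \<in> C"
      then show False using CD(6)[OF D(1)] D(4) by force
    qed
  qed
  have nr: "\<not> black i b" for i
  proof
    assume bl: "black i b"
    note D = blackD[OF bl]
    from assms show False
    proof (elim disjE exE conjE)
      fix p :: int assume "p < 1" "(p, int b) \<in> C"
      then show False using CD(7)[OF D(1)] D(2) by force
    next
      fix q assume "(int b, q) \<in> C" then show False using C_disj[OF D(1)] by blast
    qed
  qed
  show "al s b = 0" "be s b = 0" "\<not> black b j" "\<not> black i b" using nl nr by (auto simp: al_def be_def)
qed

context
  fixes lam :: "int \<Rightarrow> bool"
  assumes lam: "orient n C lam"
begin

abbreviation "v \<equiv> vlab is lam"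
abbreviation S :: "(nat \<Rightarrow> complex) \<Rightarrow> pp \<Rightarrow> nat \<Rightarrow> pp" where "S s \<equiv> st v (al s) (be s)"

lemma v_single: "\<not> crs l \<Longrightarrow> v l = lam (int l)"
  by (simp add: vlab_def crs_def)

lemma v_black: "black i j \<Longrightarrow> v j = (\<not> v i)"
  using lam blackD(1)[of i j] v_single[OF blackD(11)] v_single[OF blackD(12)] unfolding orient_def by auto

lemma v_cross: "b + 2 \<in> dbl \<Longrightarrow> \<not> v (Suc b)" "b + 2 \<in> dbl \<Longrightarrow> v (Suc (Suc b))"
  using dbl_not_Suc[of "Suc b"] by (auto simp: vlab_def)

lemma S_cross: "b + 2 \<in> dbl \<Longrightarrow> S s z (b + 2) = mulp 1 (S s z b)"
proof -
  assume d: "b + 2 \<in> dbl"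
  then have "crs (Suc b)" "crs (Suc (Suc b))" by (auto simp: crs_def)
  then show ?thesis using v_cross[OF d] al_be_crs[of "Suc b" s] al_be_crs[of "Suc (Suc b)" s]
    by (simp add: upd_cross)
qed

lemma S_Suc: "1 \<le> l \<Longrightarrow> S s z l = upd (v l) (al s l) (be s l) (S s z (l - 1))"
  by (cases l) auto

text \<open>By \<open>upd_cup\<close> and \<open>upd_cross\<close> each piece of the segment
  multiplies the state by a power of X, whatever the parameters and the orientation of the
  cups.\<close>

lemma S_closed:
  assumes "closed_seg a b"
  shows "S s z b = mulp ((b - a) div 2) (S s z a)"
  using assms
proof (induction rule: closed_induct)
  case (refl a)
  then show ?case by simp
next
  case (cross a b)
  have "a \<le> b" using closed_counts[OF cross.hyps(1)] by simp
  then have e: "(b + 2 - a) div 2 = 1 + (b - a) div 2" by (simp add: Suc_diff_le)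
  show ?case unfolding e S_cross[OF cross.hyps(2)] cross.IH mulp_mulp by (rule refl)
next
  case (cup a i j)
  note D = blackD[OF cup.hyps(2)]
  define m where "m = (i - 1 - a) div 2"
  define d where "d = (j - 1 - i) div 2"
  have 1: "even (i - 1 - a)" "a \<le> i - 1" "even (j - 1 - i)" "i \<le> j - 1"
    using closed_counts[OF cup.hyps(1)] closed_counts[OF cup.hyps(3)] by auto
  then have im: "i - 1 = a + 2 * m" "j - 1 = i + 2 * d" by (auto simp: m_def d_def)
  then have e: "(j - a) div 2 = (d + 1) + m" using D by auto
  have "S s z j = upd (v j) (al s j) (be s j) (S s z (j - 1))" by (rule S_Suc) (use D in simp)
  also have "S s z (j - 1) = mulp d (S s z i)" using cup.IH(2) by (simp add: d_def)
  also have "S s z i = upd (v i) (al s i) (be s i) (S s z (i - 1))" by (rule S_Suc) (use D in simp)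
  finally have "S s z j = upd (\<not> v i) 0 (s i) (mulp d (upd (v i) (s i) 0 (S s z (i - 1))))"
    using cup.hyps(2) by (simp add: v_black al_black al_black_right be_black be_black_left)
  also have "\<dots> = mulp (d + 1) (S s z (i - 1))" by (rule upd_cup)
  finally show ?case using cup.IH(1) unfolding e by (simp add: mulp_mulp m_def)
qed

text \<open>At a green point the orientation agrees with the weight label, because the other end is
  an outer point whose label is fixed; so the step raises the degree belonging to the right row. The
  outcome is independent of \<open>s\<close>, and at \<open>n\<close> it makes every deformed matrix
  invertible.\<close>

lemma S_outer:
  assumes "outer_pos b"
  shows "S s (1, 0) b = (monom 1 (T b), 0) \<and> S s (0, 1) b = (0, monom 1 (B b))"
  using assms
proof (induction rule: outer_induct)
  case zero
  then show ?case by simp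
next
  case (cross b)
  then show ?case using S_cross[OF cross.hyps(2)] T_dbl[OF cross.hyps(2)] B_dbl[OF cross.hyps(2)]
    by (simp add: mulp_def mult_monom del: st.simps)
next
  case (cup i j)
  note cl = closed_cup[OF cup.hyps(2)]
  show ?case using S_closed[OF cl] closed_counts[OF cl] cup.IH
    by (simp add: mulp_def mult_monom add.commute)
next
  case (green b)
  note gp = green_params[OF green.hyps(5)]
  have S1: "S s z b = upd (lam (int b)) 0 0 (S s z (b - 1))" for z
    using S_Suc[OF green.hyps(2)] gp v_single[OF green.hyps(4)] by simp
  have "lam (int b) \<longleftrightarrow> lab (int b) = Some Down"
    using green.hyps(5)
  proof (elim disjE exE conjE)
    fix p :: int assume p: "p < 1" "(p, int b) \<in> C"
    then have "lam p" "lam p \<noteq> lam (int b)" using lam by (auto simp: orient_def left_outer_def joined_iff)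
    then show ?thesis using CD(4)[OF p(2)] by simp
  next
    fix q assume q: "int n < q" "(int b, q) \<in> C"
    then have "\<not> lam q" "lam (int b) \<noteq> lam q" using lam by (auto simp: orient_def right_outer_def joined_iff)
    then show ?thesis using CD(3)[OF q(2)] by simp
  qed
  moreover have "lab (int b) = Some Up \<or> lab (int b) = Some Down"
    using joined_lab[of "int b"] joined_inner_iff[OF green.hyps(2,3)] green.hyps(4) by blast
  ultimately show ?case unfolding S1 using green.IH T_single[OF green.hyps(2-4)] B_single[OF green.hyps(2-4)]
    by (auto simp: upd_def monom_Suc)
qed

definition Gs :: "(nat \<Rightarrow> complex) \<Rightarrow> complex mat" where
  "Gs s = Gm n k v (al s) (be s)"

lemma Sn: "S s (1, 0) n = (monom 1 (n - k), 0)" "S s (0, 1) n = (0, monom 1 k)"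
  using S_outer[OF outer_pos_n] T_n B_n by auto

lemma Sn_bounded: "bounded_pp (n - k) (S s (1, 0) n)" "bounded_pp k (S s (0, 1) n)"
  unfolding Sn by (auto simp: bounded_pp_def)

lemma Gs_GLn: "Gs s \<in> GLn n"
  unfolding Gs_def by (rule Gm_GLn[OF kn n_pos Sn])

lemma Gs_good: "good (Gs s)"
  unfolding good_def
proof (intro conjI ballI Gs_GLn)
  have k: "k \<le> n" using kn by simp
  fix p assume p: "p \<in> set is"
  then have p0: "0 < p" "p \<le> n" using is_pos is_le by auto
  note N = Nmap_col_span_Gm[OF k _ Sn_bounded[of s]]
  show "Nmap n k ` col_span n (Gs s) p \<subseteq> col_span n (Gs s) (prv p)"
  proof (cases "p \<in> dbl")
    case False
    then show ?thesis using N[of "p - 1"] p0 by (simp add: prv_def Gs_def)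
  next
    case True
    define b where "b = p - 2"
    have b: "p = b + 2" using dblD(2)[OF True] by (simp add: b_def)
    have bn: "Suc b < n" using p0 b by simp
    have d: "b + 2 \<in> dbl" using True b by simp
    then have cr: "crs (Suc b)" "crs (Suc (Suc b))" by (auto simp: crs_def)
    let ?g = "Gm n k v (al s) (be s)"
    have Sb: "subsp n (col_span n ?g b)" by (rule col_span_subsp) simp
    have XY: "Xv n k v (al s) (be s) b \<in> col_span n ?g b" "Yv n k v (al s) (be s) b \<in> col_span n ?g b"
      using XY_in_col_span[of b n k v "al s" "be s"] bn by auto
    \<comment> \<open>That N carries F_(b+2) into F_b, not merely into F_(b+1), comes from the
      e-step of the crossed pair leaving y unchanged: N sends the vector of the f-step to the old
      y.\<close>
    have "Nmap n k (col ?g (Suc b)) = Yv n k v (al s) (be s) (Suc b) + 0 \<cdot>\<^sub>v Xv n k v (al s) (be s) (Suc b)"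
      using Nmap_col_Gm[OF k bn Sn_bounded[of s]] v_cross[OF d] al_be_crs[OF cr(2), of s] by simp
    also have "\<dots> = Yv n k v (al s) (be s) b"
      using XY_Suc(2)[of v b n k "al s" "be s"] v_cross[OF d] al_be_crs[OF cr(1), of s]
      by (intro eq_vecI) (auto simp: Xv_def Yv_def simp del: st.simps)
    finally have top: "Nmap n k (col ?g (Suc b)) \<in> col_span n ?g b" using XY by simp
    have "Nmap n k (col ?g c) \<in> col_span n ?g b" if c: "c < b + 2" for c
    proof (cases "c = Suc b")
      case False
      then have "col ?g c \<in> col_span n ?g (Suc b)" using col_in_col_span[of ?g n c "Suc b"] c bn by simp
      then show ?thesis using N[of b] bn by auto
    qed (use top in simp)
    then show ?thesis
      using Nmap_pow_col_span_iff[OF Gm_carrier _ Sb, of "b + 2" 1 k] bn True b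
      by (simp add: prv_def Gs_def)
  qed
qed

text \<open>At the left end of a black cup, a Down, \<open>B\<close> grows by one, so the
  combination that is multiplied by X must keep a nonzero coefficient of degree
  \<open>B (i - 1)\<close>. Failure is a single linear equation for \<open>s i\<close>.\<close>

definition step_good :: "(nat \<Rightarrow> complex) \<Rightarrow> nat \<Rightarrow> bool" where
  "step_good s i \<longleftrightarrow> (\<forall>j. black i j \<longrightarrow>
     coeff (if v i then snd (S s (0, 1) (i - 1)) + smult (s i) (fst (S s (0, 1) (i - 1)))
       else fst (S s (0, 1) (i - 1)) + smult (s i) (snd (S s (0, 1) (i - 1)))) (B (i - 1)) \<noteq> 0)"

text \<open>Membership in the cell amounts to the f-degree of the generators reaching the number of bottom
  entries. At most one value of the parameter at a cup makes the leading terms cancel.\<close>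

definition exact_at :: "(nat \<Rightarrow> complex) \<Rightarrow> nat \<Rightarrow> bool" where
  "exact_at s l \<longleftrightarrow> bounded_pp (B l) (S s (0, 1) l) \<and>
     (coeff (fst (S s (0, 1) l)) (B l) \<noteq> 0 \<or> coeff (snd (S s (0, 1) l)) (B l) \<noteq> 0)"

text \<open>Crossed pairs and right ends of black cups multiply an earlier state by a power of X,
  and green positions have monomial states. Left ends of black cups are the only places where a
  leading coefficient can cancel.\<close>

lemma exact_at_pos:
  assumes "\<And>i. i \<le> L \<Longrightarrow> step_good s i" "l \<in> pos" "l \<le> L"
  shows "exact_at s l"
  using assms(2,3)
proof (induction l rule: less_induct)
  case (less l)
  have shift: "exact_at s l" if "exact_at s a" "S s (0, 1) l = mulp c (S s (0, 1) a)" "B l = B a + c" for a c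
    using that bounded_mulp[of "B a" _ c] coeff_mulp[of c _ "B a"] unfolding exact_at_def by metis
  have outer: "exact_at s l" if "outer_pos l"
    using S_outer[OF that, of s] by (simp add: exact_at_def bounded_pp_def)
  from less.prems(1) show ?case
  proof (cases rule: pos_cases)
    case 1
    have "outer_pos 0" using blackD(2) by (force simp: outer_pos_def)
    then show ?thesis using outer 1 by simp
  next
    case 2
    then have e: "l - 2 + 2 = l" by simp
    have "S s (0, 1) l = mulp 1 (S s (0, 1) (l - 2))" using S_cross[of "l - 2"] 2 unfolding e by simp
    then show ?thesis using shift[of "l - 2" 1] less 2 B_dbl[OF 2(1)] by simp
  next
    case 3
    then have "int l \<in> joined C" using joined_inner_iff by simp
    then obtain y where y: "(int l, y) \<in> C \<or> (y, int l) \<in> C" by (auto simp: joined_iff)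
    show ?thesis
    proof (cases "(\<exists>p<1. (p, int l) \<in> C) \<or> (\<exists>q>int n. (int l, q) \<in> C)")
      case True
      then show ?thesis using outer green_outer 3 by blast
    next
      case False
      have "(\<exists>i. black i l) \<or> (\<exists>j. black l j)"
        using y
      proof
        assume a: "(int l, y) \<in> C"
        then have "y \<le> int n" using False by (meson not_le)
        then have "black l (nat y)" using a CD(2)[OF a] 3 by (simp add: black_def)
        then show ?thesis by blast
      next
        assume a: "(y, int l) \<in> C"
        then have "1 \<le> y" using False by (meson not_le)
        then have "black (nat y) l" using a CD(2)[OF a] 3 by (simp add: black_def)
        then show ?thesis by blast
      qed
      then show ?thesis
      proof (elim disjE exE)
        fix i assume bl: "black i l"
        note cl = closed_cup[OF bl] and D = blackD[OF bl]
        have "exact_at s (i - 1)" using less D by simp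
        then show ?thesis using shift[OF _ S_closed[OF cl]] closed_counts[OF cl] by simp
      next
        fix j assume bl: "black l j"
        note D = blackD[OF bl]
        have IH: "exact_at s (l - 1)" using less 3 by simp
        have g: "step_good s l" using assms(1) less.prems by simp
        have Bl: "B l = Suc (B (l - 1))" using B_single[OF 3(1-3)] D(13) by simp
        have Sl: "S s (0, 1) l = upd (v l) (s l) 0 (S s (0, 1) (l - 1))"
          using S_Suc[OF 3(1)] bl by (simp add: al_black be_black_left)
        have bd: "coeff (fst (S s (0, 1) (l - 1))) d = 0" "coeff (snd (S s (0, 1) (l - 1))) d = 0" if "B (l - 1) < d" for d
          using IH that by (auto simp: exact_at_def bounded_pp_def)
        have "bounded_pp (B l) (S s (0, 1) l)"
          unfolding bounded_pp_def Bl Sl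
        proof (intro allI impI)
          fix d assume d: "Suc (B (l - 1)) < d"
          then obtain d' where d': "d = Suc d'" "B (l - 1) < d'" by (cases d) auto
          show "coeff (fst (upd (v l) (s l) 0 (S s (0, 1) (l - 1)))) d = 0 \<and>
              coeff (snd (upd (v l) (s l) 0 (S s (0, 1) (l - 1)))) d = 0"
            using bd[OF d'(2)] bd[of d] d unfolding d'(1) by (auto simp: upd_def)
        qed
        moreover have "coeff (fst (S s (0, 1) l)) (B l) \<noteq> 0 \<or> coeff (snd (S s (0, 1) l)) (B l) \<noteq> 0"
          using g bl unfolding step_good_def Bl Sl by (auto simp: upd_def split: if_splits)
        ultimately show ?thesis by (simp add: exact_at_def)
      qed
    qed
  qed
qed

text \<open>Parameters are chosen from left to right: the earlier ones enter the condition at a left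
  end only through the state before it, where exactness supplies a coefficient pair (a, b) other
  than (0, 0). Then a + c b vanishes for at most one c, so one of two distinct candidates
  works.\<close>

lemma step_good_exists:
  assumes "c1 \<noteq> c2"
  shows "\<exists>s. (\<forall>i. s i \<in> {c1, c2}) \<and> (\<forall>i\<le>L. step_good s i)"
proof (induction L)
  case 0
  have "step_good (\<lambda>_. c1) 0" using blackD(2) by (force simp: step_good_def)
  then show ?case by (intro exI[of _ "\<lambda>_. c1"]) auto
next
  case (Suc L)
  then obtain s where s: "\<And>i. s i \<in> {c1, c2}" "\<And>i. i \<le> L \<Longrightarrow> step_good s i" by blast
  show ?case
  proof (cases "\<exists>j. black (Suc L) j")
    case False
    then have "step_good s (Suc L)" by (simp add: step_good_def)
    with s show ?thesis by (intro exI[of _ s]) (auto simp: le_Suc_eq)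
  next
    case True
    then obtain j where bl: "black (Suc L) j" by blast
    have ex: "exact_at s L" using exact_at_pos[of L s L] s(2) blackD(6)[OF bl] by simp
    define a where "a = coeff (if v (Suc L) then snd (S s (0, 1) L) else fst (S s (0, 1) L)) (B L)"
    define b where "b = coeff (if v (Suc L) then fst (S s (0, 1) L) else snd (S s (0, 1) L)) (B L)"
    have "a \<noteq> 0 \<or> b \<noteq> 0" using ex by (auto simp: exact_at_def a_def b_def)
    then have "a + c1 * b \<noteq> 0 \<or> a + c2 * b \<noteq> 0" using assms
      by (metis add.right_neutral add_left_imp_eq mult_cancel_right mult_zero_right)
    then obtain c where c: "c \<in> {c1, c2}" "a + c * b \<noteq> 0" by blast
    define s' where "s' = s(Suc L := c)"
    \<comment> \<open>Right ends up to \<open>Suc L\<close> belong to cups that start earlier, so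
      the changed parameter is not seen by them.\<close>
    have be: "be s' l = be s l" if "l \<le> Suc L" for l
    proof (cases "\<exists>i. black i l")
      case True
      then obtain i where i: "black i l" by blast
      then have "i \<noteq> Suc L" using blackD(3)[OF i] that by simp
      then show ?thesis using be_black[OF i] by (simp add: s'_def)
    qed (simp add: be_def)
    have S: "S s' z l = S s z l" if "l \<le> L" for z l
      by (rule st_cong) (use that be in \<open>auto simp: al_def s'_def\<close>)
    have "step_good s' i" if i: "i \<le> L" for i
    proof -
      have "S s' (0, 1) (i - 1) = S s (0, 1) (i - 1)" by (rule S) (use i in simp)
      moreover have "s' i = s i" using i by (simp add: s'_def)
      ultimately show ?thesis using s(2)[OF i] unfolding step_good_def by (simp only:)
    qed
    moreover have "step_good s' (Suc L)"
      using c(2) S[of L] by (simp add: step_good_def s'_def a_def b_def mult.commute split: if_splits)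
    moreover have "s' i \<in> {c1, c2}" for i using s(1) c(1) by (simp add: s'_def)
    ultimately show ?thesis by (intro exI[of _ s']) (auto simp: le_Suc_eq)
  qed
qed

lemma vecof_CS:
  assumes "\<And>d. D < d \<Longrightarrow> coeff q d = 0"
  shows "vecof n k p q \<in> CS n k (n - k) D"
proof -
  have "i - (n - k) < D" if "i < n" "\<not> i < n - k" "vecof n k p q $ i \<noteq> 0" for i
  proof (rule ccontr)
    assume "\<not> i - (n - k) < D"
    then have "coeff q (i - (n - k) + 1) = 0" by (intro assms) simp
    then show False using that by (simp add: vecof_def)
  qed
  then show ?thesis by (auto simp: CS_def not_less)
qed

text \<open>\<open>bp\<close> is at most \<open>B p\<close> since all columns up to \<open>p\<close>
  have f-degree at most \<open>B p\<close>, and at least \<open>B p\<close> since x or y reaches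
  that degree and N-stability fills in the smaller pivots. The value of \<open>tp\<close> follows
  from the dimension.\<close>

lemma Gs_cell:
  assumes sg: "\<And>i. i \<le> n \<Longrightarrow> step_good s i"
  shows "cell (Gs s)"
  unfolding cell_def
proof (intro conjI ballI Gs_good)
  note ex = exact_at_pos[OF sg]
  let ?g = "Gm n k v (al s) (be s)"
  fix p assume "p \<in> set is"
  then have p: "p \<in> pos" "p \<le> n" using is_le by (auto simp: pos_def)
  note S' = goodD(3)[OF Gs_good[of s], of p] and N = goodD(5)[OF Gs_good[of s] p(1)]
  have "col ?g c \<in> CS n k (n - k) (B p)" if c: "c < p" for c
  proof (cases "Suc c \<in> pos")
    case True
    have "exact_at s (Suc c)" by (rule ex[OF _ True]) (use c p in auto)
    then have "coeff (fst (S s (0, 1) (Suc c))) d = 0 \<and> coeff (snd (S s (0, 1) (Suc c))) d = 0" if "B p < d" for d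
      using that B_mono[of "Suc c" p] c unfolding exact_at_def bounded_pp_def by (simp del: st.simps)
    then show ?thesis using col_Gm[of c n] c p by (simp add: Xv_def Yv_def vecof_CS del: st.simps)
  next
    case False
    \<comment> \<open>\<open>Suc c\<close> is the first point of a crossed pair and not a flag
      dimension; the f-step that follows leaves x unchanged, so the degree bound is taken from
      position \<open>c + 2\<close>.\<close>
    then have "Suc c \<notin> dbl" "crs (Suc c)" using dblD(6) single(3)[of "Suc c"] c p by auto
    then have d: "c + 2 \<in> dbl" by (simp add: crs_def)
    have le: "Suc (Suc c) \<le> p" using False c p by (metis Suc_leI le_neq_implies_less)
    have "exact_at s (Suc (Suc c))" by (rule ex) (use le p dblD(6)[OF d] in auto)
    moreover have "fst (S s (0, 1) (Suc (Suc c))) = fst (S s (0, 1) (Suc c))"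
      using v_cross[OF d] al_be_crs[of "Suc (Suc c)" s] d by (simp add: upd_def crs_def)
    ultimately have "coeff (fst (S s (0, 1) (Suc c))) e = 0" if "B p < e" for e
      using that B_mono[OF le] unfolding exact_at_def bounded_pp_def by (simp del: st.simps)
    then show ?thesis using col_Gm[of c n] c p v_cross(1)[OF d] by (simp add: Xv_def vecof_CS del: st.simps)
  qed
  then have "col_span n (Gs s) p \<subseteq> CS n k (n - k) (B p)"
    using Nmap_pow_col_span_iff[OF Gm_carrier p(2) CS_subsp, where c = 0] unfolding Gs_def by simp
  then have le: "bp n k (col_span n (Gs s) p) \<le> B p" by (rule tp_bp_CS)
  have ge: "B p \<le> bp n k (col_span n (Gs s) p)"
  proof (cases "B p")
    case (Suc b)
    have bk: "B p \<le> k" using B_le[OF p(1)] .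
    have E: "exact_at s p" by (rule ex[OF _ p]) simp
    have XY: "Xv n k v (al s) (be s) p \<in> col_span n (Gs s) p" "Yv n k v (al s) (be s) p \<in> col_span n (Gs s) p"
      using XY_in_col_span[OF p(2), of k v "al s" "be s"] by (auto simp: Gs_def)
    have ld: "leads n (vecof n k P Q) (n - k + b)" if Q: "coeff Q (B p) \<noteq> 0" "\<And>d. B p < d \<Longrightarrow> coeff Q d = 0" for P Q
      unfolding leads_def
    proof (intro conjI allI impI)
      show "n - k + b < n" using bk Suc kn by simp
      then show "vecof n k P Q $ (n - k + b) \<noteq> 0" using Q(1) Suc by (simp add: vecof_def)
      fix i assume i: "n - k + b < i" "i < n"
      then have "coeff Q (i - (n - k) + 1) = 0" by (intro Q(2)) (use Suc in simp)
      then show "vecof n k P Q $ i = 0" using i by (simp add: vecof_def)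
    qed
    have "n - k + b \<in> piv n (col_span n (Gs s) p)"
      using E ld XY unfolding exact_at_def bounded_pp_def piv_def Xv_def Yv_def by blast
    then have "n - k + b \<in> {n - k..<n - k + bp n k (col_span n (Gs s) p)}"
      unfolding piv_stable(2)[OF S' N, symmetric] by simp
    then show ?thesis using Suc by simp
  qed simp
  have "tp n k (col_span n (Gs s) p) = T p" "bp n k (col_span n (Gs s) p) = B p"
    using le ge good_dim[OF Gs_good p(2), of s] TB[OF p(1)] by auto
  then show "Fprime n k (col_span n (Gs s) p) = CS n k (T p) (B p)"
    using Fprime_stable[OF S' N] by simp
qed

text \<open>With all parameters zero the matrix depends on the type and on \<open>lam\<close> only,
  so a common orientation of two diagrams yields the same flag for both tableaux. It is the limit of
  deformed flags that lie in the cell.\<close>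

lemma fixed_flag_in_Ytilde_w:
  "Gm n k v (\<lambda>_. 0) (\<lambda>_. 0) \<in> GLn n"
  "flag_of n is (Gm n k v (\<lambda>_. 0) (\<lambda>_. 0)) \<in> Ytilde_w n k is w"
proof -
  have G0: "Gm n k v (\<lambda>_. 0) (\<lambda>_. 0) = Gs (\<lambda>_. 0)" by (simp add: Gs_def al_be_zero)
  show g0: "Gm n k v (\<lambda>_. 0) (\<lambda>_. 0) \<in> GLn n" unfolding G0 by (rule Gs_GLn)
  \<comment> \<open>Consecutive members of this null sequence are the two distinct candidates
    offered to every cup.\<close>
  define c :: "nat \<Rightarrow> complex" where "c m = of_real (inverse (real (Suc m)))" for m
  have "\<forall>m. \<exists>s. (\<forall>i. s i \<in> {c m, c (Suc m)}) \<and> (\<forall>i\<le>n. step_good s i)"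
  proof
    fix m
    have "c m \<noteq> c (Suc m)" by (simp add: c_def)
    from step_good_exists[OF this, of n] show "\<exists>s. (\<forall>i. s i \<in> {c m, c (Suc m)}) \<and> (\<forall>i\<le>n. step_good s i)" .
  qed
  then obtain s where s: "\<And>m i. s m i \<in> {c m, c (Suc m)}" "\<And>m i. i \<le> n \<Longrightarrow> step_good (s m) i" by metis
  have bd: "norm (s m i) \<le> inverse (real (Suc m))" for m i
  proof -
    have "s m i = c m \<or> s m i = c (Suc m)" using s(1)[of m i] by simp
    moreover have "inverse (real (Suc (Suc m))) \<le> inverse (real (Suc m))" by (intro le_imp_inverse_le) auto
    ultimately show ?thesis unfolding c_def by (elim disjE) (simp_all only: norm_of_real abs_inverse abs_of_nat)
  qed
  have lim: "(\<lambda>m. f m) \<longlonglongrightarrow> 0" if "\<And>m. norm (f m) \<le> inverse (real (Suc m))" for f :: "nat \<Rightarrow> complex"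
  proof (rule tendsto_norm_zero_cancel)
    show "(\<lambda>m. norm (f m)) \<longlonglongrightarrow> 0"
      by (rule tendsto_sandwich[OF _ _ tendsto_const LIMSEQ_inverse_real_of_nat]) (use that in auto)
  qed
  have al: "(\<lambda>m. al (s m) l) \<longlonglongrightarrow> 0" and be: "(\<lambda>m. be (s m) l) \<longlonglongrightarrow> 0" for l
    by (rule lim, use bd in \<open>simp add: al_def be_def\<close>)+
  have "flag_of n is (Gm n k v (\<lambda>_. 0) (\<lambda>_. 0)) \<in>
    flag_zclosure n is {F \<in> Ytilde n k is. map (Fprime n k) F = map (coord_space n k w) is}"
  proof (rule limit_in_flag_zclosure[OF _ _ g0])
    show "Gs (s m) \<in> GLn n" for m by (rule Gs_GLn)
    show "flag_of n is (Gs (s m)) \<in> {F \<in> Ytilde n k is. map (Fprime n k) F = map (coord_space n k w) is}" for m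
      using cell_iff[OF Gs_GLn] Gs_cell[OF s(2)] by blast
    show "(\<lambda>m. Gs (s m) $$ (i, j)) \<longlonglongrightarrow> Gm n k v (\<lambda>_. 0) (\<lambda>_. 0) $$ (i, j)" if "i < n" "j < n" for i j
      unfolding Gs_def by (rule tendsto_Gm[OF al be that])
  qed
  moreover have "flag_of n is (Gm n k v (\<lambda>_. 0) (\<lambda>_. 0)) \<in> Ytilde n k is"
    using Ytilde_iff[OF g0] Gs_good unfolding G0 by blast
  ultimately show "flag_of n is (Gm n k v (\<lambda>_. 0) (\<lambda>_. 0)) \<in> Ytilde_w n k is w"
    by (simp add: Ytilde_w_def)
qed

end

end

theorem theorem7p4:
  fixes n k :: nat and "is" :: "nat list" and w w' :: tableau
  assumes "2 * k \<le> n"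
    and "valid_type n is"
    and "row_strict_tableau n k is w"
    and "row_strict_tableau n k is w'"
  shows "Ytilde_w n k is w \<inter> Ytilde_w n k is w' = {} \<longleftrightarrow> has_red_circle n k is w w'"
proof -
  have tabs: "two_row_tableau n k is w" "two_row_tableau n k is w'" using assms by (simp_all add: two_row_tableau_def)
  have "Ytilde_w n k is w \<inter> Ytilde_w n k is w' \<noteq> {} \<longleftrightarrow>
    (\<exists>lam. orient n (ext_cups n k is w) lam \<and> orient n (ext_cups n k is w') lam)"
  proof
    assume "Ytilde_w n k is w \<inter> Ytilde_w n k is w' \<noteq> {}"
    then obtain F where F: "F \<in> Ytilde_w n k is w" "F \<in> Ytilde_w n k is w'" by blast
    then have "F \<in> FlagVar n is" by (simp add: Ytilde_w_def Ytilde_def)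
    then obtain g where g: "g \<in> GLn n" "F = flag_of n is g" by (auto simp: FlagVar_def)
    have "orient n (ext_cups n k is w) (lamF n k g)"
      using two_row_tableau.orient_lamF[OF tabs(1) g(1)] F(1) unfolding g(2) two_row_tableau.C_def[OF tabs(1)] by blast
    moreover have "orient n (ext_cups n k is w') (lamF n k g)"
      using two_row_tableau.orient_lamF[OF tabs(2) g(1)] F(2) unfolding g(2) two_row_tableau.C_def[OF tabs(2)] by blast
    ultimately show "\<exists>lam. orient n (ext_cups n k is w) lam \<and> orient n (ext_cups n k is w') lam" by blast
  next
    assume "\<exists>lam. orient n (ext_cups n k is w) lam \<and> orient n (ext_cups n k is w') lam"
    then obtain lam where "orient n (ext_cups n k is w) lam" "orient n (ext_cups n k is w') lam" by blast
    then show "Ytilde_w n k is w \<inter> Ytilde_w n k is w' \<noteq> {}"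
      using two_row_tableau.fixed_flag_in_Ytilde_w(2)[OF tabs(1), of lam] two_row_tableau.fixed_flag_in_Ytilde_w(2)[OF tabs(2), of lam]
      unfolding two_row_tableau.C_def[OF tabs(1)] two_row_tableau.C_def[OF tabs(2)] by blast
  qed
  then show ?thesis using has_red_circle_iff[OF tabs] by blast
qed

end
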